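(* Let $(X,d)$ be a separable ultra-metric space in which all closed balls are compact, let $\mu$ be a Radon measure on $X$ with full support, with $\mu(X)=\infty$ in the case when $X$ is non-compact, let $\sigma$ be a distance distribution function, and let $\mathcal{L}$ be the isotropic Laplacian associated with $(d,\mu,\sigma)$. Let $\mathcal{K}$ be the family of all balls in $X$ with positive radii, and for $C\in\mathcal{K}$ let $f_C$ and $\lambda(C)$ be defined as follows. If $C\ne X$ and $B$ is the parent of $C$, then $$f_C=\frac1{\mu(C)}\mathbf{1}_C-\frac1{\mu(B)}\mathbf{1}_B,\qquad\lambda(C)=\frac1{\rho(B)};$$ if $C=X$ (possible only when $X$ is compact), then $f_C\equiv1$ and $\lambda(C)=0$. Then for any $C\in\mathcal{K}$ the function $f_C$ is an eigenfunction of $\mathcal{L}$ with the eigenvalue $\lambda(C)$. The family $\{f_C:C\in\mathcal{K}\}$ is complete (its linear span is dense) in $L^2(X,\mu)$. Consequently, the operator $\mathcal{L}$ has a complete system of compactly supported eigenfunctions.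
   Context: Closed balls: $B_r(x)=\{y:d(x,y)\le r\}$; $\mathrm{Q}_rf(x)=\frac1{\mu(B_r(x))}\int_{B_r(x)}f\,d\mu$. A distance distribution function is a strictly increasing left-continuous function $\sigma:[0,\infty]\to[0,1]$ with $\sigma(0+)=0$, $\sigma(\infty)=1$. The isotropic Markov operator associated with $(d,\mu,\sigma)$ is $P=\int_{[0,\infty)}\mathrm{Q}_r\,d\sigma(r)$, self-adjoint in $L^2(X,\mu)$ with spectrum in $[0,1]$; the isotropic Laplacian is the non-negative definite self-adjoint operator $\mathcal{L}=\log\frac1P$ (functional calculus), so that $P^t=\exp(-t\mathcal{L})$. Intrinsic ultra-metric: $\frac1{d_*(x,y)}=\log\frac1{\sigma(d(x,y))}$ (with $d_*(x,x)=0$); it determines the same set of balls and the same topology as $d$. For a ball $B$ (regarded as a set), $\rho(B)$ denotes its minimal $d_*$-radius, i.e. the smallest $r\ge 0$ such that $B=\{y:d_*(x,y)\le r\}$ for $x\in B$. For balls $C\subset B$, $B$ is a parent of $C$ if $C\ne B$ and any ball $A$ with $C\subset A\subset B$ equals $C$ or $B$. Every ball $C\in\mathcal{K}$ with $C\ne X$ has a unique parent $B$, and $\rho(B)>0$. *)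

theory Defs
  imports "HOL-Analysis.Analysis"
begin

section \<open>The metric measure space and the distance distribution function\<close>

definition ultrametric :: "'a::metric_space itself \<Rightarrow> bool" where
  "ultrametric _ \<longleftrightarrow> (\<forall>x y z::'a. dist x z \<le> max (dist x y) (dist y z))"

definition radon_measure :: "'a::topological_space measure \<Rightarrow> bool" where
  "radon_measure M \<longleftrightarrow>
     sets M = sets borel \<and>
     (\<forall>K. compact K \<longrightarrow> emeasure M K < \<infinity>) \<and>
     (\<forall>A\<in>sets M. emeasure M A = (SUP K\<in>{K. compact K \<and> K \<subseteq> A}. emeasure M K))"

definition full_support :: "'a::topological_space measure \<Rightarrow> bool" where
  "full_support M \<longleftrightarrow> (\<forall>U. open U \<and> U \<noteq> {} \<longrightarrow> emeasure M U > 0)"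

text \<open>The domain \<open>[0,\<infinity>]\<close> is the type \<open>ennreal\<close>. Left continuity is required at \<open>\<infinity>\<close> too, so
  \<open>\<sigma> r\<close> tends to \<open>1\<close> as \<open>r\<close> tends to \<open>\<infinity>\<close>; at \<open>0\<close> it is void.\<close>

definition distance_distribution :: "(ennreal \<Rightarrow> real) \<Rightarrow> bool" where
  "distance_distribution \<sigma> \<longleftrightarrow>
     range \<sigma> \<subseteq> {0..1} \<and>
     strict_mono \<sigma> \<and>
     (\<forall>r. (\<sigma> \<longlongrightarrow> \<sigma> r) (at_left r)) \<and>
     (\<sigma> \<longlongrightarrow> 0) (at_right 0) \<and>
     \<sigma> \<infinity> = 1"

text \<open>The Stieltjes measure of the left-continuous function \<open>\<sigma>\<close> is characterised by
  \<open>d\<sigma>([a,b)) = \<sigma>(b) - \<sigma>(a)\<close>. As \<^const>\<open>interval_measure\<close> takes a right-continuous distribution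
  function, it is applied to the right-continuous modification \<open>r \<mapsto> \<sigma>(r+)\<close>, which vanishes
  for \<open>r < 0\<close> because \<^const>\<open>ennreal\<close> truncates negative numbers to \<open>0\<close>.\<close>

definition stieltjes :: "(ennreal \<Rightarrow> real) \<Rightarrow> real measure" where
  "stieltjes \<sigma> = interval_measure (\<lambda>r. INF s\<in>{r<..}. \<sigma> (ennreal s))"


section \<open>The space \<open>L\<^sup>2\<close>\<close>

text \<open>Elements of \<open>L\<^sup>2(X,\<mu>)\<close> are represented by square-integrable functions; operators act on
  representatives and all identities between elements hold almost everywhere.\<close>

definition L2 :: "'a measure \<Rightarrow> ('a \<Rightarrow> real) set" where
  "L2 M = {f \<in> borel_measurable M. integrable M (\<lambda>x. (f x)\<^sup>2)}"

definition l2_inner :: "'a measure \<Rightarrow> ('a \<Rightarrow> real) \<Rightarrow> ('a \<Rightarrow> real) \<Rightarrow> real" where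
  "l2_inner M f g = (\<integral>x. f x * g x \<partial>M)"

definition l2_norm :: "'a measure \<Rightarrow> ('a \<Rightarrow> real) \<Rightarrow> real" where
  "l2_norm M f = sqrt (l2_inner M f f)"

definition l2_complete :: "'a measure \<Rightarrow> ('a \<Rightarrow> real) set \<Rightarrow> bool" where
  "l2_complete M F \<longleftrightarrow>
     F \<subseteq> L2 M \<and>
     (\<forall>g\<in>L2 M. \<forall>\<epsilon>>0. \<exists>S c. finite S \<and> S \<subseteq> F \<and>
        l2_norm M (\<lambda>x. g x - (\<Sum>f\<in>S. c f * f x)) < \<epsilon>)"

definition l2_linear :: "'a measure \<Rightarrow> (('a \<Rightarrow> real) \<Rightarrow> ('a \<Rightarrow> real)) \<Rightarrow> bool" where
  "l2_linear M T \<longleftrightarrow>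
     (\<forall>f\<in>L2 M. T f \<in> L2 M) \<and>
     (\<forall>f\<in>L2 M. \<forall>g\<in>L2 M. (AE x in M. f x = g x) \<longrightarrow> (AE x in M. T f x = T g x)) \<and>
     (\<forall>f\<in>L2 M. \<forall>g\<in>L2 M. \<forall>a b. AE x in M.
        T (\<lambda>y. a * f y + b * g y) x = a * T f x + b * T g x)"

definition l2_orthogonal_projection ::
    "'a measure \<Rightarrow> (('a \<Rightarrow> real) \<Rightarrow> ('a \<Rightarrow> real)) \<Rightarrow> bool" where
  "l2_orthogonal_projection M T \<longleftrightarrow>
     l2_linear M T \<and>
     (\<forall>f\<in>L2 M. AE x in M. T (T f) x = T f x) \<and>
     (\<forall>f\<in>L2 M. \<forall>g\<in>L2 M. l2_inner M (T f) g = l2_inner M f (T g))"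


section \<open>Functional calculus of self-adjoint operators on \<open>L\<^sup>2\<close>\<close>

text \<open>Projection-valued measures on the Borel sets of the real line; countable additivity is
  understood in the strong operator topology.\<close>

definition projection_valued_measure ::
    "'a measure \<Rightarrow> (real set \<Rightarrow> ('a \<Rightarrow> real) \<Rightarrow> ('a \<Rightarrow> real)) \<Rightarrow> bool" where
  "projection_valued_measure M E \<longleftrightarrow>
     (\<forall>A\<in>sets borel. l2_orthogonal_projection M (E A)) \<and>
     (\<forall>f\<in>L2 M. AE x in M. E UNIV f x = f x) \<and>
     (\<forall>A\<in>sets borel. \<forall>B\<in>sets borel. \<forall>f\<in>L2 M.
        AE x in M. E (A \<inter> B) f x = E A (E B f) x) \<and>
     (\<forall>A::nat \<Rightarrow> real set. range A \<subseteq> sets borel \<longrightarrow> disjoint_family A \<longrightarrow>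
        (\<forall>f\<in>L2 M.
           (\<lambda>n. l2_norm M (\<lambda>x. E (\<Union>i. A i) f x - (\<Sum>i<n. E (A i) f x))) \<longlonglongrightarrow> 0))"

text \<open>The finite measure \<open>A \<mapsto> \<langle>E(A) f, f\<rangle>\<close>.\<close>

definition scalar_spectral_measure ::
    "'a measure \<Rightarrow> (real set \<Rightarrow> ('a \<Rightarrow> real) \<Rightarrow> ('a \<Rightarrow> real)) \<Rightarrow> ('a \<Rightarrow> real) \<Rightarrow> real measure" where
  "scalar_spectral_measure M E f =
     measure_of UNIV (sets borel) (\<lambda>A. ennreal (l2_inner M (E A f) f))"

definition spectral_domain ::
    "'a measure \<Rightarrow> (real set \<Rightarrow> ('a \<Rightarrow> real) \<Rightarrow> ('a \<Rightarrow> real)) \<Rightarrow> (real \<Rightarrow> real) \<Rightarrow> ('a \<Rightarrow> real) set" where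
  "spectral_domain M E \<phi> =
     {f \<in> L2 M. integrable (scalar_spectral_measure M E f) (\<lambda>s. (\<phi> s)\<^sup>2)}"

text \<open>\<open>u\<close> is in the domain of \<open>\<integral> \<phi> dE\<close> and is mapped to \<open>v\<close>. The signed measure
  \<open>A \<mapsto> \<langle>E(A) u, g\<rangle>\<close> is expressed by polarisation; it suffices to test against \<open>g\<close> in the domain
  since the domain is a dense subspace.\<close>

definition has_spectral_integral ::
    "'a measure \<Rightarrow> (real set \<Rightarrow> ('a \<Rightarrow> real) \<Rightarrow> ('a \<Rightarrow> real)) \<Rightarrow> (real \<Rightarrow> real)
       \<Rightarrow> ('a \<Rightarrow> real) \<Rightarrow> ('a \<Rightarrow> real) \<Rightarrow> bool" where
  "has_spectral_integral M E \<phi> u v \<longleftrightarrow>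
     u \<in> spectral_domain M E \<phi> \<and> v \<in> L2 M \<and>
     (\<forall>g\<in>spectral_domain M E \<phi>.
        l2_inner M v g =
          ((\<integral>s. \<phi> s \<partial>scalar_spectral_measure M E (\<lambda>x. u x + g x)) -
           (\<integral>s. \<phi> s \<partial>scalar_spectral_measure M E (\<lambda>x. u x - g x))) / 4)"

text \<open>\<open>T = \<integral> s dE(s)\<close> on all of \<open>L\<^sup>2\<close>.\<close>

definition spectral_resolution ::
    "'a measure \<Rightarrow> (('a \<Rightarrow> real) \<Rightarrow> ('a \<Rightarrow> real))
       \<Rightarrow> (real set \<Rightarrow> ('a \<Rightarrow> real) \<Rightarrow> ('a \<Rightarrow> real)) \<Rightarrow> bool" where
  "spectral_resolution M T E \<longleftrightarrow>
     projection_valued_measure M E \<and>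
     (\<forall>f\<in>L2 M. has_spectral_integral M E (\<lambda>s. s) f (T f))"

text \<open>The graph of \<open>\<phi>(T)\<close>, an operator that may be unbounded. By the spectral theorem a bounded
  self-adjoint \<open>T\<close> has a spectral resolution \<open>E\<close>, and \<open>E\<close> is unique up to equality almost
  everywhere.\<close>

definition functional_calculus ::
    "'a measure \<Rightarrow> (('a \<Rightarrow> real) \<Rightarrow> ('a \<Rightarrow> real)) \<Rightarrow> (real \<Rightarrow> real)
       \<Rightarrow> ('a \<Rightarrow> real) \<Rightarrow> ('a \<Rightarrow> real) \<Rightarrow> bool" where
  "functional_calculus M T \<phi> u v \<longleftrightarrow>
     (\<exists>E. spectral_resolution M T E \<and> has_spectral_integral M E \<phi> u v)"

text \<open>An operator is given by its graph \<open>L\<close>.\<close>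

definition eigenfunction ::
    "'a measure \<Rightarrow> (('a \<Rightarrow> real) \<Rightarrow> ('a \<Rightarrow> real) \<Rightarrow> bool) \<Rightarrow> ('a \<Rightarrow> real) \<Rightarrow> real \<Rightarrow> bool" where
  "eigenfunction M L f c \<longleftrightarrow>
     f \<in> L2 M \<and> \<not> (AE x in M. f x = 0) \<and> L f (\<lambda>x. c * f x)"


section \<open>The isotropic Markov operator and the isotropic Laplacian\<close>

definition ball_average :: "'a::metric_space measure \<Rightarrow> real \<Rightarrow> ('a \<Rightarrow> real) \<Rightarrow> 'a \<Rightarrow> real" where
  "ball_average M r f x = (LINT y:cball x r|M. f y) / measure M (cball x r)"

definition isotropic_markov ::
    "'a::metric_space measure \<Rightarrow> (ennreal \<Rightarrow> real) \<Rightarrow> ('a \<Rightarrow> real) \<Rightarrow> ('a \<Rightarrow> real)" where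
  "isotropic_markov M \<sigma> f x = (LINT r:{0..}|stieltjes \<sigma>. ball_average M r f x)"

text \<open>The operator \<open>P\<close> is injective with spectrum in \<open>[0,1]\<close>, so its spectral measure vanishes on
  \<open>{..0}\<close> and the values of the logarithm there are immaterial.\<close>

definition isotropic_laplacian ::
    "'a::metric_space measure \<Rightarrow> (ennreal \<Rightarrow> real) \<Rightarrow> ('a \<Rightarrow> real) \<Rightarrow> ('a \<Rightarrow> real) \<Rightarrow> bool" where
  "isotropic_laplacian M \<sigma> = functional_calculus M (isotropic_markov M \<sigma>) (\<lambda>s. ln (1 / s))"


section \<open>Balls and the functions \<open>f\<^sub>C\<close>\<close>

definition intrinsic_dist :: "(ennreal \<Rightarrow> real) \<Rightarrow> 'a::metric_space \<Rightarrow> 'a \<Rightarrow> real" where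
  "intrinsic_dist \<sigma> x y = (if x = y then 0 else 1 / ln (1 / \<sigma> (ennreal (dist x y))))"

definition is_ball :: "'a::metric_space set \<Rightarrow> bool" where
  "is_ball B \<longleftrightarrow> (\<exists>x r. 0 \<le> r \<and> B = cball x r)"

definition positive_balls :: "'a::metric_space set set" where
  "positive_balls = {cball x r |x r. 0 < r}"

definition intrinsic_radius :: "(ennreal \<Rightarrow> real) \<Rightarrow> 'a::metric_space set \<Rightarrow> real" where
  "intrinsic_radius \<sigma> B = (LEAST r. 0 \<le> r \<and> (\<forall>x\<in>B. B = {y. intrinsic_dist \<sigma> x y \<le> r}))"

definition is_parent :: "'a::metric_space set \<Rightarrow> 'a set \<Rightarrow> bool" where
  "is_parent B C \<longleftrightarrow>
     is_ball B \<and> C \<subseteq> B \<and> C \<noteq> B \<and>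
     (\<forall>A. is_ball A \<and> C \<subseteq> A \<and> A \<subseteq> B \<longrightarrow> A = C \<or> A = B)"

definition parent :: "'a::metric_space set \<Rightarrow> 'a set" where
  "parent C = (THE B. is_parent B C)"

definition ball_fun :: "'a::metric_space measure \<Rightarrow> 'a set \<Rightarrow> 'a \<Rightarrow> real" where
  "ball_fun M C =
     (if C = UNIV then (\<lambda>x. 1)
      else (\<lambda>x. 1 / measure M C * indicator C x
                - 1 / measure M (parent C) * indicator (parent C) x))"

definition ball_eigenvalue :: "(ennreal \<Rightarrow> real) \<Rightarrow> 'a::metric_space set \<Rightarrow> real" where
  "ball_eigenvalue \<sigma> C = (if C = UNIV then 0 else 1 / intrinsic_radius \<sigma> (parent C))"

definition compactly_supported :: "('a::topological_space \<Rightarrow> real) \<Rightarrow> bool" where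
  "compactly_supported f \<longleftrightarrow> compact (closure {x. f x \<noteq> 0})"

end

theory Submission
  imports Defs "HOL-Probability.Probability"
begin

text \<open>
  Balls are nested or disjoint, so \<open>f\<^sub>C\<close> is constant on every ball that does not contain the parent \<open>B\<close> of
  \<open>C\<close> and has integral \<open>0\<close> over every ball that does. Hence \<open>Q\<^sub>r f\<^sub>C(x)\<close> is \<open>f\<^sub>C(x)\<close> for \<open>r\<close> less than the
  diameter \<open>\<delta>\<close> of \<open>B\<close> and \<open>0\<close> otherwise, whence \<open>P f\<^sub>C = \<sigma>(\<delta>) f\<^sub>C\<close>, while \<open>1/\<rho>(B) = log (1/\<sigma>(\<delta>))\<close>.
  If \<open>g\<close> is orthogonal to all \<open>f\<^sub>C\<close>, its ball averages are constant along chains of balls and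
  therefore vanish, and the balls generate the Borel sets, so \<open>g = 0\<close>. The functions with a common
  parent satisfy \<open>f\<^sub>C = \<Sum> \<mu>(C') \<langle>f\<^sub>C,f\<^bsub>C'\<^esub>\<rangle> f\<^bsub>C'\<^esub>\<close>, so \<open>f \<mapsto> \<Sum> \<mu>(C') \<langle>f,f\<^bsub>C'\<^esub>\<rangle> f\<^bsub>C'\<^esub>\<close> is an orthogonal
  projection; these projections are mutually orthogonal and sum to the identity. Thus the spectral
  resolution of \<open>P\<close>, needed for the functional calculus, is an explicit orthogonal series, and the
  general spectral theorem is avoided.
\<close>

section \<open>Square-integrable functions\<close>

text \<open>The functions with one parent are linearly dependent: the sum of \<mu>(C')
  \<open>ball_fun M C'\<close> over all children C' of a ball vanishes. So no orthonormal basis is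
  at hand, and a weighted reproducing identity takes its place. The Markov operator is given only as
  an integral of averages. It is matched with the orthogonal series by three facts: it is linear, it
  contracts the norm, and it has the right eigenvalues on a complete family. Its symmetry is then a
  consequence of the series. The contraction bound rests on there being only countably many balls,
  although there are uncountably many radii. As elements of \<open>L2 M\<close> are functions rather
  than classes, limits have to be built and selected, and identities between operators are tested
  through inner products. The logarithm may be unbounded on the spectrum, but each
  \<open>ball_fun M C\<close> lies in a single summand of the series and hence in the
  domain.\<close>

lemma L2_measurable [measurable_dest]: "f \<in> L2 M \<Longrightarrow> f \<in> borel_measurable M"
  by (simp add: L2_def)

lemma L2_square_integrable: "f \<in> L2 M \<Longrightarrow> integrable M (\<lambda>x. f x * f x)"
  by (simp add: L2_def power2_eq_square)

lemma L2_mult_integrable: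
  assumes "f \<in> L2 M" "g \<in> L2 M"
  shows "integrable M (\<lambda>x. f x * g x)"
proof (rule Bochner_Integration.integrable_bound)
  show "integrable M (\<lambda>x. f x * f x + g x * g x)"
    using assms by (intro Bochner_Integration.integrable_add L2_square_integrable)
  show "(\<lambda>x. f x * g x) \<in> borel_measurable M"
    using assms by measurable
  have "\<bar>a * b\<bar> \<le> \<bar>a * a + b * b\<bar>" for a b :: real
  proof -
    have "2 * \<bar>a * b\<bar> \<le> a * a + b * b"
      using sum_squares_bound[of "\<bar>a\<bar>" "\<bar>b\<bar>"] by (simp add: power2_eq_square abs_mult)
    then show ?thesis using abs_ge_zero[of "a * b"] by linarith
  qed
  then show "AE x in M. norm (f x * g x) \<le> norm (f x * f x + g x * g x)"
    by simp
qed

lemma L2_zero: "(\<lambda>x. 0) \<in> L2 M"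
  by (simp add: L2_def)

lemma L2_add:
  assumes "f \<in> L2 M" "g \<in> L2 M"
  shows "(\<lambda>x. f x + g x) \<in> L2 M"
proof -
  have "integrable M (\<lambda>x. f x * f x + 2 * (f x * g x) + g x * g x)"
    using assms by (intro Bochner_Integration.integrable_add integrable_mult_right L2_mult_integrable)
  moreover have "f x * f x + 2 * (f x * g x) + g x * g x = (f x + g x)\<^sup>2" for x
    by (simp add: power2_eq_square algebra_simps)
  moreover have "(\<lambda>x. f x + g x) \<in> borel_measurable M"
    using assms by measurable
  ultimately show ?thesis
    by (simp add: L2_def)
qed

lemma L2_cmult:
  assumes "f \<in> L2 M"
  shows "(\<lambda>x. a * f x) \<in> L2 M"
proof -
  have [measurable]: "f \<in> borel_measurable M"
    using assms by (rule L2_measurable)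
  have "(\<lambda>x. a * f x) \<in> borel_measurable M"
    by measurable
  then show ?thesis
    using assms by (simp add: L2_def power_mult_distrib)
qed

lemma L2_diff:
  assumes "f \<in> L2 M" "g \<in> L2 M"
  shows "(\<lambda>x. f x - g x) \<in> L2 M"
  using L2_add[OF assms(1) L2_cmult[OF assms(2), of "-1"]] by simp

lemma L2_sum: "(\<And>i. i \<in> I \<Longrightarrow> f i \<in> L2 M) \<Longrightarrow> (\<lambda>x. \<Sum>i\<in>I. f i x) \<in> L2 M"
  by (induction I rule: infinite_finite_induct) (simp_all add: L2_zero L2_add)

lemma l2_inner_commute: "l2_inner M f g = l2_inner M g f"
  by (simp add: l2_inner_def mult.commute)

lemma l2_inner_add_left:
  "\<lbrakk>f \<in> L2 M; g \<in> L2 M; h \<in> L2 M\<rbrakk> \<Longrightarrow> l2_inner M (\<lambda>x. f x + g x) h = l2_inner M f h + l2_inner M g h"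
  by (simp add: l2_inner_def distrib_right L2_mult_integrable)

lemma l2_inner_diff_left:
  "\<lbrakk>f \<in> L2 M; g \<in> L2 M; h \<in> L2 M\<rbrakk> \<Longrightarrow> l2_inner M (\<lambda>x. f x - g x) h = l2_inner M f h - l2_inner M g h"
  by (simp add: l2_inner_def left_diff_distrib L2_mult_integrable)

lemma l2_inner_cmult_left: "l2_inner M (\<lambda>x. a * f x) h = a * l2_inner M f h"
  by (simp add: l2_inner_def mult.assoc)

lemma l2_inner_sum_left:
  assumes "\<And>i. i \<in> I \<Longrightarrow> f i \<in> L2 M" "h \<in> L2 M"
  shows "l2_inner M (\<lambda>x. \<Sum>i\<in>I. f i x) h = (\<Sum>i\<in>I. l2_inner M (f i) h)"
  using assms by (simp add: l2_inner_def sum_distrib_right L2_mult_integrable)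

lemma l2_inner_add_right:
  "\<lbrakk>f \<in> L2 M; g \<in> L2 M; h \<in> L2 M\<rbrakk> \<Longrightarrow> l2_inner M h (\<lambda>x. f x + g x) = l2_inner M h f + l2_inner M h g"
  using l2_inner_add_left[of f M g h] by (simp add: l2_inner_commute[of M h])

lemma l2_inner_diff_right:
  "\<lbrakk>f \<in> L2 M; g \<in> L2 M; h \<in> L2 M\<rbrakk> \<Longrightarrow> l2_inner M h (\<lambda>x. f x - g x) = l2_inner M h f - l2_inner M h g"
  using l2_inner_diff_left[of f M g h] by (simp add: l2_inner_commute[of M h])

lemma l2_inner_cmult_right: "l2_inner M h (\<lambda>x. a * f x) = a * l2_inner M h f"
  using l2_inner_cmult_left[of M a f h] by (simp add: l2_inner_commute[of M h])

lemma l2_inner_sum_right: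
  assumes "\<And>i. i \<in> I \<Longrightarrow> f i \<in> L2 M" "h \<in> L2 M"
  shows "l2_inner M h (\<lambda>x. \<Sum>i\<in>I. f i x) = (\<Sum>i\<in>I. l2_inner M h (f i))"
  using l2_inner_sum_left[OF assms] by (simp add: l2_inner_commute[of M h])

lemma l2_inner_cong_AE:
  assumes "f \<in> L2 M" "f' \<in> L2 M" "AE x in M. f x = f' x" "g \<in> L2 M"
  shows "l2_inner M f g = l2_inner M f' g"
proof -
  have "(\<lambda>x. f x * g x) \<in> borel_measurable M" "(\<lambda>x. f' x * g x) \<in> borel_measurable M"
    using assms by measurable
  then show ?thesis
    unfolding l2_inner_def using assms(3) by (intro integral_cong_AE) auto
qed

lemma l2_inner_self_nonneg: "0 \<le> l2_inner M f f"
  by (simp add: l2_inner_def)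

lemma l2_inner_self_eq_0_iff:
  assumes "f \<in> L2 M"
  shows "l2_inner M f f = 0 \<longleftrightarrow> (AE x in M. f x = 0)"
  using integral_nonneg_eq_0_iff_AE[OF L2_square_integrable[OF assms]]
  by (simp add: l2_inner_def)

text \<open>For \<open>?c \<noteq> 0\<close> the vector \<open>?c * f - ?b * g\<close> is
  \<open>?c\<close> times the component of \<open>f\<close> orthogonal to \<open>g\<close>; its
  squared norm factors as below. Scaling by \<open>?c\<close> avoids a division and leaves
  \<open>?c = 0\<close> as the only separate case.\<close>

lemma l2_Cauchy_Schwarz:
  assumes "f \<in> L2 M" "g \<in> L2 M"
  shows "(l2_inner M f g)\<^sup>2 \<le> l2_inner M f f * l2_inner M g g"
proof -
  let ?a = "l2_inner M f f" and ?b = "l2_inner M f g" and ?c = "l2_inner M g g"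
  have "0 \<le> l2_inner M (\<lambda>x. ?c * f x - ?b * g x) (\<lambda>x. ?c * f x - ?b * g x)"
    by (rule l2_inner_self_nonneg)
  also have "\<dots> = ?c * (?c * ?a - ?b\<^sup>2)"
    using assms
    by (simp add: l2_inner_diff_left l2_inner_diff_right l2_inner_cmult_left l2_inner_cmult_right
        L2_diff L2_cmult l2_inner_commute[of M g f])
      (simp add: power2_eq_square algebra_simps)
  finally have *: "0 \<le> ?c * (?c * ?a - ?b\<^sup>2)" .
  show ?thesis
  proof (cases "?c = 0")
    case True
    then have "AE x in M. g x = (\<lambda>_. 0) x"
      using assms by (simp add: l2_inner_self_eq_0_iff)
    then have "l2_inner M g f = l2_inner M (\<lambda>_. 0) f"
      using assms by (intro l2_inner_cong_AE L2_zero)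
    then have "?b = 0" by (simp add: l2_inner_commute[of M f g]) (simp add: l2_inner_def)
    then show ?thesis by (simp add: l2_inner_self_nonneg)
  next
    case False
    then have "?c > 0" using l2_inner_self_nonneg[of M g] by simp
    then show ?thesis using * by (simp add: zero_le_mult_iff mult.commute)
  qed
qed

text \<open>Test against \<open>f - g\<close> itself. In this way almost everywhere identities
  between images of operators reduce to identities between scalar series.\<close>

lemma l2_inner_eqI:
  assumes "f \<in> L2 M" "g \<in> L2 M" "\<And>h. h \<in> L2 M \<Longrightarrow> l2_inner M f h = l2_inner M g h"
  shows "AE x in M. f x = g x"
proof -
  have "l2_inner M (\<lambda>x. f x - g x) (\<lambda>x. f x - g x) = 0"
    using assms by (simp add: l2_inner_diff_left L2_diff)
  then show ?thesis
    using assms by (simp add: l2_inner_self_eq_0_iff L2_diff)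
qed

lemma l2_norm_tendsto_0_iff:
  "((\<lambda>n. l2_norm M (f n)) \<longlongrightarrow> 0) F \<longleftrightarrow> ((\<lambda>n. l2_inner M (f n) (f n)) \<longlongrightarrow> 0) F"
proof
  assume "((\<lambda>n. l2_norm M (f n)) \<longlongrightarrow> 0) F"
  from tendsto_power[OF this, of 2] show "((\<lambda>n. l2_inner M (f n) (f n)) \<longlongrightarrow> 0) F"
    by (simp add: l2_norm_def l2_inner_self_nonneg)
next
  assume "((\<lambda>n. l2_inner M (f n) (f n)) \<longlongrightarrow> 0) F"
  from tendsto_real_sqrt[OF this] show "((\<lambda>n. l2_norm M (f n)) \<longlongrightarrow> 0) F"
    by (simp add: l2_norm_def)
qed

text \<open>Cauchy-Schwarz: strong convergence implies weak convergence. The hypothesis speaks of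
  squared norms, so a root is taken at the end.\<close>

lemma l2_inner_tendsto:
  assumes "\<And>n. f n \<in> L2 M" "g \<in> L2 M" "h \<in> L2 M"
    and lim: "((\<lambda>n. l2_inner M (\<lambda>x. f n x - g x) (\<lambda>x. f n x - g x)) \<longlongrightarrow> 0) F"
  shows "((\<lambda>n. l2_inner M (f n) h) \<longlongrightarrow> l2_inner M g h) F"
proof -
  let ?d = "\<lambda>n x. f n x - g x"
  have "((\<lambda>n. (l2_inner M (?d n) h)\<^sup>2) \<longlongrightarrow> 0) F"
  proof (rule tendsto_sandwich)
    show "\<forall>\<^sub>F n in F. 0 \<le> (l2_inner M (?d n) h)\<^sup>2"
      by simp
    show "\<forall>\<^sub>F n in F. (l2_inner M (?d n) h)\<^sup>2 \<le> l2_inner M (?d n) (?d n) * l2_inner M h h"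
      using assms by (intro always_eventually allI l2_Cauchy_Schwarz L2_diff)
    show "((\<lambda>n. l2_inner M (?d n) (?d n) * l2_inner M h h) \<longlongrightarrow> 0) F"
      using lim by (rule tendsto_mult_left_zero)
  qed simp
  then have "((\<lambda>n. sqrt ((l2_inner M (?d n) h)\<^sup>2)) \<longlongrightarrow> 0) F"
    using tendsto_real_sqrt by fastforce
  then have "((\<lambda>n. l2_inner M (?d n) h) \<longlongrightarrow> 0) F"
    by (simp add: tendsto_rabs_zero_iff)
  then have "((\<lambda>n. l2_inner M (f n) h - l2_inner M g h) \<longlongrightarrow> 0) F"
    using assms by (simp add: l2_inner_diff_left)
  then show ?thesis by (simp add: LIM_zero_iff)
qed

section \<open>Completeness of \<open>L2\<close> in terms of representatives\<close>

lemma nn_integral_square_L2: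
  assumes "f \<in> L2 M"
  shows "(\<integral>\<^sup>+x. ennreal ((f x)\<^sup>2) \<partial>M) = ennreal (l2_inner M f f)"
  using assms unfolding l2_inner_def L2_def power2_eq_square
  by (intro nn_integral_eq_integral) auto

lemma L2_I_nn_integral:
  assumes "f \<in> borel_measurable M" "(\<integral>\<^sup>+x. ennreal ((f x)\<^sup>2) \<partial>M) < \<infinity>"
  shows "f \<in> L2 M"
  using assms by (auto simp: L2_def intro!: integrableI_nonneg)

text \<open>A subsequence with rapidly decreasing gaps converges almost everywhere. Fatou's lemma
  then turns the Cauchy bound into convergence of the whole sequence to that pointwise
  limit.\<close>

theorem l2_Riesz_Fischer:
  assumes s: "\<And>n. s n \<in> L2 M"
    and Cauchy: "\<And>e. e > 0 \<Longrightarrow> \<exists>N. \<forall>m\<ge>N. \<forall>n\<ge>N.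
      l2_inner M (\<lambda>x. s m x - s n x) (\<lambda>x. s m x - s n x) < e"
  obtains g where "g \<in> L2 M" "(\<lambda>n. l2_inner M (\<lambda>x. s n x - g x) (\<lambda>x. s n x - g x)) \<longlonglongrightarrow> 0"
proof -
  \<comment> \<open>The rate \<open>(1/4)^k\<close> is meant for squared norms: multiplied by the
    weight \<open>2^k\<close> it still leaves the summable \<open>(1/2)^k\<close>.\<close>
  have "\<exists>N. \<forall>m\<ge>N. \<forall>n\<ge>N. l2_inner M (\<lambda>x. s m x - s n x) (\<lambda>x. s m x - s n x) < (1/4)^k" for k
    by (rule Cauchy) simp
  then obtain N where N: "\<And>k m n. N k \<le> m \<Longrightarrow> N k \<le> n \<Longrightarrow>
      l2_inner M (\<lambda>x. s m x - s n x) (\<lambda>x. s m x - s n x) < (1/4)^k"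
    by metis
  \<comment> \<open>Although \<open>N\<close> need not be monotone, these partial sums dominate
    every \<open>N i\<close> with \<open>i \<le> k\<close>, so \<open>r j\<close> is admissible for
    all levels up to \<open>j\<close>.\<close>
  define r where "r k = (\<Sum>i\<le>k. N i)" for k
  have r: "N k \<le> r j" if "k \<le> j" for k j
    unfolding r_def using that by (intro member_le_sum) auto
  define d where "d k x = s (r (Suc k)) x - s (r k) x" for k x
  have d_L2: "d k \<in> L2 M" for k
    unfolding d_def by (intro L2_diff s)
  have [measurable]: "s n \<in> borel_measurable M" "d n \<in> borel_measurable M" for n
    using s d_L2 by (auto intro: L2_measurable)
  have d: "l2_inner M (d k) (d k) < (1/4)^k" for k
    unfolding d_def using N[of k "r (Suc k)" "r k"] r[of k k] r[of k "Suc k"] by simp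
  \<comment> \<open>By AM-GM, summability of \<open>2\<^sup>k d\<^sub>k(x)\<^sup>2\<close> implies absolute summability of \<open>d\<^sub>k(x)\<close>.\<close>
  have "(\<integral>\<^sup>+x. (\<Sum>k. ennreal (2^k * (d k x)\<^sup>2)) \<partial>M) = (\<Sum>k. \<integral>\<^sup>+x. ennreal (2^k * (d k x)\<^sup>2) \<partial>M)"
    by (intro nn_integral_suminf) measurable
  also have "\<dots> \<le> (\<Sum>k. ennreal ((1/2)^k))"
  proof (intro suminf_le)
    fix k
    have "(\<integral>\<^sup>+x. ennreal (2^k * (d k x)\<^sup>2) \<partial>M) = ennreal (2^k) * ennreal (l2_inner M (d k) (d k))"
      by (simp add: ennreal_mult nn_integral_cmult nn_integral_square_L2 d_L2)
    also have "\<dots> \<le> ennreal (2^k * (1/4)^k)"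
      using d[of k] l2_inner_self_nonneg[of M "d k"]
      by (simp add: ennreal_mult[symmetric] del: ennreal_power)
    also have "2^k * (1/4)^k = (1/2::real)^k"
      by (simp add: power_mult_distrib[symmetric])
    finally show "(\<integral>\<^sup>+x. ennreal (2^k * (d k x)\<^sup>2) \<partial>M) \<le> ennreal ((1/2)^k)" .
  qed auto
  also have "\<dots> = ennreal (\<Sum>k. (1/2)^k)"
    by (intro suminf_ennreal_eq) (auto intro!: summable_sums summable_geometric)
  also have "\<dots> < \<infinity>" by simp
  finally have "AE x in M. (\<Sum>k. ennreal (2^k * (d k x)\<^sup>2)) \<noteq> \<infinity>"
    by (intro nn_integral_PInf_AE) auto
  then have conv: "AE x in M. convergent (\<lambda>k. s (r k) x)"
  proof eventually_elim
    case (elim x)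
    have "summable (\<lambda>k. 2^k * (d k x)\<^sup>2)"
      using elim by (intro summable_suminf_not_top) auto
    then have "summable (\<lambda>k. (1/2)^k + 2^k * (d k x)\<^sup>2)"
      by (intro summable_add summable_geometric) auto
    then have "summable (\<lambda>k. d k x)"
    proof (rule summable_comparison_test')
      fix k
      have "2 * (1 * \<bar>2^k * d k x\<bar>) \<le> 1\<^sup>2 + \<bar>2^k * d k x\<bar>\<^sup>2"
        using sum_squares_bound[of 1 "\<bar>2^k * d k x\<bar>"] by simp
      then have "2^k * \<bar>d k x\<bar> \<le> 2^k * ((1/2)^k + 2^k * (d k x)\<^sup>2)"
        using mult_nonneg_nonneg[of "\<bar>d k x\<bar>" "2^k"]
        by (simp add: abs_mult power_mult_distrib distrib_left power_divide power2_eq_square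
            algebra_simps del: mult_nonneg_nonneg)
      then show "norm (d k x) \<le> (1/2)^k + 2^k * (d k x)\<^sup>2"
        by simp
    qed
    then have "convergent (\<lambda>k. s (r 0) x + (\<Sum>j<k. d j x))"
      by (intro convergent_add convergent_const) (simp add: summable_iff_convergent)
    moreover have "s (r 0) x + (\<Sum>j<k. d j x) = s (r k) x" for k
      by (simp add: d_def sum_lessThan_telescope[of "\<lambda>k. s (r k) x"])
    ultimately show ?case by simp
  qed
  \<comment> \<open>Where the subsequence diverges, which is a null set, the value of
    \<open>lim\<close> is immaterial.\<close>
  define g where "g x = lim (\<lambda>k. s (r k) x)" for x
  have [measurable]: "g \<in> borel_measurable M"
    unfolding g_def by measurable
  have bound: "(\<integral>\<^sup>+x. ennreal ((s n x - g x)\<^sup>2) \<partial>M) \<le> ennreal ((1/4)^k)" if n: "N k \<le> n" for n k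
  proof -
    \<comment> \<open>Fatou's lemma in the index \<open>j\<close>, with \<open>n\<close>
      fixed.\<close>
    have "(\<integral>\<^sup>+x. ennreal ((s n x - g x)\<^sup>2) \<partial>M) =
        (\<integral>\<^sup>+x. liminf (\<lambda>j. ennreal ((s n x - s (r j) x)\<^sup>2)) \<partial>M)"
    proof (intro nn_integral_cong_AE, use conv in eventually_elim)
      case (elim x)
      then have "(\<lambda>j. s (r j) x) \<longlonglongrightarrow> g x"
        by (simp add: g_def convergent_LIMSEQ_iff)
      then have "(\<lambda>j. ennreal ((s n x - s (r j) x)\<^sup>2)) \<longlonglongrightarrow> ennreal ((s n x - g x)\<^sup>2)"
        by (intro tendsto_ennrealI tendsto_intros)
      then show ?case by (intro lim_imp_Liminf[symmetric]) auto
    qed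
    also have "\<dots> \<le> liminf (\<lambda>j. \<integral>\<^sup>+x. ennreal ((s n x - s (r j) x)\<^sup>2) \<partial>M)"
      by (intro nn_integral_liminf) measurable
    also have "\<dots> = liminf (\<lambda>j. ennreal (l2_inner M (\<lambda>x. s n x - s (r j) x) (\<lambda>x. s n x - s (r j) x)))"
      by (subst nn_integral_square_L2) (auto intro: L2_diff s)
    also have "\<dots> \<le> limsup (\<lambda>j. ennreal (l2_inner M (\<lambda>x. s n x - s (r j) x) (\<lambda>x. s n x - s (r j) x)))"
      by (intro Liminf_le_Limsup) simp
    also have "\<dots> \<le> ennreal ((1/4)^k)"
    proof (intro Limsup_bounded)
      show "\<forall>\<^sub>F j in sequentially. ennreal (l2_inner M (\<lambda>x. s n x - s (r j) x) (\<lambda>x. s n x - s (r j) x))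
        \<le> ennreal ((1/4)^k)"
        using eventually_ge_at_top[of k]
      proof eventually_elim
        case (elim j)
        then show ?case using N[OF n r[OF elim]] by (intro ennreal_leI) simp
      qed
    qed
    finally show ?thesis .
  qed
  have diff_L2: "(\<lambda>x. s n x - g x) \<in> L2 M" if "N 0 \<le> n" for n
    using bound[OF that] by (intro L2_I_nn_integral) (auto intro: le_less_trans)
  \<comment> \<open>So far only differences with \<open>g\<close> are known to be square-integrable;
    \<open>g\<close> is recovered from one of them.\<close>
  have "(\<lambda>x. s (N 0) x - (s (N 0) x - g x)) \<in> L2 M"
    by (intro L2_diff s diff_L2) simp
  then have g: "g \<in> L2 M" by simp
  have "(\<lambda>n. l2_inner M (\<lambda>x. s n x - g x) (\<lambda>x. s n x - g x)) \<longlonglongrightarrow> 0"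
  proof (rule LIMSEQ_I)
    fix e :: real assume "e > 0"
    then obtain k where k: "(1/4)^k < e"
      using real_arch_pow_inv[of e "1/4"] by auto
    have "norm (l2_inner M (\<lambda>x. s n x - g x) (\<lambda>x. s n x - g x) - 0) < e" if "n \<ge> N k" for n
    proof -
      have "ennreal (l2_inner M (\<lambda>x. s n x - g x) (\<lambda>x. s n x - g x)) \<le> ennreal ((1/4)^k)"
        using bound[OF that] by (simp add: nn_integral_square_L2 L2_diff s g)
      then show ?thesis using k by (simp add: l2_inner_self_nonneg del: ennreal_power)
    qed
    then show "\<exists>no. \<forall>n\<ge>no. norm (l2_inner M (\<lambda>x. s n x - g x) (\<lambda>x. s n x - g x) - 0) < e"
      by blast
  qed
  with g that show thesis by blast
qed


section \<open>Orthogonal series of projections\<close>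

locale projection_series =
  fixes M :: "'a measure" and D :: "nat \<Rightarrow> ('a \<Rightarrow> real) \<Rightarrow> 'a \<Rightarrow> real"
  assumes projection: "l2_orthogonal_projection M (D i)"
    and orthogonal: "i \<noteq> j \<Longrightarrow> f \<in> L2 M \<Longrightarrow> AE x in M. D i (D j f) x = 0"
    and total: "g \<in> L2 M \<Longrightarrow> (\<And>i. AE x in M. D i g x = 0) \<Longrightarrow> AE x in M. g x = 0"
begin

lemma D_L2 [simp]: "f \<in> L2 M \<Longrightarrow> D i f \<in> L2 M"
  using projection by (simp add: l2_orthogonal_projection_def l2_linear_def)

lemma D_symmetric: "f \<in> L2 M \<Longrightarrow> g \<in> L2 M \<Longrightarrow> l2_inner M (D i f) g = l2_inner M f (D i g)"
  using projection by (simp add: l2_orthogonal_projection_def)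

lemma D_idem: "f \<in> L2 M \<Longrightarrow> AE x in M. D i (D i f) x = D i f x"
  using projection by (simp add: l2_orthogonal_projection_def)

lemma D_cong:
  "\<lbrakk>f \<in> L2 M; g \<in> L2 M; AE x in M. f x = g x\<rbrakk> \<Longrightarrow> AE x in M. D i f x = D i g x"
  using projection by (simp add: l2_orthogonal_projection_def l2_linear_def)

lemma D_linear:
  "\<lbrakk>f \<in> L2 M; g \<in> L2 M\<rbrakk> \<Longrightarrow> AE x in M. D i (\<lambda>y. a * f y + b * g y) x = a * D i f x + b * D i g x"
  using projection by (simp add: l2_orthogonal_projection_def l2_linear_def)

lemma inner_D_linear:
  assumes "f \<in> L2 M" "g \<in> L2 M" "h \<in> L2 M"
  shows "l2_inner M (D i (\<lambda>y. a * f y + b * g y)) h = a * l2_inner M (D i f) h + b * l2_inner M (D i g) h"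
proof -
  have "l2_inner M (D i (\<lambda>y. a * f y + b * g y)) h = l2_inner M (\<lambda>x. a * D i f x + b * D i g x) h"
    using assms by (intro l2_inner_cong_AE D_linear D_L2 L2_add L2_cmult)
  then show ?thesis
    using assms by (simp add: l2_inner_add_left l2_inner_cmult_left L2_cmult)
qed

text \<open>Symmetry moves \<open>D j\<close> to the left factor, where idempotence or mutual
  orthogonality evaluates \<open>D j (D i f)\<close>.\<close>

lemma inner_D_D:
  assumes "f \<in> L2 M" "h \<in> L2 M"
  shows "l2_inner M (D i f) (D j h) = (if i = j then l2_inner M (D i f) h else 0)"
proof -
  have "l2_inner M (D i f) (D j h) = l2_inner M (D j (D i f)) h"
    using assms by (simp add: D_symmetric)
  also have "\<dots> = l2_inner M (if i = j then D i f else (\<lambda>_. 0)) h"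
    using assms by (intro l2_inner_cong_AE) (auto simp: L2_zero D_idem orthogonal)
  also have "\<dots> = (if i = j then l2_inner M (D i f) h else 0)"
    by (simp add: l2_inner_def)
  finally show ?thesis .
qed

lemma inner_sum_D_self:
  assumes "finite F" "f \<in> L2 M"
  shows "l2_inner M (\<lambda>x. \<Sum>i\<in>F. D i f x) (\<lambda>x. \<Sum>i\<in>F. D i f x) = (\<Sum>i\<in>F. l2_inner M (D i f) (D i f))"
  using assms
  by (simp add: l2_inner_sum_left l2_inner_sum_right L2_sum inner_D_D)

text \<open>The squared norm of \<open>f - ?S\<close> is non-negative, and both \<langle>?S,
  f\<rangle> and \<langle>?S, ?S\<rangle> equal the left-hand side.\<close>

lemma Bessel:
  assumes "finite F" "f \<in> L2 M"
  shows "(\<Sum>i\<in>F. l2_inner M (D i f) (D i f)) \<le> l2_inner M f f"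
proof -
  let ?S = "\<lambda>x. \<Sum>i\<in>F. D i f x"
  have S: "?S \<in> L2 M" using assms by (intro L2_sum D_L2)
  have "l2_inner M ?S f = (\<Sum>i\<in>F. l2_inner M (D i f) (D i f))"
    using assms by (simp add: l2_inner_sum_left inner_D_D)
  moreover have "0 \<le> l2_inner M (\<lambda>x. f x - ?S x) (\<lambda>x. f x - ?S x)"
    by (rule l2_inner_self_nonneg)
  ultimately show ?thesis
    using assms S inner_sum_D_self[OF assms]
    by (simp add: l2_inner_diff_left l2_inner_diff_right L2_diff l2_inner_commute[of M f ?S])
qed

lemma summable_D:
  assumes "f \<in> L2 M"
  shows "summable (\<lambda>i. l2_inner M (D i f) (D i f))"
  using Bessel[OF _ assms] by (intro summableI_nonneg_bounded) (auto simp: l2_inner_self_nonneg)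

text \<open>Expand the squared norms of the difference and the sum of \<open>D i f\<close> and
  \<open>D i h\<close>. The diagonal series thereby dominate the mixed one, which the polarised
  spectral integrals require.\<close>

lemma abs_inner_D_le:
  assumes "f \<in> L2 M" "h \<in> L2 M"
  shows "2 * \<bar>l2_inner M (D i f) h\<bar> \<le> l2_inner M (D i f) (D i f) + l2_inner M (D i h) (D i h)"
proof -
  have "0 \<le> l2_inner M (\<lambda>x. D i f x - D i h x) (\<lambda>x. D i f x - D i h x)"
    and "0 \<le> l2_inner M (\<lambda>x. D i f x + D i h x) (\<lambda>x. D i f x + D i h x)"
    by (rule l2_inner_self_nonneg)+
  then show ?thesis
    using assms inner_D_D[OF assms, of i i]
    by (simp add: l2_inner_diff_left l2_inner_diff_right l2_inner_add_left l2_inner_add_right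
        L2_diff L2_add l2_inner_commute[of M "D i h" "D i f"] abs_if)
qed

text \<open>The strong sum of \<open>D i f\<close> over \<open>i \<in> I\<close> is determined up to
  null sets only, so a representative is selected.\<close>

definition proj :: "nat set \<Rightarrow> ('a \<Rightarrow> real) \<Rightarrow> 'a \<Rightarrow> real" where
  "proj I f = (SOME g. g \<in> L2 M \<and>
     (\<lambda>n. l2_inner M (\<lambda>x. (\<Sum>i\<in>I \<inter> {..<n}. D i f x) - g x) (\<lambda>x. (\<Sum>i\<in>I \<inter> {..<n}. D i f x) - g x))
        \<longlonglongrightarrow> 0)"

text \<open>By orthogonality the squared distance of two partial sums is bounded by a section of the
  convergent Bessel series. So they form a Cauchy sequence.\<close>

lemma proj_exists:
  assumes f: "f \<in> L2 M"
  shows "\<exists>g. g \<in> L2 M \<and>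
     (\<lambda>n. l2_inner M (\<lambda>x. (\<Sum>i\<in>I \<inter> {..<n}. D i f x) - g x) (\<lambda>x. (\<Sum>i\<in>I \<inter> {..<n}. D i f x) - g x))
        \<longlonglongrightarrow> 0"
proof -
  define s where "s n x = (\<Sum>i\<in>I \<inter> {..<n}. D i f x)" for n x
  have s: "s n \<in> L2 M" for n
    unfolding s_def using f by (intro L2_sum D_L2)
  define a where "a i = l2_inner M (D i f) (D i f)" for i
  have *: "l2_inner M (\<lambda>x. s m x - s n x) (\<lambda>x. s m x - s n x) \<le> sum a {n..<m}" if "n \<le> m" for m n
  proof -
    have "s m x - s n x = (\<Sum>i\<in>I \<inter> {n..<m}. D i f x)" for x
    proof -
      have "I \<inter> {..<m} = (I \<inter> {..<n}) \<union> (I \<inter> {n..<m})"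
        using that by auto
      then show ?thesis
        unfolding s_def by (simp add: sum.union_disjoint disjoint_iff)
    qed
    then have "l2_inner M (\<lambda>x. s m x - s n x) (\<lambda>x. s m x - s n x) = sum a (I \<inter> {n..<m})"
      using inner_sum_D_self[of "I \<inter> {n..<m}" f] f by (simp add: a_def)
    also have "\<dots> \<le> sum a {n..<m}"
      by (intro sum_mono2) (auto simp: a_def l2_inner_self_nonneg)
    finally show ?thesis .
  qed
  have sym: "l2_inner M (\<lambda>x. s m x - s n x) (\<lambda>x. s m x - s n x)
      = l2_inner M (\<lambda>x. s n x - s m x) (\<lambda>x. s n x - s m x)" for m n
    by (simp add: l2_inner_def algebra_simps)
  have "\<exists>N. \<forall>m\<ge>N. \<forall>n\<ge>N. l2_inner M (\<lambda>x. s m x - s n x) (\<lambda>x. s m x - s n x) < e" if "e > 0" for e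
  proof -
    obtain N where N: "\<And>m n. m \<ge> N \<Longrightarrow> norm (sum a {m..<n}) < e"
      using summable_D[OF f] \<open>e > 0\<close> unfolding a_def[symmetric] summable_Cauchy by blast
    have "l2_inner M (\<lambda>x. s m x - s n x) (\<lambda>x. s m x - s n x) < e" if "m \<ge> N" "n \<ge> N" for m n
    proof (cases "n \<le> m")
      case True
      then show ?thesis using *[of n m] N[of n m] that by simp
    next
      case False
      then show ?thesis using *[of m n] N[of m n] that by (simp add: sym[of m n])
    qed
    then show ?thesis by blast
  qed
  from l2_Riesz_Fischer[OF s this] obtain g where
    "g \<in> L2 M" "(\<lambda>n. l2_inner M (\<lambda>x. s n x - g x) (\<lambda>x. s n x - g x)) \<longlonglongrightarrow> 0"
    by blast
  then show ?thesis unfolding s_def by blast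
qed

lemma
  assumes "f \<in> L2 M"
  shows proj_L2 [simp]: "proj I f \<in> L2 M"
    and proj_tendsto: "(\<lambda>n. l2_inner M (\<lambda>x. (\<Sum>i\<in>I \<inter> {..<n}. D i f x) - proj I f x)
        (\<lambda>x. (\<Sum>i\<in>I \<inter> {..<n}. D i f x) - proj I f x)) \<longlonglongrightarrow> 0"
  using someI_ex[OF proj_exists[OF assms, of I]] unfolding proj_def by blast+

text \<open>This is the weak form of the defining limit. Inner products with all \<open>h\<close>
  determine an element up to null sets, so the further properties of \<open>proj\<close> are read
  off this series term by term.\<close>

lemma inner_proj_sums:
  assumes "f \<in> L2 M" "h \<in> L2 M"
  shows "(\<lambda>i. indicator I i * l2_inner M (D i f) h) sums l2_inner M (proj I f) h"
proof -
  have "(\<lambda>n. l2_inner M (\<lambda>x. \<Sum>i\<in>I \<inter> {..<n}. D i f x) h) \<longlonglongrightarrow> l2_inner M (proj I f) h"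
    using assms by (intro l2_inner_tendsto proj_tendsto L2_sum) auto
  also have "(\<lambda>n. l2_inner M (\<lambda>x. \<Sum>i\<in>I \<inter> {..<n}. D i f x) h)
      = (\<lambda>n. \<Sum>i<n. indicator I i * l2_inner M (D i f) h)"
  proof
    fix n
    have "l2_inner M (\<lambda>x. \<Sum>i\<in>I \<inter> {..<n}. D i f x) h = (\<Sum>i\<in>I \<inter> {..<n}. l2_inner M (D i f) h)"
      using assms by (intro l2_inner_sum_left) auto
    also have "\<dots> = (\<Sum>i<n. indicator I i * l2_inner M (D i f) h)"
      by (intro sum.mono_neutral_cong_left) (auto simp: indicator_def)
    finally show "l2_inner M (\<lambda>x. \<Sum>i\<in>I \<inter> {..<n}. D i f x) h
      = (\<Sum>i<n. indicator I i * l2_inner M (D i f) h)" .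
  qed
  finally show ?thesis by (simp add: sums_def)
qed

lemma inner_D_proj:
  assumes "f \<in> L2 M" "h \<in> L2 M"
  shows "l2_inner M (D i (proj I f)) h = indicator I i * l2_inner M (D i f) h"
proof -
  have "(\<lambda>j. indicator I j * l2_inner M (D j f) (D i h)) sums l2_inner M (proj I f) (D i h)"
    using assms by (intro inner_proj_sums) auto
  also have "(\<lambda>j. indicator I j * l2_inner M (D j f) (D i h))
      = (\<lambda>j. if j = i then indicator I i * l2_inner M (D i f) h else 0)"
    using assms by (auto simp: inner_D_D)
  finally have "l2_inner M (proj I f) (D i h) = indicator I i * l2_inner M (D i f) h"
    by (rule sums_unique2[OF _ sums_single])
  then show ?thesis
    using assms by (simp add: D_symmetric)
qed

text \<open>Every \<open>D i\<close> annihilates the difference of the two sides, and totality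
  leaves only zero.\<close>

lemma proj_UNIV:
  assumes f: "f \<in> L2 M"
  shows "AE x in M. proj UNIV f x = f x"
proof -
  have "AE x in M. D i (\<lambda>x. 1 * proj UNIV f x + (- 1) * f x) x = 0" for i
  proof (rule l2_inner_eqI)
    fix h assume "h \<in> L2 M"
    then have "l2_inner M (D i (\<lambda>x. 1 * proj UNIV f x + (- 1) * f x)) h = 0"
      using f inner_D_proj[of f h i UNIV]
      by (subst inner_D_linear) auto
    then show "l2_inner M (D i (\<lambda>x. 1 * proj UNIV f x + (- 1) * f x)) h = l2_inner M (\<lambda>x. 0) h"
      by (simp add: l2_inner_def)
  qed (intro D_L2 L2_add L2_cmult proj_L2 f L2_zero)+
  then have "AE x in M. 1 * proj UNIV f x + (- 1) * f x = 0"
    by (rule total[rotated]) (intro L2_add L2_cmult proj_L2 f)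
  then show ?thesis by simp
qed

lemma expansion_tendsto:
  assumes f: "f \<in> L2 M"
  shows "(\<lambda>n. l2_inner M (\<lambda>x. f x - (\<Sum>i<n. D i f x)) (\<lambda>x. f x - (\<Sum>i<n. D i f x))) \<longlonglongrightarrow> 0"
proof -
  have "l2_inner M (\<lambda>x. f x - (\<Sum>i<n. D i f x)) (\<lambda>x. f x - (\<Sum>i<n. D i f x))
      = l2_inner M (\<lambda>x. (\<Sum>i<n. D i f x) - proj UNIV f x) (\<lambda>x. (\<Sum>i<n. D i f x) - proj UNIV f x)" for n
  proof -
    have [measurable]: "f \<in> borel_measurable M" "proj UNIV f \<in> borel_measurable M"
      "D i f \<in> borel_measurable M" for i
      using f by (auto intro!: L2_measurable)
    show ?thesis
      unfolding l2_inner_def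
    proof (intro integral_cong_AE)
      show "AE x in M. (f x - (\<Sum>i<n. D i f x)) * (f x - (\<Sum>i<n. D i f x)) =
        ((\<Sum>i<n. D i f x) - proj UNIV f x) * ((\<Sum>i<n. D i f x) - proj UNIV f x)"
        using proj_UNIV[OF f] by eventually_elim (simp add: algebra_simps)
    qed measurable
  qed
  then show ?thesis using proj_tendsto[OF f, of UNIV] by simp
qed

lemma inner_proj_proj:
  assumes "f \<in> L2 M" "h \<in> L2 M"
  shows "l2_inner M (proj I (proj J f)) h = l2_inner M (proj (I \<inter> J) f) h"
proof -
  have "(\<lambda>i. indicator I i * l2_inner M (D i (proj J f)) h) sums l2_inner M (proj I (proj J f)) h"
    using assms by (intro inner_proj_sums) auto
  moreover have "(\<lambda>i. indicator I i * l2_inner M (D i (proj J f)) h)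
      = (\<lambda>i. indicator (I \<inter> J) i * l2_inner M (D i f) h)"
    using assms by (simp add: inner_D_proj indicator_inter_arith mult.assoc)
  ultimately show ?thesis
    using sums_unique2[OF _ inner_proj_sums[OF assms, of "I \<inter> J"]] by metis
qed

lemma proj_Int:
  assumes "f \<in> L2 M"
  shows "AE x in M. proj (I \<inter> J) f x = proj I (proj J f) x"
  using assms by (intro l2_inner_eqI) (simp_all add: inner_proj_proj)

lemma proj_symmetric:
  assumes "f \<in> L2 M" "g \<in> L2 M"
  shows "l2_inner M (proj I f) g = l2_inner M f (proj I g)"
proof -
  have "l2_inner M (D i f) g = l2_inner M (D i g) f" for i
    using assms D_symmetric[of f g i] by (simp add: l2_inner_commute)
  then show ?thesis
    using sums_unique2[OF inner_proj_sums[OF assms, of I]] inner_proj_sums[OF assms(2,1), of I]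
    by (simp add: l2_inner_commute[of M f])
qed

lemma proj_linear:
  assumes "f \<in> L2 M" "g \<in> L2 M"
  shows "AE x in M. proj I (\<lambda>y. a * f y + b * g y) x = a * proj I f x + b * proj I g x"
proof (rule l2_inner_eqI)
  fix h assume h: "h \<in> L2 M"
  have "(\<lambda>i. a * (indicator I i * l2_inner M (D i f) h) + b * (indicator I i * l2_inner M (D i g) h))
      sums (a * l2_inner M (proj I f) h + b * l2_inner M (proj I g) h)"
    using assms h by (intro sums_add sums_mult inner_proj_sums)
  also have "(\<lambda>i. a * (indicator I i * l2_inner M (D i f) h) + b * (indicator I i * l2_inner M (D i g) h))
      = (\<lambda>i. indicator I i * l2_inner M (D i (\<lambda>y. a * f y + b * g y)) h)"
    using assms h by (simp add: inner_D_linear algebra_simps)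
  finally have "l2_inner M (proj I (\<lambda>y. a * f y + b * g y)) h
      = a * l2_inner M (proj I f) h + b * l2_inner M (proj I g) h"
    using assms h by (intro sums_unique2[OF inner_proj_sums] L2_add L2_cmult)
  then show "l2_inner M (proj I (\<lambda>y. a * f y + b * g y)) h
      = l2_inner M (\<lambda>x. a * proj I f x + b * proj I g x) h"
    using assms h by (simp add: l2_inner_add_left l2_inner_cmult_left L2_cmult)
qed (use assms in \<open>auto intro!: proj_L2 L2_add L2_cmult\<close>)

lemma proj_cong:
  assumes "f \<in> L2 M" "g \<in> L2 M" "AE x in M. f x = g x"
  shows "AE x in M. proj I f x = proj I g x"
proof (rule l2_inner_eqI)
  fix h assume h: "h \<in> L2 M"
  have "l2_inner M (D i f) h = l2_inner M (D i g) h" for i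
    using assms h by (intro l2_inner_cong_AE D_cong) auto
  then show "l2_inner M (proj I f) h = l2_inner M (proj I g) h"
    using sums_unique2[OF inner_proj_sums[OF assms(1) h, of I]] inner_proj_sums[OF assms(2) h, of I]
    by simp
qed (use assms in auto)

lemma proj_orthogonal_projection: "l2_orthogonal_projection M (proj I)"
proof -
  have "AE x in M. proj I (proj I f) x = proj I f x" if "f \<in> L2 M" for f
    using proj_Int[OF that, of I I] by eventually_elim simp
  then show ?thesis
    unfolding l2_orthogonal_projection_def l2_linear_def
    using proj_linear proj_cong proj_symmetric by simp
qed

end


locale spectral_series = projection_series +
  fixes s :: "nat \<Rightarrow> real"
  assumes bounded: "\<bar>s i\<bar> \<le> 1"
begin

text \<open>The values \<open>s i\<close> may repeat, since different parents can share an
  eigenvalue; the preimage collects all summands whose value lies in \<open>A\<close>.\<close>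

definition resolution :: "real set \<Rightarrow> ('a \<Rightarrow> real) \<Rightarrow> 'a \<Rightarrow> real" where
  "resolution A = proj (s -` A)"

text \<open>The sum of point masses at \<open>s i\<close> with weight the squared norm of
  \<open>D i f\<close>. Written as the image of a weighted counting measure, it turns spectral
  integrals into series.\<close>

definition point_measure :: "('a \<Rightarrow> real) \<Rightarrow> real measure" where
  "point_measure f =
     distr (density (count_space UNIV) (\<lambda>i. ennreal (l2_inner M (D i f) (D i f)))) borel s"

lemma sets_point_measure: "sets (point_measure f) = sets borel" "space (point_measure f) = UNIV"
  by (simp_all add: point_measure_def)

lemma emeasure_point_measure:
  assumes f: "f \<in> L2 M" and A: "A \<in> sets borel"
  shows "emeasure (point_measure f) A = ennreal (l2_inner M (resolution A f) f)"
proof -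
  let ?a = "\<lambda>i. l2_inner M (D i f) (D i f)"
  have "emeasure (point_measure f) A = (\<integral>\<^sup>+i. ennreal (?a i) * indicator (s -` A) i \<partial>count_space UNIV)"
    using A by (simp add: point_measure_def emeasure_distr emeasure_density)
  also have "\<dots> = (\<Sum>i. ennreal (?a i) * indicator (s -` A) i)"
    by (simp add: nn_integral_count_space_nat)
  also have "\<dots> = (\<Sum>i. ennreal (indicator (s -` A) i * l2_inner M (D i f) f))"
    using f by (intro suminf_cong) (auto simp: inner_D_D indicator_def)
  also have "\<dots> = ennreal (l2_inner M (resolution A f) f)"
    unfolding resolution_def
  proof (intro suminf_ennreal_eq inner_proj_sums f)
    show "0 \<le> indicator (s -` A) i * l2_inner M (D i f) f" for i
      using l2_inner_self_nonneg[of M "D i f"] f by (simp add: inner_D_D)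
  qed
  finally show ?thesis .
qed

text \<open>\<open>measure_of\<close> returns the given set function only if that is a measure. Its
  agreement with the genuine measure \<open>point_measure f\<close> on Borel sets settles
  this.\<close>

lemma scalar_spectral_measure_resolution:
  assumes "f \<in> L2 M"
  shows "scalar_spectral_measure M resolution f = point_measure f"
proof -
  have "scalar_spectral_measure M resolution f
      = measure_of UNIV (sets borel) (emeasure (point_measure f))"
    unfolding scalar_spectral_measure_def
  proof (rule measure_of_eq)
    fix A :: "real set" assume "A \<in> sigma_sets UNIV (sets borel)"
    then have "A \<in> sets borel" using sets.sigma_sets_eq[of "borel :: real measure"] by simp
    then show "ennreal (l2_inner M (resolution A f) f) = emeasure (point_measure f) A"
      using assms by (simp add: emeasure_point_measure)
  qed auto
  also have "\<dots> = point_measure f"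
    using measure_of_of_measure[of "point_measure f"] by (simp add: sets_point_measure)
  finally show ?thesis .
qed

section \<open>Integration against the resolution\<close>

lemma integrable_point_measure:
  fixes \<phi> :: "real \<Rightarrow> real"
  assumes [measurable]: "\<phi> \<in> borel_measurable borel"
  shows "integrable (point_measure f) \<phi> \<longleftrightarrow>
    summable (\<lambda>i. l2_inner M (D i f) (D i f) * \<bar>\<phi> (s i)\<bar>)"
  unfolding point_measure_def
  by (simp add: integrable_distr_eq integrable_density integrable_count_space_nat_iff
      l2_inner_self_nonneg abs_mult)

lemma integral_point_measure:
  fixes \<phi> :: "real \<Rightarrow> real"
  assumes [measurable]: "\<phi> \<in> borel_measurable borel"
    and "summable (\<lambda>i. l2_inner M (D i f) (D i f) * \<bar>\<phi> (s i)\<bar>)"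
  shows "(\<lambda>i. l2_inner M (D i f) (D i f) * \<phi> (s i)) sums (\<integral>t. \<phi> t \<partial>point_measure f)"
proof -
  have "(\<integral>t. \<phi> t \<partial>point_measure f)
      = (\<integral>i. l2_inner M (D i f) (D i f) * \<phi> (s i) \<partial>count_space UNIV)"
    unfolding point_measure_def
    by (simp add: integral_distr integral_density l2_inner_self_nonneg)
  then show ?thesis
    using assms(2)
    by (auto intro!: sums_integral_count_space_nat
        simp: integrable_count_space_nat_iff l2_inner_self_nonneg abs_mult)
qed

lemma spectral_domain_resolution:
  assumes [measurable]: "\<phi> \<in> borel_measurable borel"
  shows "f \<in> spectral_domain M resolution \<phi> \<longleftrightarrow>
    f \<in> L2 M \<and> summable (\<lambda>i. l2_inner M (D i f) (D i f) * (\<phi> (s i))\<^sup>2)"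
  by (auto simp: spectral_domain_def scalar_spectral_measure_resolution integrable_point_measure)

text \<open>For strong countable additivity, the squared norm of the error collapses to a difference
  of values of \<open>point_measure f\<close>, so the countable additivity of that measure
  suffices.\<close>

lemma projection_valued_measure_resolution: "projection_valued_measure M resolution"
  unfolding projection_valued_measure_def
proof (intro conjI ballI allI impI)
  show "l2_orthogonal_projection M (resolution A)" for A
    unfolding resolution_def by (rule proj_orthogonal_projection)
  show "AE x in M. resolution UNIV f x = f x" if "f \<in> L2 M" for f
    using proj_UNIV[OF that] by (simp add: resolution_def)
  show "AE x in M. resolution (A \<inter> B) f x = resolution A (resolution B f) x" if "f \<in> L2 M" for A B f
    using proj_Int[OF that] by (simp add: resolution_def)
next
  fix A :: "nat \<Rightarrow> real set" and f
  assume A: "range A \<subseteq> sets borel" and disj: "disjoint_family A" and f: "f \<in> L2 M"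
  let ?U = "resolution (\<Union>i. A i) f" and ?E = "\<lambda>i. resolution (A i) f"
  let ?m = "\<lambda>A. l2_inner M (resolution A f) f"
  have L2: "resolution A f \<in> L2 M" for A
    using f by (simp add: resolution_def)
  have inter: "l2_inner M (resolution A f) (resolution B f) = ?m (A \<inter> B)" for A B
    using f inner_proj_proj[of f f "s -` B" "s -` A"] proj_symmetric[of "proj (s -` A) f" f "s -` B"]
    by (simp add: resolution_def Int_commute)
  have disjoint: "?m (A i \<inter> A j) = (if i = j then ?m (A i) else 0)" for i j
  proof (cases "i = j")
    case False
    then have "A i \<inter> A j = {}" using disj by (auto simp: disjoint_family_on_def)
    moreover have "?m {} = 0"
      using sums_unique2[OF inner_proj_sums[OF f f, of "{}"] sums_0] by (simp add: resolution_def)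
    ultimately show ?thesis using False by simp
  qed simp
  have "l2_inner M (\<lambda>x. ?U x - (\<Sum>i<n. ?E i x)) (\<lambda>x. ?U x - (\<Sum>i<n. ?E i x))
      = ?m (\<Union>i. A i) - (\<Sum>i<n. ?m (A i))" for n
  proof -
    have S: "(\<lambda>x. \<Sum>i<n. ?E i x) \<in> L2 M" by (intro L2_sum L2)
    have "l2_inner M (\<lambda>x. \<Sum>i<n. ?E i x) (\<lambda>x. \<Sum>i<n. ?E i x) = (\<Sum>i<n. ?m (A i))"
      using L2 S by (simp add: l2_inner_sum_left l2_inner_sum_right inter disjoint)
    moreover have "l2_inner M ?U (\<lambda>x. \<Sum>i<n. ?E i x) = (\<Sum>i<n. ?m (A i))"
      using L2 by (simp add: l2_inner_sum_right inter Int_absorb1 UN_upper)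
    ultimately show ?thesis
      using L2 S by (simp add: l2_inner_diff_left l2_inner_diff_right L2_diff inter
          l2_inner_commute[of M "\<lambda>x. \<Sum>i<n. ?E i x" ?U])
  qed
  moreover have "(\<lambda>n. ?m (\<Union>i. A i) - (\<Sum>i<n. ?m (A i))) \<longlonglongrightarrow> 0"
  proof -
    have nonneg: "0 \<le> ?m B" for B
      using inter[of B B] l2_inner_self_nonneg[of M "resolution B f"] by simp
    have "(\<lambda>i. emeasure (point_measure f) (A i)) sums emeasure (point_measure f) (\<Union>i. A i)"
      using A disj by (intro sums_emeasure) (auto simp: sets_point_measure disjoint_family_on_def)
    then have "(\<lambda>i. ennreal (?m (A i))) sums ennreal (?m (\<Union>i. A i))"
      using A f by (subst (asm) (1 2) emeasure_point_measure) auto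
    then have "(\<lambda>i. ?m (A i)) sums ?m (\<Union>i. A i)"
      using nonneg by (simp add: sums_ennreal)
    then have "(\<lambda>n. \<Sum>i<n. ?m (A i)) \<longlonglongrightarrow> ?m (\<Union>i. A i)"
      by (simp add: sums_def)
    from tendsto_diff[OF tendsto_const this, of "?m (\<Union>i. A i)"] show ?thesis by simp
  qed
  ultimately show "(\<lambda>n. l2_norm M (\<lambda>x. ?U x - (\<Sum>i<n. ?E i x))) \<longlonglongrightarrow> 0"
    by (simp add: l2_norm_tendsto_0_iff)
qed

text \<open>The last assumption is the spectral integral in coordinates. The work lies in the
  absolute convergence of the polarised integrals when \<open>\<phi>\<close> is unbounded.\<close>

lemma has_spectral_integral_resolution:
  assumes \<phi>: "\<phi> \<in> borel_measurable borel"
    and u: "u \<in> L2 M" "summable (\<lambda>i. l2_inner M (D i u) (D i u) * (\<phi> (s i))\<^sup>2)" and v: "v \<in> L2 M"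
    and sums: "\<And>h. h \<in> L2 M \<Longrightarrow> (\<lambda>i. \<phi> (s i) * l2_inner M (D i u) h) sums l2_inner M v h"
  shows "has_spectral_integral M resolution \<phi> u v"
  unfolding has_spectral_integral_def
proof (intro conjI ballI)
  show "u \<in> spectral_domain M resolution \<phi>"
    using \<phi> u by (simp add: spectral_domain_resolution)
  fix g assume "g \<in> spectral_domain M resolution \<phi>"
  then have g: "g \<in> L2 M" "summable (\<lambda>i. l2_inner M (D i g) (D i g) * (\<phi> (s i))\<^sup>2)"
    using \<phi> by (auto simp: spectral_domain_resolution)
  have norm_D: "l2_inner M (D i (\<lambda>x. u x + c * g x)) (D i (\<lambda>x. u x + c * g x))
      = l2_inner M (D i u) (D i u) + 2 * c * l2_inner M (D i u) g + c\<^sup>2 * l2_inner M (D i g) (D i g)"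
    for c i
  proof -
    have 1: "l2_inner M (D i (\<lambda>x. u x + c * g x)) h = l2_inner M (D i u) h + c * l2_inner M (D i g) h"
      if "h \<in> L2 M" for h
      using inner_D_linear[OF u(1) g(1) that, of i 1 c] by simp
    have 2: "(\<lambda>x. u x + c * g x) \<in> L2 M"
      using u g by (intro L2_add L2_cmult)
    have "l2_inner M (D i u) (\<lambda>x. u x + c * g x) = l2_inner M (D i u) u + c * l2_inner M (D i u) g"
      "l2_inner M (D i g) (\<lambda>x. u x + c * g x) = l2_inner M (D i g) u + c * l2_inner M (D i g) g"
      using u g by (simp_all add: l2_inner_add_right l2_inner_cmult_right L2_cmult)
    moreover have "l2_inner M (D i g) u = l2_inner M (D i u) g"
      using D_symmetric[OF u(1) g(1), of i] by (simp add: l2_inner_commute)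
    moreover have "l2_inner M (D i (\<lambda>x. u x + c * g x)) (D i (\<lambda>x. u x + c * g x))
        = l2_inner M (D i (\<lambda>x. u x + c * g x)) (\<lambda>x. u x + c * g x)"
      using inner_D_D[OF 2 2] by simp
    ultimately show ?thesis
      using u g 2 by (simp add: 1 inner_D_D power2_eq_square algebra_simps)
  qed
  \<comment> \<open>Membership in the domain controls only the square of \<open>\<phi>\<close>. As
    the weights themselves are summable, the bound of |\<phi>| by 1 plus its square gives
    integrability of \<open>\<phi>\<close>.\<close>
  have summable_abs: "summable (\<lambda>i. l2_inner M (D i f) (D i f) * \<bar>\<phi> (s i)\<bar>)"
    if "f \<in> L2 M" "summable (\<lambda>i. l2_inner M (D i f) (D i f) * (\<phi> (s i))\<^sup>2)" for f
  proof (rule summable_comparison_test'[OF summable_add[OF summable_D[OF that(1)] that(2)]])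
    fix i
    have "\<bar>\<phi> (s i)\<bar> \<le> 1 + (\<phi> (s i))\<^sup>2"
      using sum_squares_bound[of 1 "\<bar>\<phi> (s i)\<bar>"] by simp
    from mult_left_mono[OF this l2_inner_self_nonneg[of M "D i f"]]
    show "norm (l2_inner M (D i f) (D i f) * \<bar>\<phi> (s i)\<bar>)
        \<le> l2_inner M (D i f) (D i f) + l2_inner M (D i f) (D i f) * (\<phi> (s i))\<^sup>2"
      by (simp add: l2_inner_self_nonneg abs_mult distrib_left)
  qed
  have S1: "summable (\<lambda>i. \<bar>l2_inner M (D i u) g\<bar> * \<bar>\<phi> (s i)\<bar>)"
  proof (rule summable_comparison_test'[OF
        summable_add[OF summable_abs[OF u(1,2)] summable_abs[OF g(1,2)]]])
    fix i
    have "\<bar>l2_inner M (D i u) g\<bar> \<le> l2_inner M (D i u) (D i u) + l2_inner M (D i g) (D i g)"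
      using abs_inner_D_le[OF u(1) g(1), of i] by linarith
    from mult_right_mono[OF this abs_ge_zero[of "\<phi> (s i)"]]
    show "norm (\<bar>l2_inner M (D i u) g\<bar> * \<bar>\<phi> (s i)\<bar>) \<le> l2_inner M (D i u) (D i u) * \<bar>\<phi> (s i)\<bar>
        + l2_inner M (D i g) (D i g) * \<bar>\<phi> (s i)\<bar>"
      by (simp add: abs_mult distrib_right)
  qed
  have int: "(\<lambda>i. (l2_inner M (D i u) (D i u) + 2 * c * l2_inner M (D i u) g
        + c\<^sup>2 * l2_inner M (D i g) (D i g)) * \<phi> (s i))
      sums (\<integral>t. \<phi> t \<partial>scalar_spectral_measure M resolution (\<lambda>x. u x + c * g x))" for c
  proof -
    let ?w = "\<lambda>x. u x + c * g x"
    have w: "?w \<in> L2 M" using u g by (intro L2_add L2_cmult)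
    have "summable (\<lambda>i. l2_inner M (D i u) (D i u) * \<bar>\<phi> (s i)\<bar>
        + 2 * \<bar>c\<bar> * (\<bar>l2_inner M (D i u) g\<bar> * \<bar>\<phi> (s i)\<bar>)
        + c\<^sup>2 * (l2_inner M (D i g) (D i g) * \<bar>\<phi> (s i)\<bar>))"
      by (intro summable_add summable_mult summable_abs S1 u g)
    then have "summable (\<lambda>i. l2_inner M (D i ?w) (D i ?w) * \<bar>\<phi> (s i)\<bar>)"
    proof (rule summable_comparison_test')
      fix i
      have "l2_inner M (D i ?w) (D i ?w) \<le> l2_inner M (D i u) (D i u)
          + 2 * \<bar>c\<bar> * \<bar>l2_inner M (D i u) g\<bar> + c\<^sup>2 * l2_inner M (D i g) (D i g)"
        using abs_ge_self[of "c * l2_inner M (D i u) g"] by (simp add: norm_D abs_mult)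
      from mult_right_mono[OF this abs_ge_zero[of "\<phi> (s i)"]]
      show "norm (l2_inner M (D i ?w) (D i ?w) * \<bar>\<phi> (s i)\<bar>)
        \<le> l2_inner M (D i u) (D i u) * \<bar>\<phi> (s i)\<bar>
        + 2 * \<bar>c\<bar> * (\<bar>l2_inner M (D i u) g\<bar> * \<bar>\<phi> (s i)\<bar>)
        + c\<^sup>2 * (l2_inner M (D i g) (D i g) * \<bar>\<phi> (s i)\<bar>)"
        by (simp add: abs_mult l2_inner_self_nonneg distrib_right mult.assoc)
    qed
    from integral_point_measure[OF \<phi> this] show ?thesis
      using w by (simp add: scalar_spectral_measure_resolution norm_D)
  qed
  \<comment> \<open>Between \<open>c = 1\<close> and \<open>c = -1\<close> the diagonal terms cancel
    and the mixed term survives four times.\<close>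
  have "(\<lambda>i. \<phi> (s i) * l2_inner M (D i u) g) sums
      (((\<integral>t. \<phi> t \<partial>scalar_spectral_measure M resolution (\<lambda>x. u x + g x)) -
        (\<integral>t. \<phi> t \<partial>scalar_spectral_measure M resolution (\<lambda>x. u x - g x))) / 4)"
    using sums_divide[OF sums_diff[OF int[of 1] int[of "-1"]], of 4]
    by (simp add: algebra_simps)
  then show "l2_inner M v g =
      ((\<integral>t. \<phi> t \<partial>scalar_spectral_measure M resolution (\<lambda>x. u x + g x)) -
       (\<integral>t. \<phi> t \<partial>scalar_spectral_measure M resolution (\<lambda>x. u x - g x))) / 4"
    by (rule sums_unique2[OF sums[OF g(1)]])
qed (rule v)

lemma spectral_resolution_resolution:
  assumes T: "\<And>f. f \<in> L2 M \<Longrightarrow> T f \<in> L2 M"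
    and sums: "\<And>f h. f \<in> L2 M \<Longrightarrow> h \<in> L2 M \<Longrightarrow>
      (\<lambda>i. s i * l2_inner M (D i f) h) sums l2_inner M (T f) h"
  shows "spectral_resolution M T resolution"
  unfolding spectral_resolution_def
proof (intro conjI ballI projection_valued_measure_resolution)
  fix f assume f: "f \<in> L2 M"
  show "has_spectral_integral M resolution (\<lambda>s. s) f (T f)"
  proof (rule has_spectral_integral_resolution)
    show "summable (\<lambda>i. l2_inner M (D i f) (D i f) * (s i)\<^sup>2)"
    proof (rule summable_comparison_test'[OF summable_D[OF f]])
      fix i
      have "(s i)\<^sup>2 \<le> 1" using bounded[of i] by (simp add: abs_square_le_1)
      from mult_left_mono[OF this l2_inner_self_nonneg[of M "D i f"]]
      show "norm (l2_inner M (D i f) (D i f) * (s i)\<^sup>2) \<le> l2_inner M (D i f) (D i f)"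
        by (simp add: l2_inner_self_nonneg abs_mult)
    qed
  qed (use f T sums in auto)
qed

end


section \<open>Families of eigenfunctions\<close>

lemma l2_linear_L2:
  assumes "l2_linear M T" "f \<in> L2 M"
  shows "T f \<in> L2 M"
proof -
  have "\<forall>f\<in>L2 M. T f \<in> L2 M"
    using assms(1) unfolding l2_linear_def by (elim conjE)
  then show ?thesis using assms(2) by (rule bspec)
qed

lemma l2_linear_combination:
  assumes "l2_linear M T" "f \<in> L2 M" "g \<in> L2 M"
  shows "AE x in M. T (\<lambda>y. a * f y + b * g y) x = a * T f x + b * T g x"
proof -
  have "\<forall>f\<in>L2 M. \<forall>g\<in>L2 M. \<forall>a b. AE x in M. T (\<lambda>y. a * f y + b * g y) x = a * T f x + b * T g x"
    using assms(1) unfolding l2_linear_def by (elim conjE)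
  from this[rule_format, OF assms(2,3)] show ?thesis .
qed

lemma l2_linear_eigen_sum:
  assumes T: "l2_linear M T" and "finite F"
    and g: "\<And>i. i \<in> F \<Longrightarrow> g i \<in> L2 M" "\<And>i. i \<in> F \<Longrightarrow> AE x in M. T (g i) x = t i * g i x"
  shows "AE x in M. T (\<lambda>x. \<Sum>i\<in>F. a i * g i x) x = (\<Sum>i\<in>F. t i * (a i * g i x))"
  using assms(2) g
proof (induction F rule: finite_induct)
  case empty
  show ?case
    \<comment> \<open>The zero function is a combination with zero coefficients, so linearity makes
      its image vanish almost everywhere.\<close>
    using l2_linear_combination[OF T L2_zero L2_zero, of 0 0] by simp
next
  case (insert i F)
  let ?S = "\<lambda>x. \<Sum>i\<in>F. a i * g i x"
  have "?S \<in> L2 M" "g i \<in> L2 M"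
    using insert by (auto intro!: L2_sum L2_cmult)
  then have "AE x in M. T (\<lambda>y. a i * g i y + 1 * ?S y) x = a i * T (g i) x + 1 * T ?S x"
    by (intro l2_linear_combination[OF T])
  moreover have "AE x in M. T (g i) x = t i * g i x" "AE x in M. T ?S x = (\<Sum>i\<in>F. t i * (a i * g i x))"
    using insert by auto
  ultimately show ?case
    by eventually_elim (use insert(1,2) in simp)
qed

text \<open>Within one fibre the functions may be linearly dependent. The assumption
  \<open>reproducing\<close> replaces orthonormality: with the weights \<open>c\<close> it makes
  \<open>frame_proj\<close> the identity on the span of a fibre.\<close>

locale eigenframe =
  fixes M :: "'a measure" and K :: "'i set" and \<phi> :: "'i \<Rightarrow> 'a \<Rightarrow> real"
    and c :: "'i \<Rightarrow> real" and idx :: "'i \<Rightarrow> nat"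
  assumes \<phi>_L2: "C \<in> K \<Longrightarrow> \<phi> C \<in> L2 M"
    and finite_fibre: "finite {C\<in>K. idx C = n}"
    and orthogonal_fibres: "\<lbrakk>C \<in> K; C' \<in> K; idx C \<noteq> idx C'\<rbrakk> \<Longrightarrow> l2_inner M (\<phi> C) (\<phi> C') = 0"
    and reproducing: "C \<in> K \<Longrightarrow>
      (\<Sum>C'\<in>{C'\<in>K. idx C' = idx C}. c C' * l2_inner M (\<phi> C) (\<phi> C') * \<phi> C' x) = \<phi> C x"
    and total_frame: "\<lbrakk>g \<in> L2 M; \<And>C. C \<in> K \<Longrightarrow> l2_inner M g (\<phi> C) = 0\<rbrakk> \<Longrightarrow> AE x in M. g x = 0"
begin

definition fibre :: "nat \<Rightarrow> 'i set" where
  "fibre n = {C\<in>K. idx C = n}"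

definition frame_proj :: "nat \<Rightarrow> ('a \<Rightarrow> real) \<Rightarrow> 'a \<Rightarrow> real" where
  "frame_proj n f x = (\<Sum>C\<in>fibre n. c C * l2_inner M f (\<phi> C) * \<phi> C x)"

lemma fibre: "finite (fibre n)" "C \<in> fibre n \<Longrightarrow> C \<in> K" "C \<in> fibre n \<Longrightarrow> idx C = n"
  using finite_fibre by (auto simp: fibre_def)

lemma frame_proj_L2: "frame_proj n f \<in> L2 M"
  unfolding frame_proj_def by (intro L2_sum L2_cmult \<phi>_L2 fibre)

lemma frame_proj_\<phi>:
  assumes "C \<in> K"
  shows "frame_proj n (\<phi> C) = (if idx C = n then \<phi> C else (\<lambda>x. 0))"
proof (cases "idx C = n")
  case True
  then show ?thesis
    using reproducing[OF assms] by (auto simp: frame_proj_def fibre_def)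
next
  case False
  then have "l2_inner M (\<phi> C) (\<phi> C') = 0" if "C' \<in> fibre n" for C'
    using orthogonal_fibres[OF assms, of C'] fibre(2,3)[OF that] by auto
  then show ?thesis using False by (simp add: frame_proj_def fun_eq_iff)
qed

lemma inner_frame_proj:
  assumes "g \<in> L2 M"
  shows "l2_inner M (frame_proj n f) g = (\<Sum>C\<in>fibre n. c C * l2_inner M f (\<phi> C) * l2_inner M (\<phi> C) g)"
  unfolding frame_proj_def using assms
  by (subst l2_inner_sum_left) (auto intro!: L2_cmult \<phi>_L2 fibre sum.cong simp: l2_inner_cmult_left)

lemma frame_proj_symmetric:
  assumes "f \<in> L2 M" "g \<in> L2 M"
  shows "l2_inner M (frame_proj n f) g = l2_inner M f (frame_proj n g)"
  using assms
  by (simp add: inner_frame_proj l2_inner_commute[of M f "frame_proj n g"] l2_inner_commute[of M "\<phi> _"]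
      mult.commute mult.left_commute)

lemma inner_frame_proj_\<phi>:
  assumes "f \<in> L2 M" "C \<in> K"
  shows "l2_inner M (frame_proj n f) (\<phi> C) = (if idx C = n then l2_inner M f (\<phi> C) else 0)"
  using assms by (simp add: frame_proj_symmetric \<phi>_L2 frame_proj_\<phi>) (simp add: l2_inner_def)

lemma frame_proj_frame_proj:
  assumes "f \<in> L2 M"
  shows "frame_proj m (frame_proj n f) = (if m = n then frame_proj n f else (\<lambda>x. 0))"
proof
  fix x
  have "frame_proj m (frame_proj n f) x
      = (\<Sum>C\<in>fibre m. if m = n then c C * l2_inner M f (\<phi> C) * \<phi> C x else 0)"
    unfolding frame_proj_def[of m] using assms fibre(2,3)
    by (intro sum.cong) (auto simp: inner_frame_proj_\<phi>)
  then show "frame_proj m (frame_proj n f) x = (if m = n then frame_proj n f else (\<lambda>x. 0)) x"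
    by (simp add: frame_proj_def)
qed

sublocale projection_series M frame_proj
proof
  show "l2_orthogonal_projection M (frame_proj n)" for n
    unfolding l2_orthogonal_projection_def l2_linear_def
  proof (intro conjI ballI allI impI)
    fix f g assume fg: "f \<in> L2 M" "g \<in> L2 M"
    show "AE x in M. frame_proj n f x = frame_proj n g x" if "AE x in M. f x = g x"
    proof -
      have "l2_inner M f (\<phi> C) = l2_inner M g (\<phi> C)" if "C \<in> fibre n" for C
        using fg \<open>AE x in M. f x = g x\<close> that by (intro l2_inner_cong_AE \<phi>_L2 fibre)
      then show ?thesis by (simp add: frame_proj_def)
    qed
    fix a b
    have "l2_inner M (\<lambda>y. a * f y + b * g y) (\<phi> C) = a * l2_inner M f (\<phi> C) + b * l2_inner M g (\<phi> C)"
      if "C \<in> fibre n" for C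
      using fg fibre(2)[OF that] by (simp add: l2_inner_add_left l2_inner_cmult_left L2_cmult \<phi>_L2)
    then show "AE x in M. frame_proj n (\<lambda>y. a * f y + b * g y) x = a * frame_proj n f x + b * frame_proj n g x"
      by (simp add: frame_proj_def sum_distrib_left sum.distrib[symmetric] algebra_simps)
  qed (use frame_proj_L2 frame_proj_symmetric in \<open>auto simp: frame_proj_frame_proj\<close>)
  show "AE x in M. frame_proj i (frame_proj j f) x = 0" if "i \<noteq> j" "f \<in> L2 M" for i j f
    using that by (simp add: frame_proj_frame_proj)
  fix g assume g: "g \<in> L2 M" "\<And>i. AE x in M. frame_proj i g x = 0"
  show "AE x in M. g x = 0"
  proof (rule total_frame[OF g(1)])
    fix C assume C: "C \<in> K"
    \<comment> \<open>Pairing with \<open>\<phi> C\<close> sees only the fibre of \<open>C\<close>,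
      so a function with vanishing projections is orthogonal to the whole family.\<close>
    have "l2_inner M g (\<phi> C) = l2_inner M (frame_proj (idx C) g) (\<phi> C)"
      using g C by (simp add: inner_frame_proj_\<phi>)
    also have "\<dots> = l2_inner M (\<lambda>x. 0) (\<phi> C)"
      using g C by (intro l2_inner_cong_AE frame_proj_L2 L2_zero \<phi>_L2)
    finally show "l2_inner M g (\<phi> C) = 0" by (simp add: l2_inner_def)
  qed
qed

lemma l2_complete_frame: "l2_complete M (\<phi> ` K)"
  unfolding l2_complete_def
proof (intro conjI ballI allI impI)
  show "\<phi> ` K \<subseteq> L2 M" using \<phi>_L2 by auto
  fix g and \<epsilon> :: real assume g: "g \<in> L2 M" and "\<epsilon> > 0"
  have "(\<lambda>n. l2_norm M (\<lambda>x. g x - (\<Sum>i<n. frame_proj i g x))) \<longlonglongrightarrow> 0"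
    unfolding l2_norm_tendsto_0_iff by (rule expansion_tendsto[OF g])
  from order_tendstoD(2)[OF this \<open>\<epsilon> > 0\<close>] obtain n where
    n: "l2_norm M (\<lambda>x. g x - (\<Sum>i<n. frame_proj i g x)) < \<epsilon>"
    using eventually_happens'[OF sequentially_bot] by blast
  define F where "F = (\<Union>i<n. fibre i)"
  have F: "finite F" "F \<subseteq> K" unfolding F_def using fibre by auto
  \<comment> \<open>Completeness refers to a set of functions, whereas distinct indices may give the
    same function. The coefficients of equal functions are therefore added up.\<close>
  define b where "b f = (\<Sum>C\<in>{C\<in>F. \<phi> C = f}. c C * l2_inner M g (\<phi> C))" for f
  have "(\<Sum>i<n. frame_proj i g x) = (\<Sum>f\<in>\<phi> ` F. b f * f x)" for x
  proof -
    have "(\<Sum>i<n. frame_proj i g x) = (\<Sum>C\<in>F. c C * l2_inner M g (\<phi> C) * \<phi> C x)"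
      unfolding F_def frame_proj_def
      by (subst sum.UNION_disjoint) (auto simp: fibre(1) dest!: fibre(3))
    also have "\<dots> = (\<Sum>f\<in>\<phi> ` F. \<Sum>C\<in>{C\<in>F. \<phi> C = f}. c C * l2_inner M g (\<phi> C) * \<phi> C x)"
      using F by (intro sum.image_gen)
    also have "\<dots> = (\<Sum>f\<in>\<phi> ` F. b f * f x)"
      unfolding b_def sum_distrib_right by (intro sum.cong) auto
    finally show ?thesis .
  qed
  with n F show "\<exists>S b. finite S \<and> S \<subseteq> \<phi> ` K \<and> l2_norm M (\<lambda>x. g x - (\<Sum>f\<in>S. b f * f x)) < \<epsilon>"
    by (intro exI[of _ "\<phi> ` F"] exI[of _ b]) auto
qed

text \<open>A contraction is determined by its values on a complete family: \<open>T\<close> acts on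
  the i-th summand of an expansion as \<open>s i\<close>, and contractivity carries this to the
  limit. So \<open>resolution\<close> resolves \<open>T\<close> and can serve as the witness in
  \<open>functional_calculus\<close>.\<close>

theorem functional_calculus_frame:
  assumes s: "\<And>n. \<bar>s n\<bar> \<le> 1"
    and T: "l2_linear M T" "\<And>f. f \<in> L2 M \<Longrightarrow> l2_inner M (T f) (T f) \<le> l2_inner M f f"
    and eigen: "\<And>C. C \<in> K \<Longrightarrow> AE x in M. T (\<phi> C) x = s (idx C) * \<phi> C x"
    and \<psi>: "\<psi> \<in> borel_measurable borel" and C: "C \<in> K"
  shows "functional_calculus M T \<psi> (\<phi> C) (\<lambda>x. \<psi> (s (idx C)) * \<phi> C x)"
proof -
  interpret spectral_series M frame_proj s
    by standard (rule s)
  have T_proj: "AE x in M. T (frame_proj i f) x = s i * frame_proj i f x" for i f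
  proof -
    have "AE x in M. T (\<phi> C) x = s i * \<phi> C x" if "C \<in> fibre i" for C
      using eigen[OF fibre(2)[OF that]] fibre(3)[OF that] by simp
    then have "AE x in M. T (frame_proj i f) x =
        (\<Sum>C\<in>fibre i. s i * (c C * l2_inner M f (\<phi> C) * \<phi> C x))"
      unfolding frame_proj_def by (intro l2_linear_eigen_sum T(1) fibre \<phi>_L2)
    then show ?thesis by (simp add: frame_proj_def sum_distrib_left)
  qed
  have sums: "(\<lambda>i. s i * l2_inner M (frame_proj i f) h) sums l2_inner M (T f) h"
    if f: "f \<in> L2 M" and h: "h \<in> L2 M" for f h
  proof -
    let ?S = "\<lambda>n x. \<Sum>i<n. frame_proj i f x"
    have S: "?S n \<in> L2 M" for n by (intro L2_sum frame_proj_L2)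
    have TS: "AE x in M. T (?S n) x = (\<Sum>i<n. s i * frame_proj i f x)" for n
      using l2_linear_eigen_sum[OF T(1), of "{..<n}" "\<lambda>i. frame_proj i f" s "\<lambda>_. 1"] T_proj frame_proj_L2
      by simp
    \<comment> \<open>Up to sign this error is the image under \<open>T\<close> of the error of the
      expansion.\<close>
    have "l2_inner M (\<lambda>x. T (?S n) x - T f x) (\<lambda>x. T (?S n) x - T f x)
        \<le> l2_inner M (\<lambda>x. f x - ?S n x) (\<lambda>x. f x - ?S n x)" for n
    proof -
      let ?d = "\<lambda>x. f x - ?S n x"
      have d: "?d \<in> L2 M" using f S by (rule L2_diff)
      have "AE x in M. T (\<lambda>y. 1 * f y + (-1) * ?S n y) x = 1 * T f x + (-1) * T (?S n) x"
        by (intro l2_linear_combination[OF T(1)] f S)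
      then have Td: "AE x in M. T ?d x = T f x - T (?S n) x" by simp
      have [measurable]: "T ?d \<in> borel_measurable M" "T f \<in> borel_measurable M"
        "T (?S n) \<in> borel_measurable M"
        using l2_linear_L2[OF T(1)] d f S by (auto intro!: L2_measurable)
      have "l2_inner M (\<lambda>x. T (?S n) x - T f x) (\<lambda>x. T (?S n) x - T f x) = l2_inner M (T ?d) (T ?d)"
        unfolding l2_inner_def
      proof (intro integral_cong_AE)
        show "AE x in M. (T (?S n) x - T f x) * (T (?S n) x - T f x) = T ?d x * T ?d x"
          using Td
        proof eventually_elim
          case (elim x)
          show ?case unfolding elim by (simp add: algebra_simps)
        qed
      qed measurable
      then show ?thesis using T(2)[OF d] by simp
    qed
    then have "(\<lambda>n. l2_inner M (\<lambda>x. T (?S n) x - T f x) (\<lambda>x. T (?S n) x - T f x)) \<longlonglongrightarrow> 0"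
      by (intro tendsto_sandwich[OF _ _ tendsto_const expansion_tendsto[OF f]])
        (auto simp: l2_inner_self_nonneg intro!: always_eventually)
    then have "(\<lambda>n. l2_inner M (T (?S n)) h) \<longlonglongrightarrow> l2_inner M (T f) h"
      using f h S by (intro l2_inner_tendsto l2_linear_L2[OF T(1)])
    also have "(\<lambda>n. l2_inner M (T (?S n)) h) = (\<lambda>n. \<Sum>i<n. s i * l2_inner M (frame_proj i f) h)"
    proof
      fix n
      have "l2_inner M (T (?S n)) h = l2_inner M (\<lambda>x. \<Sum>i<n. s i * frame_proj i f x) h"
        using TS h S by (intro l2_inner_cong_AE l2_linear_L2[OF T(1)] L2_sum L2_cmult frame_proj_L2)
      then show "l2_inner M (T (?S n)) h = (\<Sum>i<n. s i * l2_inner M (frame_proj i f) h)"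
        using h by (simp add: l2_inner_sum_left l2_inner_cmult_left L2_cmult frame_proj_L2)
    qed
    finally show ?thesis by (simp add: sums_def)
  qed
  have "has_spectral_integral M resolution \<psi> (\<phi> C) (\<lambda>x. \<psi> (s (idx C)) * \<phi> C x)"
  proof (rule has_spectral_integral_resolution[OF \<psi> \<phi>_L2[OF C]])
    have 0: "l2_inner M (\<lambda>x. 0) g = 0" for g by (simp add: l2_inner_def)
    \<comment> \<open>Only the summand \<open>i = idx C\<close> is non-zero, so
      \<open>\<phi> C\<close> is in the domain however large \<open>\<psi>\<close> may be.\<close>
    show "summable (\<lambda>i. l2_inner M (frame_proj i (\<phi> C)) (frame_proj i (\<phi> C)) * (\<psi> (s i))\<^sup>2)"
      using C by (intro summable_finite[of "{idx C}"]) (auto simp: frame_proj_\<phi> 0)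
    show "(\<lambda>x. \<psi> (s (idx C)) * \<phi> C x) \<in> L2 M"
      using C by (intro L2_cmult \<phi>_L2)
    fix h assume "h \<in> L2 M"
    have "(\<lambda>i. \<psi> (s i) * l2_inner M (frame_proj i (\<phi> C)) h)
        = (\<lambda>i. if i = idx C then \<psi> (s i) * l2_inner M (\<phi> C) h else 0)"
      using C by (auto simp: frame_proj_\<phi> 0)
    then show "(\<lambda>i. \<psi> (s i) * l2_inner M (frame_proj i (\<phi> C)) h)
        sums l2_inner M (\<lambda>x. \<psi> (s (idx C)) * \<phi> C x) h"
      using sums_single[of "idx C" "\<lambda>i. \<psi> (s i) * l2_inner M (\<phi> C) h"]
      by (simp add: l2_inner_cmult_left)
  qed
  moreover have "spectral_resolution M T resolution"
    using l2_linear_L2[OF T(1)] sums by (rule spectral_resolution_resolution)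
  ultimately show ?thesis unfolding functional_calculus_def by blast
qed

end


section \<open>Balls in a proper ultrametric space\<close>

lemma diameter_eqI:
  fixes S :: "'a::metric_space set"
  assumes "x \<in> S" "y \<in> S" "dist x y = d" "\<And>u v. u \<in> S \<Longrightarrow> v \<in> S \<Longrightarrow> dist u v \<le> d"
  shows "diameter S = d"
proof (rule antisym)
  show "diameter S \<le> d"
    using assms by (auto simp: diameter_def intro!: cSUP_least)
  have "bounded S"
    using assms by (auto simp: bounded_def)
  then show "d \<le> diameter S"
    using assms(1-3) diameter_bounded_bound by blast
qed

locale proper_ultrametric =
  fixes space_type :: "'a::metric_space itself"
  assumes ultrametric: "ultrametric TYPE('a)"
    and compact_cball: "\<And>(x::'a) r. compact (cball x r)"
begin

lemma dist_le_max: "dist x z \<le> max (dist x y) (dist y z)" for x y z :: 'a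
  using ultrametric by (simp add: ultrametric_def)

lemma cball_eq: "y \<in> cball x r \<Longrightarrow> cball y r = cball x r" for x y :: 'a
proof -
  assume "y \<in> cball x r"
  then have "dist y z \<le> r \<longleftrightarrow> dist x z \<le> r" for z
    using dist_le_max[of x z y] dist_le_max[of y z x] by (auto simp: dist_commute)
  then show ?thesis by auto
qed

lemma ball_eq: "y \<in> ball x r \<Longrightarrow> ball y r = ball x r" for x y :: 'a
proof -
  assume "y \<in> ball x r"
  then have "dist y z < r \<longleftrightarrow> dist x z < r" for z
    using dist_le_max[of x z y] dist_le_max[of y z x] by (auto simp: dist_commute)
  then show ?thesis by auto
qed

lemma open_cball: "0 < r \<Longrightarrow> open (cball x r)" for x :: 'a
  unfolding open_contains_cball using cball_eq by blast

lemma cball_positive_ball: "0 < r \<Longrightarrow> cball x r \<in> positive_balls" for x :: 'a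
  unfolding positive_balls_def by blast

lemma is_ball_compact: "is_ball A \<Longrightarrow> compact A" for A :: "'a set"
  using compact_cball by (auto simp: is_ball_def)

lemma is_ball_nonempty: "is_ball A \<Longrightarrow> A \<noteq> {}" for A :: "'a set"
  by (auto simp: is_ball_def)

lemma is_ball_center: "is_ball A \<Longrightarrow> x \<in> A \<Longrightarrow> \<exists>r\<ge>0. A = cball x r" for A :: "'a set"
  using cball_eq by (fastforce simp: is_ball_def)

lemma positive_ball_center: "C \<in> positive_balls \<Longrightarrow> x \<in> C \<Longrightarrow> \<exists>r>0. C = cball x r" for C :: "'a set"
  using cball_eq by (fastforce simp: positive_balls_def)

lemma is_ball_nested: "\<lbrakk>is_ball A; is_ball B; x \<in> A; x \<in> B\<rbrakk> \<Longrightarrow> A \<subseteq> B \<or> B \<subseteq> A" for A B :: "'a set"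
  by (metis is_ball_center linorder_linear subset_cball)

lemma positive_ball_is_ball: "C \<in> positive_balls \<Longrightarrow> is_ball C" for C :: "'a set"
  by (auto simp: positive_balls_def is_ball_def intro: less_imp_le)

lemma positive_ball_open: "C \<in> positive_balls \<Longrightarrow> open C" for C :: "'a set"
  using open_cball by (auto simp: positive_balls_def)

text \<open>An open ball is also closed, hence compact, so the distance from the centre attains its
  maximum, which lies strictly below \<open>r\<close>.\<close>

lemma ball_positive_ball:
  fixes x :: 'a
  assumes r: "0 < r"
  shows "ball x r \<in> positive_balls"
proof -
  have "closed (ball x r)"
  proof -
    have "open (- ball x r)"
      unfolding open_contains_ball
    proof
      fix y assume y: "y \<in> - ball x r"
      have "ball y r \<subseteq> - ball x r"
        using ball_eq[of _ x r] ball_eq[of _ y r] y r by (metis ComplD ComplI centre_in_ball subsetI)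
      then show "\<exists>e>0. ball y e \<subseteq> - ball x r" using r by blast
    qed
    then show ?thesis by (simp add: closed_def)
  qed
  then have "compact (ball x r)"
    using compact_Int_closed[OF compact_cball[of x r], of "ball x r"] ball_subset_cball[of x r]
    by (simp add: Int_absorb1)
  then obtain z where z: "z \<in> ball x r" "\<And>y. y \<in> ball x r \<Longrightarrow> dist x y \<le> dist x z"
    using r continuous_attains_sup[of "ball x r" "dist x", OF _ _ continuous_on_dist[OF continuous_on_const continuous_on_id]]
    by auto
  \<comment> \<open>The midpoint between the maximal distance and \<open>r\<close> is positive even
    if the ball is a single point.\<close>
  have "ball x r = cball x ((dist x z + r) / 2)"
    using z by (fastforce simp: field_simps)
  moreover have "0 < (dist x z + r) / 2"
    using r by (simp add: add_nonneg_pos)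
  ultimately show ?thesis
    unfolding positive_balls_def by blast
qed

section \<open>Parents and children\<close>

lemma parent_unique:
  fixes C :: "'a set"
  assumes "C \<noteq> {}" "is_parent B C" "is_parent B' C"
  shows "B = B'"
proof -
  obtain x where "x \<in> C" using assms by auto
  then have "B \<subseteq> B' \<or> B' \<subseteq> B"
    using assms by (intro is_ball_nested[of B B' x]) (auto simp: is_parent_def)
  then show ?thesis
    using assms(2,3) unfolding is_parent_def by metis
qed

text \<open>The radius \<open>m\<close> is the distance from a centre of \<open>C\<close> to the
  complement of \<open>C\<close>, attained because \<open>C\<close> is open and balls are compact.
  The last clause, that \<open>m\<close> is attained from every point, later identifies
  \<open>m\<close> with the diameter.\<close>

lemma parent_exists:
  fixes C :: "'a set"
  assumes C: "C \<in> positive_balls" "C \<noteq> UNIV"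
  shows "\<exists>B m. is_parent B C \<and> 0 < m \<and> (\<forall>p\<in>B. B = cball p m \<and> (\<exists>q\<in>B. dist p q = m))"
proof -
  obtain x r where r: "0 < r" and Cr: "C = cball x r"
    using C by (auto simp: positive_balls_def)
  obtain y where y: "y \<notin> C" using C by auto
  \<comment> \<open>Cutting off at the distance of a point \<open>y\<close> outside \<open>C\<close>
    makes the set compact without losing the nearest points of the complement.\<close>
  define S where "S = cball x (dist x y) - C"
  have "compact S" "S \<noteq> {}"
    unfolding S_def using y positive_ball_open[OF C(1)] by (auto intro: compact_diff compact_cball)
  then obtain z where z: "z \<in> S" "\<And>w. w \<in> S \<Longrightarrow> dist x z \<le> dist x w"
    using continuous_attains_inf[of S "dist x", OF _ _ continuous_on_dist[OF continuous_on_const continuous_on_id]]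
    by auto
  define m where "m = dist x z"
  have m: "r < m" "m \<le> dist x y"
    using z by (auto simp: m_def S_def Cr)
  define B where "B = cball x m"
  have "is_parent B C"
    unfolding is_parent_def
  proof (intro conjI allI impI)
    show "is_ball B"
      unfolding is_ball_def B_def using m r by (intro exI[of _ x] exI[of _ m]) simp
    show "C \<subseteq> B" using m by (auto simp: Cr B_def)
    have "z \<in> B" "z \<notin> C" using z by (auto simp: B_def m_def S_def)
    then show "C \<noteq> B" by auto
    fix A assume A: "is_ball A \<and> C \<subseteq> A \<and> A \<subseteq> B"
    then have "x \<in> A" using r by (auto simp: Cr)
    then obtain t where t: "A = cball x t" using A is_ball_center by blast
    show "A = C \<or> A = B"
    proof (cases "m \<le> t")
      case True
      then have "B \<subseteq> A" by (auto simp: B_def t)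
      then show ?thesis using A by auto
    next
      case False
      have "A \<subseteq> C"
      proof
        fix w assume w: "w \<in> A"
        then have "w \<notin> S" using z(2)[of w] False by (auto simp: t m_def)
        then show "w \<in> C" using w False m by (auto simp: S_def t)
      qed
      then show ?thesis using A by auto
    qed
  qed
  \<comment> \<open>Isosceles triangles: a point closer than \<open>m\<close> to \<open>x\<close>
    has distance exactly \<open>m\<close> from \<open>z\<close>.\<close>
  moreover have "\<exists>q\<in>B. dist p q = m" if p: "p \<in> B" for p
  proof (cases "dist x p = m")
    case True
    then show ?thesis using m r by (intro bexI[of _ x]) (auto simp: B_def dist_commute)
  next
    case False
    then have "dist p z = m"
      using p dist_le_max[of p z x] dist_le_max[of x z p] by (auto simp: B_def m_def dist_commute)
    then show ?thesis by (intro bexI[of _ z]) (auto simp: B_def m_def)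
  qed
  ultimately show ?thesis
    using m r cball_eq by (intro exI[of _ B] exI[of _ m]) (auto simp: B_def)
qed

context
  fixes C :: "'a set"
  assumes C: "C \<in> positive_balls" "C \<noteq> UNIV"
begin

lemma positive_ball_nonempty: "C \<noteq> {}"
  using C by (auto simp: positive_balls_def)

lemma
  shows is_parent_parent: "is_parent (parent C) C"
    and diameter_parent_pos: "0 < diameter (parent C)"
    and parent_eq_cball: "p \<in> parent C \<Longrightarrow> parent C = cball p (diameter (parent C))"
    and diameter_parent_attained: "p \<in> parent C \<Longrightarrow> \<exists>q\<in>parent C. dist p q = diameter (parent C)"
proof -
  obtain B m where B: "is_parent B C" "0 < m" "\<And>p. p \<in> B \<Longrightarrow> B = cball p m"
    "\<And>p. p \<in> B \<Longrightarrow> \<exists>q\<in>B. dist p q = m"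
    using parent_exists[OF C] by blast
  have P: "parent C = B"
    unfolding parent_def using B(1) parent_unique[OF positive_ball_nonempty] by (intro the_equality)
  have "diameter B = m"
  proof -
    obtain p where p: "p \<in> B" using B(1) positive_ball_nonempty by (auto simp: is_parent_def)
    obtain q where q: "q \<in> B" "dist p q = m" using B(4)[OF p] by blast
    have "dist u v \<le> m" if "u \<in> B" "v \<in> B" for u v
      using B(3)[OF that(1)] that(2) by auto
    then show ?thesis using p q by (intro diameter_eqI) auto
  qed
  with P B show "is_parent (parent C) C" "0 < diameter (parent C)"
    "p \<in> parent C \<Longrightarrow> parent C = cball p (diameter (parent C))"
    "p \<in> parent C \<Longrightarrow> \<exists>q\<in>parent C. dist p q = diameter (parent C)"
    by auto
qed

lemma subset_parent: "C \<subseteq> parent C" and parent_neq: "parent C \<noteq> C"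
  and parent_is_ball: "is_ball (parent C)"
  and parent_minimal: "\<lbrakk>is_ball A; C \<subseteq> A; A \<subseteq> parent C\<rbrakk> \<Longrightarrow> A = C \<or> A = parent C"
  using is_parent_parent by (auto simp: is_parent_def)

lemma parent_positive_ball: "parent C \<in> positive_balls"
proof -
  obtain p where "p \<in> parent C" using positive_ball_nonempty subset_parent by auto
  then show ?thesis
    using parent_eq_cball diameter_parent_pos unfolding positive_balls_def by blast
qed

lemma open_ball_ne_parent:
  assumes "p \<in> parent C"
  shows "ball p (diameter (parent C)) \<subseteq> parent C" "ball p (diameter (parent C)) \<noteq> parent C"
  using parent_eq_cball[OF assms] diameter_parent_attained[OF assms] ball_subset_cball
  by (metis, metis mem_ball order_less_irrefl)

text \<open>As a closed ball, \<open>C\<close> has radius less than the diameter of its parent, so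
  it lies in the open ball. This is itself a ball different from the parent, and nothing lies
  strictly between \<open>C\<close> and the parent.\<close>

lemma child_eq_ball:
  assumes p: "p \<in> C"
  shows "C = ball p (diameter (parent C))"
proof -
  let ?m = "diameter (parent C)"
  have pP: "p \<in> parent C" using p subset_parent by auto
  obtain r where r: "C = cball p r" using positive_ball_center[OF C(1) p] by blast
  have "r < ?m"
  proof (rule ccontr)
    assume "\<not> r < ?m"
    then have "parent C \<subseteq> C" using parent_eq_cball[OF pP] r subset_cball[of ?m r p] by simp
    then show False using subset_parent parent_neq by auto
  qed
  then have "C \<subseteq> ball p ?m" by (auto simp: r)
  then show ?thesis
    using parent_minimal[OF positive_ball_is_ball[OF ball_positive_ball[OF diameter_parent_pos]]]
      open_ball_ne_parent[OF pP] by blast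
qed

text \<open>One inclusion is \<open>child_eq_ball\<close>. Conversely nothing fits between such an
  open ball and the parent, because any ball in between is centred at \<open>p\<close> and its
  radius is either below the diameter or not.\<close>

lemma siblings_eq: "{C'\<in>positive_balls. C' \<noteq> UNIV \<and> parent C' = parent C}
    = (\<lambda>p. ball p (diameter (parent C))) ` parent C"
proof (intro set_eqI iffI)
  fix C' assume "C' \<in> {C'\<in>positive_balls. C' \<noteq> UNIV \<and> parent C' = parent C}"
  then have C': "C' \<in> positive_balls" "C' \<noteq> UNIV" "parent C' = parent C" by auto
  obtain p where "p \<in> C'" using is_ball_nonempty[OF positive_ball_is_ball[OF C'(1)]] by blast
  then show "C' \<in> (\<lambda>p. ball p (diameter (parent C))) ` parent C"
    using proper_ultrametric.child_eq_ball[OF proper_ultrametric_axioms C'(1,2)]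
      proper_ultrametric.subset_parent[OF proper_ultrametric_axioms C'(1,2)] C'(3) by auto
next
  let ?m = "diameter (parent C)"
  fix C' assume "C' \<in> (\<lambda>p. ball p ?m) ` parent C"
  then obtain p where p: "p \<in> parent C" "C' = ball p ?m" by auto
  note neq = open_ball_ne_parent[OF p(1)]
  have "is_parent (parent C) C'"
    unfolding is_parent_def
  proof (intro conjI allI impI)
    fix A assume A: "is_ball A \<and> C' \<subseteq> A \<and> A \<subseteq> parent C"
    then have "p \<in> A" using p diameter_parent_pos by auto
    then obtain t where t: "A = cball p t" using A is_ball_center by blast
    show "A = C' \<or> A = parent C"
    proof (cases "?m \<le> t")
      case True
      then have "parent C \<subseteq> A" using parent_eq_cball[OF p(1)] subset_cball[of ?m t p] t by simp
      then show ?thesis using A by auto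
    next
      case False
      then have "A \<subseteq> C'" by (auto simp: t p)
      then show ?thesis using A by auto
    qed
  qed (use parent_is_ball neq p in auto)
  moreover have C': "C' \<in> positive_balls"
    using p ball_positive_ball diameter_parent_pos by auto
  moreover have "C' \<noteq> UNIV" using neq p by auto
  ultimately show "C' \<in> {C'\<in>positive_balls. C' \<noteq> UNIV \<and> parent C' = parent C}"
    using parent_unique[OF is_ball_nonempty[OF positive_ball_is_ball[OF C']]]
      proper_ultrametric.is_parent_parent[OF proper_ultrametric_axioms] by blast
qed

end

section \<open>Finiteness and countability of families of balls\<close>

lemma finite_balls_in_compact:
  fixes B :: "'a set"
  assumes "compact B" "0 < r"
  shows "finite ((\<lambda>p. ball p r) ` B)" "finite ((\<lambda>p. cball p r) ` B)"
proof -
  have "B \<subseteq> (\<Union>p\<in>B. ball p r)" using \<open>0 < r\<close> by auto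
  \<comment> \<open>Every point of a ball is a centre, so a ball of radius \<open>r\<close> equals
    the one about any member of \<open>D\<close> that covers its centre.\<close>
  then obtain D where D: "D \<subseteq> B" "finite D" "B \<subseteq> (\<Union>p\<in>D. ball p r)"
    using compactE_image[OF assms(1), of B "\<lambda>p. ball p r"] by auto
  have "(\<lambda>p. ball p r) ` B \<subseteq> (\<lambda>p. ball p r) ` D"
  proof
    fix A assume "A \<in> (\<lambda>p. ball p r) ` B"
    then obtain p where p: "p \<in> B" "A = ball p r" by blast
    then obtain d where "d \<in> D" "p \<in> ball d r" using D by blast
    then show "A \<in> (\<lambda>p. ball p r) ` D"
      using ball_eq[of p d r] p by blast
  qed
  moreover have "(\<lambda>p. cball p r) ` B \<subseteq> (\<lambda>p. cball p r) ` D"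
  proof
    fix A assume "A \<in> (\<lambda>p. cball p r) ` B"
    then obtain p where p: "p \<in> B" "A = cball p r" by blast
    then obtain d where "d \<in> D" "p \<in> ball d r" using D by blast
    then show "A \<in> (\<lambda>p. cball p r) ` D"
      using cball_eq[of p d r] p by auto
  qed
  ultimately show "finite ((\<lambda>p. ball p r) ` B)" "finite ((\<lambda>p. cball p r) ` B)"
    using \<open>finite D\<close> finite_subset finite_imageI by metis+
qed

lemma finite_siblings:
  assumes "C \<in> positive_balls" "C \<noteq> (UNIV :: 'a set)"
  shows "finite {C'\<in>positive_balls. C' \<noteq> UNIV \<and> parent C' = parent C}"
  unfolding siblings_eq[OF assms]
  using assms by (intro finite_balls_in_compact is_ball_compact parent_is_ball diameter_parent_pos)

text \<open>A ball that contains \<open>C\<close> is the union of balls of the radius of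
  \<open>C\<close>, and those with centre in the compact \<open>B\<close> are finite in number. This
  is why chains of parents reach every larger ball.\<close>

lemma finite_balls_between:
  fixes B :: "'a set"
  assumes C: "C \<in> positive_balls" and B: "compact B"
  shows "finite {A. is_ball A \<and> C \<subseteq> A \<and> A \<subseteq> B}"
proof -
  obtain x r where r: "0 < r" and Cr: "C = cball x r"
    using C by (auto simp: positive_balls_def)
  let ?f = "\<lambda>A. (\<lambda>p. cball p r) ` A"
  have *: "\<Union> (?f A) = A" if "is_ball A" "C \<subseteq> A" for A
  proof -
    have "x \<in> A" using that r Cr by auto
    then obtain t where t: "A = cball x t" using is_ball_center[OF \<open>is_ball A\<close>] by blast
    have "cball p r \<subseteq> A" if "p \<in> A" for p
    proof (cases "r \<le> t")
      case True
      then show ?thesis using cball_eq[of p x t] that t subset_cball[of r t p] by simp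
    next
      case False
      then have "p \<in> cball x r" using that t by auto
      then show ?thesis using cball_eq[of p x r] \<open>C \<subseteq> A\<close> Cr by simp
    qed
    then show ?thesis using r by force
  qed
  have "inj_on ?f {A. is_ball A \<and> C \<subseteq> A \<and> A \<subseteq> B}"
    by (rule inj_on_inverseI[where g = Union]) (use * in auto)
  moreover have "?f ` {A. is_ball A \<and> C \<subseteq> A \<and> A \<subseteq> B} \<subseteq> Pow (?f B)"
    by auto
  ultimately show ?thesis
    using finite_balls_in_compact(2)[OF B r] by (meson finite_Pow_iff inj_on_finite)
qed

text \<open>Every ball has a centre in the countable dense set and is enclosed between two balls
  from a countable list about that centre; between these two there are only finitely many
  balls.\<close>

lemma countable_positive_balls:
  assumes "separable_space (euclidean :: 'a topology)"
  shows "countable (positive_balls :: 'a set set)"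
proof -
  obtain S :: "'a set" where S: "countable S" "closure S = UNIV"
    using assms unfolding separable_space_def by auto
  define F where "F q n = {A. is_ball A \<and> cball q (1 / Suc n) \<subseteq> A \<and> A \<subseteq> cball q (real n)}" for q :: 'a and n
  have "countable (F q n)" for q n
  proof -
    have "cball q (1 / Suc n) \<in> positive_balls"
      by (intro cball_positive_ball) simp
    then show ?thesis
      unfolding F_def by (intro countable_finite finite_balls_between compact_cball)
  qed
  then have "countable (\<Union>q\<in>S. \<Union>n. F q n)"
    using S by auto
  moreover have "positive_balls \<subseteq> (\<Union>q\<in>S. \<Union>n. F q n)"
  proof
    fix A :: "'a set" assume A: "A \<in> positive_balls"
    then obtain x r where r: "0 < r" and Ar: "A = cball x r"
      by (auto simp: positive_balls_def)
    have "x \<in> closure S" using S by auto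
    then obtain q where q: "q \<in> S" "dist q x < r" using r unfolding closure_approachable by blast
    have Aq: "A = cball q r" using cball_eq[of q x r] q Ar by (auto simp: dist_commute)
    obtain n where n: "r < real n" using reals_Archimedean2 by blast
    obtain k where k: "1 / Suc k < r" using r nat_approx_posE by blast
    have "1 / Suc (max n k) \<le> 1 / Suc k" by (intro divide_left_mono) auto
    then have "A \<in> F q (max n k)"
      using positive_ball_is_ball[OF A] n k unfolding F_def Aq by (auto intro!: subset_cball)
    then show "A \<in> (\<Union>q\<in>S. \<Union>n. F q n)" using q by blast
  qed
  ultimately show ?thesis by (rule countable_subset[rotated])
qed

end


section \<open>The functions \<open>f\<^sub>C\<close>\<close>

lemma enn2real_inject: "\<lbrakk>enn2real a = enn2real b; a \<noteq> \<infinity>; b \<noteq> \<infinity>\<rbrakk> \<Longrightarrow> a = b"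
  by (cases a; cases b) auto

locale ultrametric_measure_space = proper_ultrametric space_type
  for space_type :: "'a::metric_space itself" +
  fixes M :: "'a measure"
  assumes separable: "separable_space (euclidean :: 'a topology)"
    and radon: "radon_measure M"
    and full_support: "full_support M"
    and infinite: "\<not> compact (UNIV :: 'a set) \<Longrightarrow> emeasure M UNIV = \<infinity>"
begin

lemma sets_M [measurable_cong]: "sets M = sets borel"
  using radon by (simp add: radon_measure_def)

lemma space_M [simp]: "space M = UNIV"
  using sets_eq_imp_space_eq[OF sets_M] by simp

lemma countable_balls: "countable (positive_balls :: 'a set set)"
  using separable by (rule countable_positive_balls)

lemma positive_ball_sets [measurable]: "C \<in> positive_balls \<Longrightarrow> C \<in> sets M"
  using positive_ball_open by (simp add: sets_M borel_open)

lemma positive_ball_finite: "C \<in> positive_balls \<Longrightarrow> emeasure M C < \<infinity>"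
  using radon is_ball_compact[OF positive_ball_is_ball] by (simp add: radon_measure_def)

lemma positive_ball_emeasure: "C \<in> positive_balls \<Longrightarrow> emeasure M C = ennreal (measure M C)"
  using positive_ball_finite by (intro emeasure_eq_ennreal_measure) (auto simp: less_top)

lemma positive_ball_measure_pos: "C \<in> positive_balls \<Longrightarrow> 0 < measure M C"
proof -
  assume C: "C \<in> positive_balls"
  then have "0 < emeasure M C"
    using full_support positive_ball_open is_ball_nonempty[OF positive_ball_is_ball[OF C]]
    by (simp add: full_support_def)
  then show ?thesis using positive_ball_emeasure[OF C] by (simp add: ennreal_less_zero_iff)
qed

lemma UNIV_positive_ball:
  assumes "compact (UNIV :: 'a set)"
  shows "(UNIV :: 'a set) \<in> positive_balls"
proof -
  obtain x :: 'a where True by blast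
  obtain r where "0 < r" "\<And>y. dist x y \<le> r"
    using compact_imp_bounded[OF assms] unfolding bounded_any_center[of _ x] bounded_def
    by (metis UNIV_I less_le_not_le linorder_le_less_linear order_trans zero_less_one)
  then have "(UNIV :: 'a set) = cball x r" by auto
  then show ?thesis using cball_positive_ball[OF \<open>0 < r\<close>, of x] by simp
qed

lemma positive_balls_generate: "(borel :: 'a measure) = sigma UNIV positive_balls"
proof (rule borel_eq_countable_basis[OF countable_balls], rule topological_basisI)
  fix U :: "'a set" and x assume "open U" "x \<in> U"
  then obtain r where "0 < r" "cball x r \<subseteq> U" using open_contains_cball by blast
  then show "\<exists>B\<in>positive_balls. x \<in> B \<and> B \<subseteq> U"
    using cball_positive_ball by (intro bexI[of _ "cball x r"]) auto
qed (rule positive_ball_open)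

lemma sigma_finite_M: "sigma_finite_measure M"
proof
  obtain x :: 'a where True by blast
  have "(\<Union>n. cball x (real (Suc n))) = UNIV"
  proof (intro equalityI subsetI UNIV_I)
    fix y
    obtain n where "dist x y < real n" using reals_Archimedean2 by blast
    then show "y \<in> (\<Union>n. cball x (real (Suc n)))" by (intro UN_I[of n]) auto
  qed
  moreover have "cball x (real (Suc n)) \<in> positive_balls" for n
    by (intro cball_positive_ball) simp
  ultimately show "\<exists>A. countable A \<and> A \<subseteq> sets M \<and> \<Union> A = space M \<and> (\<forall>a\<in>A. emeasure M a \<noteq> \<infinity>)"
    using positive_ball_sets positive_ball_finite
    by (intro exI[of _ "range (\<lambda>n. cball x (real (Suc n)))"]) (auto simp: less_top)
qed

lemma indicator_L2: "C \<in> positive_balls \<Longrightarrow> indicator C \<in> L2 M"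
proof -
  assume C[measurable]: "C \<in> positive_balls"
  have "(\<lambda>x. (indicator C x)\<^sup>2) = (indicator C :: 'a \<Rightarrow> real)"
    by (auto simp: indicator_def)
  moreover have "integrable M (indicator C :: 'a \<Rightarrow> real)"
    using positive_ball_finite[OF C] positive_ball_sets[OF C] by (simp add: less_top)
  ultimately show ?thesis
    using positive_ball_sets[OF C] by (simp add: L2_def)
qed

lemma inner_indicator:
  assumes "C \<in> positive_balls" "A \<in> positive_balls"
  shows "l2_inner M (indicator C) (indicator A) = measure M (C \<inter> A)"
  using positive_ball_sets assms
  by (simp add: l2_inner_def indicator_inter_arith[symmetric] sets.Int)

lemma ball_fun_eq:
  "C \<noteq> UNIV \<Longrightarrow> ball_fun M C =
    (\<lambda>x. 1 / measure M C * indicator C x - 1 / measure M (parent C) * indicator (parent C) x)"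
  by (simp add: ball_fun_def)

lemma ball_fun_UNIV: "ball_fun M UNIV = indicator UNIV"
  by (auto simp: ball_fun_def)

lemma ball_fun_L2: "C \<in> positive_balls \<Longrightarrow> ball_fun M C \<in> L2 M"
proof (cases "C = UNIV")
  case True
  assume "C \<in> positive_balls"
  with True show ?thesis using indicator_L2[of UNIV] by (simp only: ball_fun_UNIV)
next
  case False
  assume "C \<in> positive_balls"
  with False show ?thesis
    unfolding ball_fun_eq[OF False] by (intro L2_diff L2_cmult indicator_L2 parent_positive_ball)
qed

lemma inner_ball_fun_right:
  assumes "g \<in> L2 M" "C \<in> positive_balls" "C \<noteq> UNIV"
  shows "l2_inner M g (ball_fun M C) = l2_inner M g (indicator C) / measure M C
    - l2_inner M g (indicator (parent C)) / measure M (parent C)"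
  unfolding ball_fun_eq[OF assms(3)]
    l2_inner_diff_right[OF L2_cmult[OF indicator_L2[OF assms(2)]]
      L2_cmult[OF indicator_L2[OF parent_positive_ball[OF assms(2,3)]]] assms(1)]
    l2_inner_cmult_right
  by simp

lemma inner_ball_fun_indicator:
  assumes C: "C \<in> positive_balls" "C \<noteq> UNIV" and A: "A \<in> positive_balls"
  shows "l2_inner M (ball_fun M C) (indicator A)
    = measure M (C \<inter> A) / measure M C - measure M (parent C \<inter> A) / measure M (parent C)"
  using inner_ball_fun_right[OF indicator_L2[OF A] C] C A parent_positive_ball[OF C]
  by (simp add: l2_inner_commute[of M "ball_fun M C"] inner_indicator Int_commute)

lemma inner_ball_fun_superset:
  assumes C: "C \<in> positive_balls" "C \<noteq> UNIV" and A: "A \<in> positive_balls" "parent C \<subseteq> A"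
  shows "l2_inner M (ball_fun M C) (indicator A) = 0"
proof -
  have "C \<inter> A = C" "parent C \<inter> A = parent C"
    using A subset_parent[OF C] by auto
  then show ?thesis
    using inner_ball_fun_indicator[OF C A(1)] positive_ball_measure_pos[OF C(1)]
      positive_ball_measure_pos[OF parent_positive_ball[OF C]] by simp
qed

text \<open>If \<open>A\<close> meets the parent without containing it, it lies inside the parent.
  If it meets \<open>C\<close> too, it lies inside \<open>C\<close>, as no ball fits strictly
  between. So neither indicator changes on \<open>A\<close>.\<close>

lemma ball_fun_const:
  assumes C: "C \<in> positive_balls" and A: "is_ball A" "C = UNIV \<or> \<not> parent C \<subseteq> A"
    and xy: "x \<in> A" "y \<in> A"
  shows "ball_fun M C x = ball_fun M C y"
proof (cases "C = UNIV")
  case True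
  then show ?thesis by (simp add: ball_fun_UNIV)
next
  case False
  note C = C False
  have *: "(v \<in> parent C) \<and> (u \<in> C \<longrightarrow> v \<in> C)" if "u \<in> A" "v \<in> A" "u \<in> parent C" for u v
  proof -
    have AP: "A \<subseteq> parent C"
      using is_ball_nested[OF A(1) parent_is_ball[OF C] that(1,3)] A False by auto
    have "v \<in> C" if u: "u \<in> C"
    proof -
      have "A \<subseteq> C \<or> C \<subseteq> A"
        using is_ball_nested[OF A(1) positive_ball_is_ball[OF C(1)] \<open>u \<in> A\<close> u] .
      moreover have "A = C" if "C \<subseteq> A"
        using parent_minimal[OF C A(1) that AP] A False by auto
      ultimately show ?thesis using \<open>v \<in> A\<close> by auto
    qed
    then show ?thesis using AP that by auto
  qed
  have "x \<in> parent C \<longleftrightarrow> y \<in> parent C" "x \<in> C \<longleftrightarrow> y \<in> C"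
    using *[of x y] *[of y x] xy subset_parent[OF C] by auto
  then show ?thesis by (simp add: ball_fun_eq[OF False] indicator_def)
qed

lemma ball_fun_outside:
  assumes "C \<in> positive_balls" "C \<noteq> UNIV" "x \<notin> parent C"
  shows "ball_fun M C x = 0"
proof -
  have "x \<notin> C" using assms subset_parent[OF assms(1,2)] by blast
  then show ?thesis using assms by (simp add: ball_fun_eq)
qed

text \<open>\<open>ball_fun M C\<close> lives on its parent with mean zero, and
  \<open>ball_fun M C'\<close> is constant there. The asymmetric condition covers disjoint parents
  as well as a strictly larger \<open>parent C'\<close>.\<close>

lemma ball_fun_orthogonal:
  assumes C: "C \<in> positive_balls" "C \<noteq> UNIV"
    and C': "C' \<in> positive_balls" "C' = UNIV \<or> \<not> parent C' \<subseteq> parent C"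
  shows "l2_inner M (ball_fun M C) (ball_fun M C') = 0"
proof -
  obtain p where p: "p \<in> parent C" using is_ball_nonempty[OF parent_is_ball[OF C]] by auto
  have "ball_fun M C x * ball_fun M C' x = ball_fun M C' p * (ball_fun M C x * indicator (parent C) x)" for x
    using ball_fun_outside[OF C, of x] ball_fun_const[OF C'(1) parent_is_ball[OF C] C'(2) _ p, of x]
    by (cases "x \<in> parent C") auto
  then have "l2_inner M (ball_fun M C) (ball_fun M C')
      = ball_fun M C' p * l2_inner M (ball_fun M C) (indicator (parent C))"
    by (simp only: l2_inner_def integral_mult_right_zero)
  then show ?thesis
    using inner_ball_fun_superset[OF C parent_positive_ball[OF C]] by simp
qed

section \<open>Balls with a common parent\<close>

definition siblings :: "'a set \<Rightarrow> 'a set set" where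
  "siblings C = {C'\<in>positive_balls. C' \<noteq> UNIV \<and> parent C' = parent C}"

lemma siblings_finite:
  "C \<in> positive_balls \<Longrightarrow> C \<noteq> UNIV \<Longrightarrow> finite (siblings C)"
  unfolding siblings_def by (rule finite_siblings)

lemma siblings_disjoint:
  assumes C: "C \<in> positive_balls" "C \<noteq> UNIV" and "C1 \<in> siblings C" "C2 \<in> siblings C" "x \<in> C1" "x \<in> C2"
  shows "C1 = C2"
  using assms child_eq_ball[of C1 x] child_eq_ball[of C2 x] by (simp add: siblings_def)

lemma siblings_disjoint_family:
  assumes C: "C \<in> positive_balls" "C \<noteq> UNIV"
  shows "disjoint_family_on (\<lambda>C'. C') (siblings C)"
  unfolding disjoint_family_on_def using siblings_disjoint[OF C] by blast

lemma Union_siblings: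
  assumes C: "C \<in> positive_balls" "C \<noteq> UNIV"
  shows "\<Union> (siblings C) = parent C"
proof
  show "\<Union> (siblings C) \<subseteq> parent C"
  proof (rule Union_least)
    fix C' assume "C' \<in> siblings C"
    then show "C' \<subseteq> parent C"
      using subset_parent[of C'] by (simp add: siblings_def)
  qed
  show "parent C \<subseteq> \<Union> (siblings C)"
    unfolding siblings_def siblings_eq[OF C] using diameter_parent_pos[OF C] by auto
qed

lemma sum_siblings_indicator:
  assumes C: "C \<in> positive_balls" "C \<noteq> UNIV"
  shows "(\<Sum>C'\<in>siblings C. indicator C' x) = (indicator (parent C) x :: real)"
proof -
  have "indicator (\<Union> (siblings C)) x = (\<Sum>C'\<in>siblings C. indicator C' x :: real)"
    using indicator_UN_disjoint[OF siblings_finite[OF C] siblings_disjoint_family[OF C], of x]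
    by simp
  then show ?thesis by (simp add: Union_siblings[OF C])
qed

lemma sum_siblings_measure:
  assumes C: "C \<in> positive_balls" "C \<noteq> UNIV"
  shows "(\<Sum>C'\<in>siblings C. measure M C') = measure M (parent C)"
proof -
  have "measure M (\<Union>C'\<in>siblings C. C') = (\<Sum>C'\<in>siblings C. measure M C')"
  proof (rule measure_finite_Union[OF siblings_finite[OF C] _ siblings_disjoint_family[OF C]])
    have K: "C' \<in> positive_balls" if "C' \<in> siblings C" for C'
      using that by (simp add: siblings_def)
    then show "(\<lambda>C'. C') ` siblings C \<subseteq> sets M"
      using positive_ball_sets by blast
    show "emeasure M C' \<noteq> \<infinity>" if "C' \<in> siblings C" for C'
      using positive_ball_finite[OF K[OF that]] by simp
  qed
  then show ?thesis by (simp add: Union_siblings[OF C])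
qed

text \<open>The Gram matrix weighted by \<mu>(C') is the identity minus a rank-one matrix with
  entries \<mu>(C')/\<mu>(B). The latter contributes a multiple of the sum of \<mu>(C')
  \<open>ball_fun M C'\<close>, which vanishes because the siblings partition the parent.\<close>

lemma ball_fun_reproducing:
  assumes C: "C \<in> positive_balls" "C \<noteq> UNIV"
  shows "(\<Sum>C'\<in>siblings C. measure M C' * l2_inner M (ball_fun M C) (ball_fun M C') * ball_fun M C' x)
    = ball_fun M C x"
proof -
  let ?B = "parent C"
  have pos: "0 < measure M ?B" using C parent_positive_ball positive_ball_measure_pos by blast
  have sib: "C' \<in> positive_balls" "C' \<noteq> UNIV" "parent C' = ?B" "0 < measure M C'" if "C' \<in> siblings C" for C'
    using that positive_ball_measure_pos by (auto simp: siblings_def)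
  have eq: "measure M C' * ball_fun M C' x = indicator C' x - measure M C' / measure M ?B * indicator ?B x"
    if "C' \<in> siblings C" for C'
    using sib[OF that] by (simp add: ball_fun_eq right_diff_distrib)
  have inner: "measure M C' * l2_inner M (ball_fun M C) (ball_fun M C')
      = (if C' = C then 1 else 0) - measure M C' / measure M ?B" if "C' \<in> siblings C" for C'
  proof -
    have "l2_inner M (ball_fun M C) (ball_fun M C') = l2_inner M (ball_fun M C) (indicator C') / measure M C'"
      using inner_ball_fun_right[OF ball_fun_L2[OF C(1)] sib(1,2)[OF that]] sib(3)[OF that]
        inner_ball_fun_superset[OF C parent_positive_ball[OF C]] by simp
    then have "measure M C' * l2_inner M (ball_fun M C) (ball_fun M C')
        = measure M (C \<inter> C') / measure M C - measure M (?B \<inter> C') / measure M ?B"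
      using sib(4)[OF that] inner_ball_fun_indicator[OF C sib(1)[OF that]] by simp
    moreover have "?B \<inter> C' = C'"
      using subset_parent[OF sib(1,2)[OF that]] sib(3)[OF that] by auto
    moreover have "C \<inter> C' = {}" if "C' \<noteq> C"
      using siblings_disjoint[OF C, of C C'] C \<open>C' \<in> siblings C\<close> that by (auto simp: siblings_def)
    ultimately show ?thesis
      using positive_ball_measure_pos[OF C(1)] by auto
  qed
  have C_sib: "C \<in> siblings C" using C by (simp add: siblings_def)
  note fin = siblings_finite[OF C]
  have "(\<Sum>C'\<in>siblings C. measure M C' * l2_inner M (ball_fun M C) (ball_fun M C') * ball_fun M C' x)
      = (\<Sum>C'\<in>siblings C. (if C' = C then ball_fun M C' x else 0)
          - measure M C' * ball_fun M C' x / measure M ?B)"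
    by (intro sum.cong refl) (simp add: inner left_diff_distrib)
  also have "\<dots> = ball_fun M C x - (\<Sum>C'\<in>siblings C. measure M C' * ball_fun M C' x) / measure M ?B"
    using fin C_sib by (simp add: sum_subtractf sum_divide_distrib)
  also have "(\<Sum>C'\<in>siblings C. measure M C' * ball_fun M C' x)
      = (\<Sum>C'\<in>siblings C. indicator C' x) - (\<Sum>C'\<in>siblings C. measure M C') / measure M ?B * indicator ?B x"
    by (simp add: eq sum_subtractf sum_divide_distrib sum_distrib_right)
  also have "\<dots> = 0"
    using pos by (simp add: sum_siblings_indicator[OF C] sum_siblings_measure[OF C])
  finally show ?thesis by simp
qed

text \<open>The ball average of \<open>g\<close> does not change along the chain of parents of \<open>C\<close>; in the non-compact case it
  tends to \<open>0\<close> along the chain because \<open>\<mu>\<close> is infinite.\<close>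

lemma inner_indicator_eq_0:
  assumes g: "g \<in> L2 M" and orth: "\<And>C. C \<in> positive_balls \<Longrightarrow> l2_inner M g (ball_fun M C) = 0"
    and C: "C \<in> positive_balls"
  shows "l2_inner M g (indicator C) = 0"
proof -
  define a where "a A = l2_inner M g (indicator A) / measure M A" for A
  have parent: "a (parent A) = a A" if "A \<in> positive_balls" "A \<noteq> UNIV" for A
    using inner_ball_fun_right[OF g that] orth[OF that(1)] by (simp add: a_def)
  have chain: "a B = a C" if B: "B \<in> positive_balls" "C \<subseteq> B" for B
  proof -
    \<comment> \<open>In place of an induction along the chain of parents, a maximal member of this
      finite family is taken: if it were not \<open>B\<close>, its parent would be a larger
      member.\<close>
    let ?F = "{A \<in> positive_balls. C \<subseteq> A \<and> A \<subseteq> B \<and> a A = a C}"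
    have "finite ?F"
      by (rule finite_subset[OF _ finite_balls_between[OF C is_ball_compact[OF positive_ball_is_ball[OF B(1)]]]])
        (auto intro: positive_ball_is_ball)
    moreover have "C \<in> ?F" using C B by auto
    ultimately have "\<exists>A\<in>?F. \<forall>A'\<in>?F. A \<subseteq> A' \<longrightarrow> A = A'"
      by (intro finite_has_maximal) blast+
    then obtain A where A: "A \<in> ?F" and maximal: "\<forall>A'\<in>?F. A \<subseteq> A' \<longrightarrow> A = A'"
      by (rule bexE)
    have "A = B"
    proof (rule ccontr)
      assume "A \<noteq> B"
      then have neq: "A \<noteq> UNIV" using A by auto
      have Ap: "A \<in> positive_balls" using A by auto
      obtain p where p: "p \<in> A" using is_ball_nonempty[OF positive_ball_is_ball[OF Ap]] by auto
      have "parent A \<subseteq> B"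
        using is_ball_nested[OF parent_is_ball[OF Ap neq] positive_ball_is_ball[OF B(1)], of p]
          subset_parent[OF Ap neq] p A(1)
          parent_minimal[OF Ap neq positive_ball_is_ball[OF B(1)]] \<open>A \<noteq> B\<close> by blast
      then have "parent A \<in> ?F"
        using A(1) parent[OF Ap neq] subset_parent[OF Ap neq] parent_positive_ball[OF Ap neq] by auto
      then show False
        using bspec[OF maximal] subset_parent[OF Ap neq] parent_neq[OF Ap neq] by metis
    qed
    then show ?thesis using A(1) by auto
  qed
  have "a C = 0"
  proof (cases "compact (UNIV :: 'a set)")
    case True
    then show ?thesis
      using chain[OF UNIV_positive_ball[OF True]] orth[OF UNIV_positive_ball[OF True]]
      by (simp add: a_def ball_fun_UNIV)
  next
    case False
    show ?thesis
    proof (rule ccontr)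
      assume nz: "a C \<noteq> 0"
      \<comment> \<open>If the average over a ball is \<open>a C\<close>, Cauchy-Schwarz bounds the
        measure of that ball by this number. It does not depend on the ball, so the measures could
        not tend to infinity.\<close>
      define b where "b = l2_inner M g g / (a C)\<^sup>2"
      obtain x r where r: "0 < r" and Cr: "C = cball x r"
        using C by (auto simp: positive_balls_def)
      let ?A = "\<lambda>n. cball x (r + real n)"
      have A: "?A n \<in> positive_balls" "C \<subseteq> ?A n" for n
        using r by (auto simp: Cr intro!: cball_positive_ball)
      have "measure M (?A n) \<le> b" for n
      proof -
        have pos: "0 < measure M (?A n)" using A positive_ball_measure_pos by blast
        have "(a C * measure M (?A n))\<^sup>2 = (l2_inner M g (indicator (?A n)))\<^sup>2"
          using chain[OF A(1,2), of n, symmetric] pos by (simp add: a_def[of "?A n"])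
        also have "\<dots> \<le> l2_inner M g g * measure M (?A n)"
          using l2_Cauchy_Schwarz[OF g indicator_L2[OF A(1)]] inner_indicator[OF A(1) A(1)] by simp
        finally have "(a C)\<^sup>2 * measure M (?A n) \<le> l2_inner M g g"
          using pos by (simp add: power2_eq_square)
        then show ?thesis using nz by (simp add: b_def field_simps)
      qed
      then have *: "emeasure M (?A n) \<le> ennreal b" for n
        using positive_ball_emeasure[OF A(1)] by (simp add: ennreal_leI)
      have "(\<Union>n. ?A n) = UNIV"
      proof (intro equalityI subsetI UNIV_I)
        fix y
        obtain n where "dist x y < real n" using reals_Archimedean2 by blast
        then show "y \<in> (\<Union>n. ?A n)" using r by (intro UN_I[of n]) auto
      qed
      then have "emeasure M UNIV = (SUP n. emeasure M (?A n))"
        using A positive_ball_sets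
        by (subst SUP_emeasure_incseq) (auto simp: incseq_def intro!: subset_cball)
      also have "\<dots> \<le> ennreal b" using * by (intro SUP_least) auto
      finally show False using infinite[OF False] by (simp add: top_unique)
    qed
  qed
  then show ?thesis
    using positive_ball_measure_pos[OF C] by (simp add: a_def)
qed

text \<open>The measures with the positive and the negative part of \<open>g\<close> as densities
  agree on balls. Together with the empty set these form an intersection-stable generator, so the
  two measures and then the two parts coincide.\<close>

lemma ball_fun_total:
  assumes g: "g \<in> L2 M" and orth: "\<And>C. C \<in> positive_balls \<Longrightarrow> l2_inner M g (ball_fun M C) = 0"
  shows "AE x in M. g x = 0"
proof -
  interpret sigma_finite_measure M by (rule sigma_finite_M)
  have [measurable]: "g \<in> borel_measurable M" using g by (rule L2_measurable)
  \<comment> \<open>\<open>ennreal\<close> truncates negative numbers, so \<open>?N g\<close> and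
    \<open>?N (\<lambda>x. - g x)\<close> carry the positive and the negative part of
    \<open>g\<close>.\<close>
  let ?N = "\<lambda>g. density M (\<lambda>x. ennreal (g x))"
  let ?E = "insert {} positive_balls :: 'a set set"
  have eq: "emeasure (?N g) C = emeasure (?N (\<lambda>x. - g x)) C" "emeasure (?N g) C \<noteq> \<infinity>"
    if C: "C \<in> positive_balls" for C
  proof -
    have [measurable]: "C \<in> sets M" using C by (rule positive_ball_sets)
    have int: "integrable M (\<lambda>x. g x * indicator C x)"
      using g indicator_L2[OF C] by (rule L2_mult_integrable)
    have "(\<integral>x. g x * indicator C x \<partial>M) = 0"
      using inner_indicator_eq_0[OF g orth C] by (simp add: l2_inner_def)
    then have "enn2real (\<integral>\<^sup>+x. ennreal (g x * indicator C x) \<partial>M)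
        = enn2real (\<integral>\<^sup>+x. ennreal (- (g x * indicator C x)) \<partial>M)"
      using real_lebesgue_integral_def[OF int] by simp
    moreover have fin: "(\<integral>\<^sup>+x. ennreal (g x * indicator C x) \<partial>M) \<noteq> \<infinity>"
      and "(\<integral>\<^sup>+x. ennreal (- (g x * indicator C x)) \<partial>M) \<noteq> \<infinity>"
      using int unfolding real_integrable_def by auto
    ultimately have *: "(\<integral>\<^sup>+x. ennreal (g x * indicator C x) \<partial>M)
        = (\<integral>\<^sup>+x. ennreal (- (g x * indicator C x)) \<partial>M)"
      by (rule enn2real_inject)
    have "emeasure (?N g) C = (\<integral>\<^sup>+x. ennreal (g x * indicator C x) \<partial>M)"
      "emeasure (?N (\<lambda>x. - g x)) C = (\<integral>\<^sup>+x. ennreal (- (g x * indicator C x)) \<partial>M)"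
      by (auto simp: emeasure_density indicator_def intro!: nn_integral_cong)
    with * fin show "emeasure (?N g) C = emeasure (?N (\<lambda>x. - g x)) C" "emeasure (?N g) C \<noteq> \<infinity>"
      by auto
  qed
  obtain x :: 'a where True by blast
  have "?N g = ?N (\<lambda>x. - g x)"
  proof (rule measure_eqI_generator_eq[where E="?E" and A="\<lambda>n. cball x (real (Suc n))"])
    show "Int_stable ?E"
    proof (rule Int_stableI)
      fix A B assume AB: "A \<in> ?E" "B \<in> ?E"
      show "A \<inter> B \<in> ?E"
      proof (cases "A \<inter> B = {}")
        case False
        then obtain p where p: "p \<in> A" "p \<in> B" by auto
        then have "A \<subseteq> B \<or> B \<subseteq> A"
          using AB is_ball_nested[of A B p] positive_ball_is_ball by auto
        then have "A \<inter> B = A \<or> A \<inter> B = B" by auto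
        then show ?thesis using AB by auto
      qed simp
    qed
    have "sets M = sigma_sets UNIV positive_balls"
      unfolding sets_M by (subst positive_balls_generate) simp
    also have "\<dots> = sigma_sets UNIV ?E"
      by (intro sigma_sets_eqI) (auto intro: sigma_sets.Basic sigma_sets.Empty)
    finally show "sets (?N g) = sigma_sets UNIV ?E" "sets (?N (\<lambda>x. - g x)) = sigma_sets UNIV ?E"
      by auto
    show "emeasure (?N g) A = emeasure (?N (\<lambda>x. - g x)) A" if "A \<in> ?E" for A
      using that eq by auto
    have A: "cball x (real (Suc n)) \<in> positive_balls" for n
      by (intro cball_positive_ball) simp
    then show "range (\<lambda>n. cball x (real (Suc n))) \<subseteq> ?E" by auto
    show "emeasure (?N g) (cball x (real (Suc n))) \<noteq> \<infinity>" for n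
      using eq(2)[OF A] .
    show "(\<Union>n. cball x (real (Suc n))) = UNIV"
    proof (intro equalityI subsetI UNIV_I)
      fix y
      obtain n where "dist x y < real n" using reals_Archimedean2 by blast
      then show "y \<in> (\<Union>n. cball x (real (Suc n)))" by (intro UN_I[of n]) auto
    qed
  qed simp
  then have "AE x in M. ennreal (g x) = ennreal (- g x)"
    by (intro density_unique) auto
  then show ?thesis
  proof eventually_elim
    case (elim x)
    then show ?case
      by (cases "0 \<le> g x") (auto simp: ennreal_neg ennreal_eq_0_iff dest: sym)
  qed
qed

end


section \<open>The measure \<open>d\<sigma>\<close>\<close>

locale distance_distribution_function =
  fixes \<sigma> :: "ennreal \<Rightarrow> real"
  assumes dd: "distance_distribution \<sigma>"
begin

lemma \<sigma>_nonneg: "0 \<le> \<sigma> r" and \<sigma>_le_1: "\<sigma> r \<le> 1"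
proof -
  have "\<sigma> r \<in> {0..1}" using dd unfolding distance_distribution_def by blast
  then show "0 \<le> \<sigma> r" "\<sigma> r \<le> 1" by auto
qed

lemma \<sigma>_less: "r < s \<Longrightarrow> \<sigma> r < \<sigma> s"
  using dd by (auto simp: distance_distribution_def strict_mono_def)

lemma \<sigma>_mono: "r \<le> s \<Longrightarrow> \<sigma> r \<le> \<sigma> s"
  using \<sigma>_less by (cases "r = s") (auto simp: le_less)

lemma \<sigma>_at_right_0:
  assumes "0 < e"
  shows "\<exists>s>0. \<sigma> (ennreal s) < e"
proof -
  have "\<forall>\<^sub>F r in at_right 0. \<sigma> r < e"
    using dd assms unfolding distance_distribution_def by (intro order_tendstoD(2)[where y = 0]) auto
  then obtain b :: ennreal where b: "0 < b" "\<And>y. 0 < y \<Longrightarrow> y < b \<Longrightarrow> \<sigma> y < e"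
    using eventually_at_right[of 0 "1::ennreal"] by auto
  obtain y where y: "0 < y" "y < b" using dense[OF b(1)] by auto
  then obtain s where "y = ennreal s" "0 \<le> s" by (cases y) auto
  with y b(2)[OF y] show ?thesis by (intro exI[of _ s]) auto
qed

lemma \<sigma>_at_left:
  assumes "0 < d" "c < \<sigma> d"
  shows "\<exists>b\<ge>0. ennreal b < d \<and> c < \<sigma> (ennreal b)"
proof -
  have "\<forall>\<^sub>F r in at_left d. c < \<sigma> r"
    using dd assms unfolding distance_distribution_def by (intro order_tendstoD(1)[where y = "\<sigma> d"]) auto
  then obtain b where b: "b < d" "\<And>y. b < y \<Longrightarrow> y < d \<Longrightarrow> c < \<sigma> y"
    using eventually_at_left[OF assms(1)] by auto
  obtain y where y: "b < y" "y < d" using dense[OF b(1)] by auto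
  then have "y < \<top>" using less_le_trans[OF y(2) top_greatest] by simp
  then obtain s where "y = ennreal s" "0 \<le> s" by (cases y) auto
  with y b(2)[OF y] show ?thesis by auto
qed

lemma \<sigma>_0: "\<sigma> 0 = 0"
proof (rule ccontr)
  assume "\<sigma> 0 \<noteq> 0"
  then obtain s where "0 < s" "\<sigma> (ennreal s) < \<sigma> 0"
    using \<sigma>_at_right_0[of "\<sigma> 0"] \<sigma>_nonneg[of 0] by auto
  then show False using \<sigma>_mono[of 0 "ennreal s"] by simp
qed

lemma \<sigma>_pos: "0 < r \<Longrightarrow> 0 < \<sigma> (ennreal r)"
  using \<sigma>_less[of 0 "ennreal r"] \<sigma>_0 by simp

lemma \<sigma>_less_1: "\<sigma> (ennreal r) < 1"
  using \<sigma>_less[of "ennreal r" \<infinity>] dd by (simp add: distance_distribution_def)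

definition right_modification :: "real \<Rightarrow> real" where
  "right_modification r = (INF s\<in>{r<..}. \<sigma> (ennreal s))"

lemma stieltjes_eq: "stieltjes \<sigma> = interval_measure right_modification"
  by (simp add: stieltjes_def right_modification_def[abs_def])

lemma bdd_below_\<sigma>: "bdd_below ((\<lambda>s. \<sigma> (ennreal s)) ` S)"
  using \<sigma>_nonneg by (intro bdd_belowI[of _ 0]) auto

lemma right_modification_le: "r < s \<Longrightarrow> right_modification r \<le> \<sigma> (ennreal s)"
  unfolding right_modification_def by (intro cINF_lower bdd_below_\<sigma>) auto

lemma le_right_modification: "\<sigma> (ennreal r) \<le> right_modification r"
  unfolding right_modification_def by (intro cINF_greatest \<sigma>_mono ennreal_leI) auto

lemma right_modification_mono: "r \<le> s \<Longrightarrow> right_modification r \<le> right_modification s"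
  unfolding right_modification_def by (intro cINF_superset_mono bdd_below_\<sigma>) auto

lemma right_modification_nonneg: "0 \<le> right_modification r"
  using le_right_modification[of r] \<sigma>_nonneg[of "ennreal r"] by simp

lemma right_modification_nonpos:
  assumes "r \<le> 0"
  shows "right_modification r = 0"
proof -
  have "right_modification 0 < e" if "0 < e" for e
    using \<sigma>_at_right_0[OF that] right_modification_le[of 0] by (meson le_less_trans)
  then have "right_modification 0 \<le> 0"
    using less_irrefl not_le by blast
  then show ?thesis
    using right_modification_mono[OF assms] right_modification_nonneg[of r] by simp
qed

lemma real_distribution_stieltjes: "real_distribution (stieltjes \<sigma>)"
  and cdf_stieltjes: "cdf (stieltjes \<sigma>) = right_modification"
proof -
  have right_cont: "continuous (at_right a) right_modification" for a
    unfolding continuous_within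
  proof (rule order_tendstoI)
    fix y assume "y < right_modification a"
    show "\<forall>\<^sub>F x in at_right a. y < right_modification x"
      using eventually_at_right_real[of a "a + 1", simplified]
    proof eventually_elim
      case (elim x)
      then show ?case
        using \<open>y < right_modification a\<close> right_modification_mono[of a x] by simp
    qed
  next
    fix y assume "right_modification a < y"
    then obtain s where s: "a < s" "\<sigma> (ennreal s) < y"
      unfolding right_modification_def using cINF_less_iff[OF _ bdd_below_\<sigma>, of "{a<..}" y] by auto
    show "\<forall>\<^sub>F x in at_right a. right_modification x < y"
      using eventually_at_right_real[OF s(1)]
    proof eventually_elim
      case (elim x)
      then show ?case using s(2) right_modification_le[of x s] by simp
    qed
  qed
  have bot: "(right_modification \<longlongrightarrow> 0) at_bot"
    using eventually_le_at_bot[of "0::real"]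
    by (rule tendsto_eventually[OF eventually_mono]) (rule right_modification_nonpos)
  \<comment> \<open>Total mass one is the left continuity of \<open>\<sigma>\<close> at
    \<open>\<infinity>\<close>.\<close>
  have top: "(right_modification \<longlongrightarrow> 1) at_top"
  proof (rule order_tendstoI)
    fix y :: real assume "y < 1"
    then obtain b where b: "y < \<sigma> (ennreal b)"
      using \<sigma>_at_left[of \<infinity> y] dd by (auto simp: distance_distribution_def)
    show "\<forall>\<^sub>F x in at_top. y < right_modification x"
      using eventually_ge_at_top[of b]
    proof eventually_elim
      case (elim x)
      then show ?case
        using b \<sigma>_mono[of "ennreal b" "ennreal x"] le_right_modification[of x] by (simp add: ennreal_leI)
    qed
  next
    fix y :: real assume "1 < y"
    then have "right_modification x < y" for x
      using right_modification_le[of x "x + 1"] \<sigma>_le_1[of "ennreal (x + 1)"] by simp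
    then show "\<forall>\<^sub>F x in at_top. right_modification x < y" by simp
  qed
  show "real_distribution (stieltjes \<sigma>)"
    unfolding stieltjes_eq using right_modification_mono right_cont bot top
    by (rule real_distribution_interval_measure)
  show "cdf (stieltjes \<sigma>) = right_modification"
    unfolding stieltjes_eq using right_modification_mono right_cont bot
    by (rule cdf_interval_measure)
qed

sublocale S: real_distribution "stieltjes \<sigma>"
  by (rule real_distribution_stieltjes)

text \<open>The right modification has the same left limits as \<open>\<sigma>\<close>, and left
  continuity identifies the limit at \<open>d\<close>. So the open half-line receives the value at
  \<open>d\<close> itself and not the right limit.\<close>

lemma measure_stieltjes_lessThan:
  assumes "0 < d"
  shows "measure (stieltjes \<sigma>) {..<d} = \<sigma> (ennreal d)"
proof -
  have "(right_modification \<longlongrightarrow> \<sigma> (ennreal d)) (at_left d)"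
  proof (rule order_tendstoI)
    fix y assume "y < \<sigma> (ennreal d)"
    then obtain b where b: "0 \<le> b" "ennreal b < ennreal d" "y < \<sigma> (ennreal b)"
      using \<sigma>_at_left[of "ennreal d" y] assms by auto
    then have "b < d" by (simp add: ennreal_less_iff)
    from eventually_at_left_real[OF this] show "\<forall>\<^sub>F x in at_left d. y < right_modification x"
    proof eventually_elim
      case (elim x)
      then show ?case
        using b \<sigma>_mono[of "ennreal b" "ennreal x"] le_right_modification[of x] by (simp add: ennreal_leI)
    qed
  next
    fix y assume "\<sigma> (ennreal d) < y"
    show "\<forall>\<^sub>F x in at_left d. right_modification x < y"
      using eventually_at_left_real[of "d - 1" d, simplified]
    proof eventually_elim
      case (elim x)
      then show ?case using \<open>\<sigma> (ennreal d) < y\<close> right_modification_le[of x d] by simp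
    qed
  qed
  moreover have "(right_modification \<longlongrightarrow> measure (stieltjes \<sigma>) {..<d}) (at_left d)"
    using S.cdf_at_left[of d] by (simp add: cdf_stieltjes)
  ultimately show ?thesis
    using tendsto_unique trivial_limit_at_left_real by blast
qed

lemma measure_stieltjes_nonpos: "measure (stieltjes \<sigma>) {..0} = 0"
  using cdf_stieltjes right_modification_nonpos[of 0] by (metis cdf_def2 order_refl)

lemma measure_stieltjes_0: "measure (stieltjes \<sigma>) {0} = 0"
  using S.finite_measure_mono[of "{0}" "{..0}"] measure_stieltjes_nonpos
  by (simp add: measure_le_0_iff)

lemma measure_stieltjes_greaterThanLessThan:
  assumes "0 < d"
  shows "measure (stieltjes \<sigma>) {0<..<d} = \<sigma> (ennreal d)"
proof -
  have "{0<..<d} = {..<d} - {..0}" by auto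
  then show ?thesis
    using assms S.finite_measure_Diff[of "{..<d}" "{..0}"] measure_stieltjes_lessThan[OF assms]
      measure_stieltjes_nonpos by (auto simp: subset_eq)
qed

lemma measure_stieltjes_greaterThan: "measure (stieltjes \<sigma>) {0<..} = 1"
proof -
  have "{0<..} = UNIV - {..0::real}" by auto
  then show ?thesis
    using S.finite_measure_Diff[of UNIV "{..0}"] measure_stieltjes_nonpos S.prob_space by simp
qed

end


section \<open>The isotropic Markov operator\<close>

locale isotropic_space =
  ultrametric_measure_space space_type M + distance_distribution_function \<sigma>
  for space_type :: "'a::metric_space itself" and M :: "'a measure" and \<sigma> :: "ennreal \<Rightarrow> real"
begin

text \<open>Many radii give the same ball. Grouping them by ball turns an integral over
  \<open>r\<close> into a sum over countably many balls, which opens the way to measurability and to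
  the exchange of integrals.\<close>

definition radii :: "'a set \<Rightarrow> real set" where
  "radii A = {r. 0 < r \<and> (\<exists>x. cball x r = A)}"

lemma radii_iff:
  assumes "x \<in> A"
  shows "r \<in> radii A \<longleftrightarrow> 0 < r \<and> cball x r = A"
proof
  assume "r \<in> radii A"
  then obtain y where "0 < r" "cball y r = A" by (auto simp: radii_def)
  then show "0 < r \<and> cball x r = A" using cball_eq[of x y r] assms by simp
qed (auto simp: radii_def)

lemma radii_sets:
  assumes "A \<in> positive_balls"
  shows "radii A \<in> sets borel"
proof -
  obtain x where x: "x \<in> A" using is_ball_nonempty[OF positive_ball_is_ball[OF assms]] by auto
  have "is_interval (radii A)"
    unfolding is_interval_1
  proof (intro ballI allI impI, elim conjE)
    fix a b c assume "a \<in> radii A" "b \<in> radii A" "a \<le> c" "c \<le> b"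
    then have "0 < c" "cball x c = A"
      using x subset_cball[of a c x] subset_cball[of c b x] by (simp_all add: radii_iff)
    then show "c \<in> radii A" using x by (simp add: radii_iff)
  qed
  then show ?thesis by (rule real_interval_borel_measurable)
qed

section \<open>Averages over balls as functions of centre and radius\<close>

definition avg :: "('a \<Rightarrow> real) \<Rightarrow> 'a set \<Rightarrow> real" where
  "avg f A = l2_inner M f (indicator A) / measure M A"

definition positive_average :: "('a \<Rightarrow> real) \<Rightarrow> 'a \<Rightarrow> real \<Rightarrow> real" where
  "positive_average f x r = indicator {0<..} r * avg f (cball x r)"

text \<open>Since \<open>d\<sigma>\<close> has no atom at \<open>0\<close>, only balls of positive radius matter.\<close>

lemma isotropic_markov_eq:
  "isotropic_markov M \<sigma> f x = (\<integral>r. positive_average f x r \<partial>stieltjes \<sigma>)"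
proof -
  have "(\<integral>r. indicator {0..} r *\<^sub>R ball_average M r f x \<partial>stieltjes \<sigma>)
      = (\<integral>r. positive_average f x r \<partial>stieltjes \<sigma>)"
  proof (rule integral_discrete_difference[where X="{0}"])
    show "emeasure (stieltjes \<sigma>) {r} = 0" if "r \<in> {0}" for r
      using that measure_stieltjes_0 by (simp add: S.emeasure_eq_measure)
    show "indicator {0..} r *\<^sub>R ball_average M r f x = positive_average f x r" if "r \<notin> {0}" for r
      using that by (auto simp: positive_average_def avg_def ball_average_def l2_inner_def
          set_lebesgue_integral_def indicator_def mult.commute)
  qed auto
  then show ?thesis by (simp add: isotropic_markov_def set_lebesgue_integral_def)
qed

text \<open>The function \<open>h\<close> of balls is arbitrary, but the product space is covered by
  the half-space of non-positive radii and countably many measurable boxes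
  \<open>A \<times> radii A\<close>, and the function is constant on each of these.\<close>

lemma ball_function_measurable:
  fixes h :: "'a set \<Rightarrow> real"
  shows "(\<lambda>(x, r). indicator {0<..} r * h (cball x r)) \<in> borel_measurable (M \<Otimes>\<^sub>M stieltjes \<sigma>)"
    (is "?f \<in> _")
proof -
  let ?C = "insert (UNIV \<times> {..0}) ((\<lambda>A. A \<times> radii A) ` positive_balls)"
  show ?thesis
  proof (rule measurable_piecewise_restrict[where C = "?C"])
    show "countable ?C" using countable_balls by simp
    show "\<Omega> \<inter> space (M \<Otimes>\<^sub>M stieltjes \<sigma>) \<in> sets (M \<Otimes>\<^sub>M stieltjes \<sigma>)" if "\<Omega> \<in> ?C" for \<Omega>
    proof -
      have "A \<times> radii A \<in> sets (M \<Otimes>\<^sub>M stieltjes \<sigma>)" if "A \<in> positive_balls" for A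
        using positive_ball_sets[OF that] radii_sets[OF that] by (intro pair_measureI) auto
      moreover have "UNIV \<times> {..0} \<in> sets (M \<Otimes>\<^sub>M stieltjes \<sigma>)"
        using sets.top[of M] by (intro pair_measureI) auto
      ultimately have "\<Omega> \<in> sets (M \<Otimes>\<^sub>M stieltjes \<sigma>)"
        using that by (elim insertE imageE) simp_all
      then show ?thesis by (rule sets.Int[OF _ sets.top])
    qed
    show "space (M \<Otimes>\<^sub>M stieltjes \<sigma>) \<subseteq> \<Union> ?C"
    proof
      fix p assume "p \<in> space (M \<Otimes>\<^sub>M stieltjes \<sigma>)"
      obtain x r where p: "p = (x, r)" by (cases p)
      show "p \<in> \<Union> ?C"
      proof (cases "0 < r")
        case True
        then have "p \<in> cball x r \<times> radii (cball x r)" by (auto simp: p radii_def)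
        then show ?thesis using cball_positive_ball[OF True, of x] by blast
      qed (auto simp: p)
    qed
    fix \<Omega> assume \<Omega>: "\<Omega> \<in> ?C"
    have "\<exists>c. \<forall>p\<in>\<Omega>. ?f p = c"
    proof (cases "\<Omega> = UNIV \<times> {..0}")
      case True
      then show ?thesis by (intro exI[of _ 0]) auto
    next
      case False
      then obtain A where "\<Omega> = A \<times> radii A" using \<Omega> by auto
      then show ?thesis by (intro exI[of _ "h A"]) (auto simp: radii_iff)
    qed
    then obtain c where c: "\<forall>p\<in>\<Omega>. ?f p = c" by (rule exE)
    have "?f \<in> borel_measurable (restrict_space (M \<Otimes>\<^sub>M stieltjes \<sigma>) \<Omega>) \<longleftrightarrow>
        (\<lambda>p. c) \<in> borel_measurable (restrict_space (M \<Otimes>\<^sub>M stieltjes \<sigma>) \<Omega>)"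
      by (rule measurable_cong) (use c in \<open>simp add: space_restrict_space\<close>)
    then show "?f \<in> borel_measurable (restrict_space (M \<Otimes>\<^sub>M stieltjes \<sigma>) \<Omega>)" by simp
  qed
qed

lemma positive_average_measurable:
  "case_prod (positive_average f) \<in> borel_measurable (M \<Otimes>\<^sub>M stieltjes \<sigma>)"
  using ball_function_measurable[of "avg f"] by (simp add: positive_average_def[abs_def])

lemma positive_average_measurable_radius [measurable]:
  "positive_average f x \<in> borel_measurable (stieltjes \<sigma>)"
  using measurable_Pair2[OF positive_average_measurable, of x f] by simp

lemma isotropic_markov_measurable [measurable]: "isotropic_markov M \<sigma> f \<in> borel_measurable M"
  unfolding isotropic_markov_eq[abs_def]
  by (rule S.borel_measurable_lebesgue_integral) (rule positive_average_measurable)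

text \<open>For \<open>r > 0\<close> exactly one ball \<open>A\<close> has \<open>x \<in> A\<close>
  and \<open>r \<in> radii A\<close>, namely \<open>cball x r\<close>. The sum over balls may then
  be exchanged with the integral.\<close>

lemma nn_integral_balls:
  fixes c :: "'a set \<Rightarrow> ennreal"
  shows "(\<integral>\<^sup>+r. c (cball x r) * indicator {0<..} r \<partial>stieltjes \<sigma>)
    = (\<integral>\<^sup>+A. c A * indicator A x * emeasure (stieltjes \<sigma>) (radii A) \<partial>count_space positive_balls)"
proof -
  have *: "c (cball x r) * indicator {0<..} r
      = (\<integral>\<^sup>+A. c A * indicator A x * indicator (radii A) r \<partial>count_space positive_balls)" for r
  proof (cases "0 < r")
    case True
    have "(\<integral>\<^sup>+A. c A * indicator A x * indicator (radii A) r \<partial>count_space positive_balls)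
        = (\<integral>\<^sup>+A. c (cball x r) * indicator {cball x r} A \<partial>count_space positive_balls)"
    proof (intro nn_integral_cong)
      fix A
      show "c A * indicator A x * indicator (radii A) r = c (cball x r) * indicator {cball x r} A"
        using True radii_iff[of x A r] by (cases "x \<in> A") (auto simp: indicator_def)
    qed
    also have "\<dots> = c (cball x r) * emeasure (count_space positive_balls) {cball x r}"
      using cball_positive_ball[OF True] by (intro nn_integral_cmult_indicator) auto
    also have "\<dots> = c (cball x r)"
      using cball_positive_ball[OF True] by simp
    finally show ?thesis using True by simp
  qed (simp add: radii_def)
  have "(\<integral>\<^sup>+r. c (cball x r) * indicator {0<..} r \<partial>stieltjes \<sigma>)
      = (\<integral>\<^sup>+A. \<integral>\<^sup>+r. c A * indicator A x * indicator (radii A) r \<partial>stieltjes \<sigma> \<partial>count_space positive_balls)"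
    unfolding * using countable_balls radii_sets
    by (intro nn_integral_count_space_nn_integral) auto
  also have "\<dots> = (\<integral>\<^sup>+A. c A * indicator A x * emeasure (stieltjes \<sigma>) (radii A) \<partial>count_space positive_balls)"
    using radii_sets by (intro nn_integral_cong nn_integral_cmult_indicator) auto
  finally show ?thesis .
qed

lemma avg_square_le:
  assumes f: "f \<in> L2 M" and A: "A \<in> positive_balls"
  shows "ennreal ((avg f A)\<^sup>2) * emeasure M A \<le> (\<integral>\<^sup>+x. ennreal ((f x)\<^sup>2) * indicator A x \<partial>M)"
proof -
  have [measurable]: "A \<in> sets M" "f \<in> borel_measurable M"
    using A f by (auto intro: positive_ball_sets L2_measurable)
  \<comment> \<open>Restricting \<open>f\<close> to \<open>A\<close> localises Cauchy-Schwarz, so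
    that the bound involves the square of \<open>f\<close> on \<open>A\<close> only.\<close>
  let ?f = "\<lambda>x. indicator A x * f x"
  have sq: "(\<lambda>x. (?f x)\<^sup>2) = (\<lambda>x. indicator A x *\<^sub>R (f x)\<^sup>2)"
    by (auto simp: indicator_def)
  have "integrable M (\<lambda>x. indicator A x *\<^sub>R (f x)\<^sup>2)"
    using f by (intro integrable_mult_indicator) (auto simp: L2_def)
  then have L2: "?f \<in> L2 M"
    by (simp only: L2_def mem_Collect_eq sq) simp
  have inner: "l2_inner M f (indicator A) = l2_inner M ?f (indicator A)"
    unfolding l2_inner_def by (intro Bochner_Integration.integral_cong) (auto simp: indicator_def)
  have pos: "0 < measure M A" using A by (rule positive_ball_measure_pos)
  have "(avg f A)\<^sup>2 * measure M A = (l2_inner M ?f (indicator A))\<^sup>2 / measure M A"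
    using pos by (simp add: avg_def inner power_divide power2_eq_square)
  also have "\<dots> \<le> l2_inner M ?f ?f"
    using l2_Cauchy_Schwarz[OF L2 indicator_L2[OF A]] inner_indicator[OF A A] pos
    by (simp add: divide_le_eq)
  finally have "ennreal ((avg f A)\<^sup>2 * measure M A) \<le> ennreal (l2_inner M ?f ?f)"
    by (rule ennreal_leI)
  also have "\<dots> = (\<integral>\<^sup>+x. ennreal ((?f x)\<^sup>2) \<partial>M)"
    using L2 by (simp add: nn_integral_square_L2)
  also have "\<dots> = (\<integral>\<^sup>+x. ennreal ((f x)\<^sup>2) * indicator A x \<partial>M)"
    by (intro nn_integral_cong) (auto simp: indicator_def)
  finally show ?thesis
    using positive_ball_emeasure[OF A] by (simp add: ennreal_mult)
qed

text \<open>With the sum over balls outside, \<open>avg_square_le\<close> applies to each ball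
  separately. After exchanging back, the weights of the balls around \<open>x\<close> add up to the
  total mass one of \<open>stieltjes \<sigma>\<close>.\<close>

lemma nn_integral_positive_average_le:
  assumes f: "f \<in> L2 M"
  shows "(\<integral>\<^sup>+x. \<integral>\<^sup>+r. ennreal ((positive_average f x r)\<^sup>2) \<partial>stieltjes \<sigma> \<partial>M) \<le> ennreal (l2_inner M f f)"
proof -
  have [measurable]: "f \<in> borel_measurable M" using f by (rule L2_measurable)
  let ?w = "\<lambda>A. emeasure (stieltjes \<sigma>) (radii A)" and ?c = "\<lambda>A. ennreal ((avg f A)\<^sup>2)"
  have "(\<integral>\<^sup>+x. \<integral>\<^sup>+r. ennreal ((positive_average f x r)\<^sup>2) \<partial>stieltjes \<sigma> \<partial>M)
      = (\<integral>\<^sup>+x. \<integral>\<^sup>+A. ?c A * indicator A x * ?w A \<partial>count_space positive_balls \<partial>M)"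
    unfolding nn_integral_balls[symmetric]
    by (intro nn_integral_cong) (auto simp: positive_average_def indicator_def)
  also have "\<dots> = (\<integral>\<^sup>+A. \<integral>\<^sup>+x. ?c A * indicator A x * ?w A \<partial>M \<partial>count_space positive_balls)"
    using countable_balls positive_ball_sets by (intro nn_integral_count_space_nn_integral) auto
  also have "\<dots> \<le> (\<integral>\<^sup>+A. \<integral>\<^sup>+x. ennreal ((f x)\<^sup>2) * indicator A x * ?w A \<partial>M \<partial>count_space positive_balls)"
  proof (rule nn_integral_mono)
    fix A :: "'a set" assume "A \<in> space (count_space positive_balls)"
    then have A: "A \<in> positive_balls" by simp
    have [measurable]: "A \<in> sets M" using A by (rule positive_ball_sets)
    have "(\<integral>\<^sup>+x. ?c A * indicator A x * ?w A \<partial>M) = ?c A * emeasure M A * ?w A"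
      by (simp add: nn_integral_multc nn_integral_cmult)
    also have "\<dots> \<le> (\<integral>\<^sup>+x. ennreal ((f x)\<^sup>2) * indicator A x \<partial>M) * ?w A"
      by (intro mult_right_mono avg_square_le f A) simp
    also have "\<dots> = (\<integral>\<^sup>+x. ennreal ((f x)\<^sup>2) * indicator A x * ?w A \<partial>M)"
      by (simp add: nn_integral_multc)
    finally show "(\<integral>\<^sup>+x. ?c A * indicator A x * ?w A \<partial>M)
      \<le> (\<integral>\<^sup>+x. ennreal ((f x)\<^sup>2) * indicator A x * ?w A \<partial>M)" .
  qed
  also have "\<dots> = (\<integral>\<^sup>+x. \<integral>\<^sup>+A. ennreal ((f x)\<^sup>2) * indicator A x * ?w A \<partial>count_space positive_balls \<partial>M)"
    using countable_balls positive_ball_sets by (intro nn_integral_count_space_nn_integral[symmetric]) auto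
  also have "\<dots> = (\<integral>\<^sup>+x. \<integral>\<^sup>+r. ennreal ((f x)\<^sup>2) * indicator {0<..} r \<partial>stieltjes \<sigma> \<partial>M)"
    by (subst nn_integral_balls[of "\<lambda>A. ennreal ((f x)\<^sup>2)" x for x]) simp
  also have "\<dots> \<le> (\<integral>\<^sup>+x. ennreal ((f x)\<^sup>2) \<partial>M)"
  proof (intro nn_integral_mono)
    fix x
    have "(\<integral>\<^sup>+r. ennreal ((f x)\<^sup>2) * indicator {0<..} r \<partial>stieltjes \<sigma>)
        = ennreal ((f x)\<^sup>2) * emeasure (stieltjes \<sigma>) {0<..}"
      by (intro nn_integral_cmult_indicator) simp
    also have "\<dots> = ennreal ((f x)\<^sup>2)"
      by (simp add: S.emeasure_eq_measure measure_stieltjes_greaterThan)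
    finally show "(\<integral>\<^sup>+r. ennreal ((f x)\<^sup>2) * indicator {0<..} r \<partial>stieltjes \<sigma>) \<le> ennreal ((f x)\<^sup>2)"
      by simp
  qed
  also have "\<dots> = ennreal (l2_inner M f f)" using f by (rule nn_integral_square_L2)
  finally show ?thesis .
qed

lemma one_L2: "(\<lambda>r. 1) \<in> L2 (stieltjes \<sigma>)"
  by (simp add: L2_def)

text \<open>The integral of a non-integrable function is 0 by convention. Integrability in
  \<open>r\<close> for almost every \<open>x\<close> is therefore what makes the Markov operator
  additive.\<close>

lemma AE_positive_average_L2:
  assumes f: "f \<in> L2 M"
  shows "AE x in M. positive_average f x \<in> L2 (stieltjes \<sigma>)"
proof -
  have "(\<lambda>x. \<integral>\<^sup>+r. ennreal ((positive_average f x r)\<^sup>2) \<partial>stieltjes \<sigma>) \<in> borel_measurable M"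
    using positive_average_measurable[of f]
    by (intro S.borel_measurable_nn_integral) (simp add: split_def)
  moreover have "(\<integral>\<^sup>+x. \<integral>\<^sup>+r. ennreal ((positive_average f x r)\<^sup>2) \<partial>stieltjes \<sigma> \<partial>M) \<noteq> \<infinity>"
    using nn_integral_positive_average_le[OF f] by (auto simp: top_unique)
  ultimately have "AE x in M. (\<integral>\<^sup>+r. ennreal ((positive_average f x r)\<^sup>2) \<partial>stieltjes \<sigma>) \<noteq> \<infinity>"
    by (rule nn_integral_PInf_AE)
  then show ?thesis
    by eventually_elim (rule L2_I_nn_integral, auto simp: less_top)
qed

lemma positive_average_integrable:
  assumes "positive_average f x \<in> L2 (stieltjes \<sigma>)"
  shows "integrable (stieltjes \<sigma>) (positive_average f x)"
  using L2_mult_integrable[OF assms one_L2] by simp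

text \<open>\<open>stieltjes \<sigma>\<close> is a probability measure, so Cauchy-Schwarz against
  the constant 1 takes the square inside the integral.\<close>

lemma isotropic_markov_square_le:
  assumes f: "f \<in> L2 M"
  shows "(\<integral>\<^sup>+x. ennreal ((isotropic_markov M \<sigma> f x)\<^sup>2) \<partial>M) \<le> ennreal (l2_inner M f f)"
proof -
  have "(\<integral>\<^sup>+x. ennreal ((isotropic_markov M \<sigma> f x)\<^sup>2) \<partial>M)
      \<le> (\<integral>\<^sup>+x. \<integral>\<^sup>+r. ennreal ((positive_average f x r)\<^sup>2) \<partial>stieltjes \<sigma> \<partial>M)"
  proof (rule nn_integral_mono_AE, use AE_positive_average_L2[OF f] in eventually_elim)
    case (elim x)
    have "l2_inner (stieltjes \<sigma>) (\<lambda>r. 1) (\<lambda>r. 1) = 1"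
      using S.prob_space by (simp add: l2_inner_def)
    then have "(isotropic_markov M \<sigma> f x)\<^sup>2
        \<le> l2_inner (stieltjes \<sigma>) (positive_average f x) (positive_average f x)"
      using l2_Cauchy_Schwarz[OF elim one_L2]
      by (simp add: isotropic_markov_eq) (simp add: l2_inner_def)
    then show ?case using elim by (simp add: nn_integral_square_L2 ennreal_leI)
  qed
  also note nn_integral_positive_average_le[OF f]
  finally show ?thesis .
qed

lemma isotropic_markov_L2: "f \<in> L2 M \<Longrightarrow> isotropic_markov M \<sigma> f \<in> L2 M"
  by (rule L2_I_nn_integral[OF isotropic_markov_measurable le_less_trans[OF isotropic_markov_square_le]])
    auto

lemma isotropic_markov_contraction:
  assumes "f \<in> L2 M"
  shows "l2_inner M (isotropic_markov M \<sigma> f) (isotropic_markov M \<sigma> f) \<le> l2_inner M f f"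
  using isotropic_markov_square_le[OF assms] isotropic_markov_L2[OF assms]
  by (simp add: nn_integral_square_L2 l2_inner_self_nonneg)

lemma isotropic_markov_linear: "l2_linear M (isotropic_markov M \<sigma>)"
  unfolding l2_linear_def
proof (intro conjI ballI allI impI)
  fix f g assume f: "f \<in> L2 M" and g: "g \<in> L2 M"
  show "AE x in M. isotropic_markov M \<sigma> f x = isotropic_markov M \<sigma> g x" if "AE x in M. f x = g x"
  proof -
    have "positive_average f x r = positive_average g x r" for x r
    proof (cases "0 < r")
      case True
      then have "l2_inner M f (indicator (cball x r)) = l2_inner M g (indicator (cball x r))"
        using f g \<open>AE x in M. f x = g x\<close>
        by (intro l2_inner_cong_AE indicator_L2 cball_positive_ball)
      then show ?thesis by (simp add: positive_average_def avg_def)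
    qed (simp add: positive_average_def)
    then show ?thesis by (simp add: isotropic_markov_eq)
  qed
  fix a b
  have *: "positive_average (\<lambda>y. a * f y + b * g y) x r
      = a * positive_average f x r + b * positive_average g x r" for x r
  proof (cases "0 < r")
    case True
    then have "indicator (cball x r) \<in> L2 M" by (intro indicator_L2 cball_positive_ball)
    then have "l2_inner M (\<lambda>y. a * f y + b * g y) (indicator (cball x r))
        = a * l2_inner M f (indicator (cball x r)) + b * l2_inner M g (indicator (cball x r))"
      using f g by (simp add: l2_inner_add_left l2_inner_cmult_left L2_cmult)
    with True show ?thesis by (simp add: positive_average_def avg_def add_divide_distrib)
  qed (simp add: positive_average_def)
  show "AE x in M. isotropic_markov M \<sigma> (\<lambda>y. a * f y + b * g y) x
      = a * isotropic_markov M \<sigma> f x + b * isotropic_markov M \<sigma> g x"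
    using AE_positive_average_L2[OF f] AE_positive_average_L2[OF g]
    by eventually_elim (simp add: isotropic_markov_eq * positive_average_integrable)
qed (rule isotropic_markov_L2)

section \<open>Action of the Markov operator on the functions \<open>ball_fun M C\<close>\<close>

definition markov_eigenvalue :: "'a set \<Rightarrow> real" where
  "markov_eigenvalue C = (if C = UNIV then 1 else \<sigma> (ennreal (diameter (parent C))))"

lemma isotropic_markov_ball_fun:
  assumes C: "C \<in> positive_balls"
  shows "isotropic_markov M \<sigma> (ball_fun M C) x = markov_eigenvalue C * ball_fun M C x"
proof -
  have avg_const: "avg (ball_fun M C) (cball x r) = ball_fun M C x"
    if r: "0 < r" "C = UNIV \<or> \<not> parent C \<subseteq> cball x r" for r
  proof -
    let ?A = "cball x r"
    have A: "?A \<in> positive_balls" using r by (intro cball_positive_ball)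
    have eq: "ball_fun M C y * indicator ?A y = ball_fun M C x * indicator ?A y" for y
      using ball_fun_const[OF C positive_ball_is_ball[OF A] r(2), of y x] r
      by (cases "y \<in> ?A") (auto simp del: mem_cball)
    have "l2_inner M (ball_fun M C) (indicator ?A) = ball_fun M C x * measure M ?A"
      unfolding l2_inner_def eq using positive_ball_sets[OF A] by simp
    then show ?thesis
      using positive_ball_measure_pos[OF A] by (simp add: avg_def)
  qed
  show ?thesis
  proof (cases "C = UNIV")
    case True
    then have "positive_average (ball_fun M C) x r = indicator {0<..} r" for r
      using avg_const[of r] by (auto simp: positive_average_def ball_fun_UNIV indicator_def)
    then show ?thesis
      using True by (simp add: isotropic_markov_eq measure_stieltjes_greaterThan markov_eigenvalue_def ball_fun_UNIV)
  next
    case False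
    let ?d = "diameter (parent C)"
    have d: "0 < ?d" using C False by (rule diameter_parent_pos)
    have zero: "avg (ball_fun M C) (cball x r) = 0" if "0 < r" "parent C \<subseteq> cball x r" for r
      using inner_ball_fun_superset[OF C False cball_positive_ball[OF that(1)] that(2)]
      by (simp add: avg_def)
    \<comment> \<open>The range of radii is open at \<open>?d\<close>: the closed ball of radius
      \<open>?d\<close> about a point of the parent is already the parent, over which the mean is
      zero. This matches the left continuity of \<open>\<sigma>\<close>.\<close>
    have "positive_average (ball_fun M C) x r = indicator {0<..<?d} r * ball_fun M C x" for r
    proof (cases "x \<in> parent C")
      case True
      have "parent C \<subseteq> cball x r \<longleftrightarrow> ?d \<le> r"
      proof
        obtain y where y: "y \<in> parent C" "dist x y = ?d"
          using diameter_parent_attained[OF C False True] by auto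
        assume "parent C \<subseteq> cball x r"
        then have "y \<in> cball x r" using y(1) by (rule subsetD)
        then show "?d \<le> r" using y(2) by simp
      next
        assume "?d \<le> r"
        then have "cball x ?d \<subseteq> cball x r" by (rule subset_cball)
        then show "parent C \<subseteq> cball x r" by (simp only: parent_eq_cball[OF C False True, symmetric])
      qed
      then show ?thesis
        using avg_const[of r] zero[of r] by (auto simp: positive_average_def indicator_def)
    next
      case outside: False
      \<comment> \<open>Off the parent every average vanishes, either as a mean over a ball that
        contains the parent or as the constant value 0.\<close>
      then show ?thesis
        using avg_const[of r] zero[of r] ball_fun_outside[OF C False outside]
        by (cases "parent C \<subseteq> cball x r") (auto simp: positive_average_def indicator_def)
    qed
    then show ?thesis
      using False measure_stieltjes_greaterThanLessThan[OF d]
      by (simp add: isotropic_markov_eq markov_eigenvalue_def)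
  qed
qed

end


section \<open>Eigenvalues of the isotropic Laplacian\<close>

context ultrametric_measure_space
begin

text \<open>If \<open>C \<noteq> UNIV\<close>, the value on \<open>C\<close> is 1/\<mu>(C) -
  1/\<mu>(B) with \<open>B\<close> the parent. It is non-zero because \<open>B - C\<close> is open
  and non-empty, hence of positive measure by full support.\<close>

lemma ball_fun_nonzero:
  assumes C: "C \<in> positive_balls"
  shows "\<not> (AE x in M. ball_fun M C x = 0)"
proof
  assume AE: "AE x in M. ball_fun M C x = 0"
  have [measurable]: "C \<in> sets M" using C by (rule positive_ball_sets)
  have "ball_fun M C x \<noteq> 0" if "x \<in> C" for x
  proof (cases "C = UNIV")
    case False
    let ?B = "parent C"
    have B: "?B \<in> positive_balls" using C False by (rule parent_positive_ball)
    have "open (?B - C)"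
      using positive_ball_open[OF B] compact_imp_closed[OF is_ball_compact[OF positive_ball_is_ball[OF C]]]
      by (rule open_Diff)
    moreover have "?B - C \<noteq> {}"
      using subset_parent[OF C False] parent_neq[OF C False] by blast
    ultimately have pos: "0 < emeasure M (?B - C)"
      using full_support by (simp add: full_support_def)
    have "emeasure M ?B = emeasure M C + emeasure M (?B - C)"
      using subset_parent[OF C False] positive_ball_sets[OF B]
      by (subst plus_emeasure) (auto simp: Un_absorb1)
    then have "emeasure M ?B \<noteq> emeasure M C"
      using pos positive_ball_finite[OF C] by (auto simp: ennreal_add_left_cancel)
    then have "measure M ?B \<noteq> measure M C"
      using positive_ball_emeasure[OF B] positive_ball_emeasure[OF C] by simp
    then show ?thesis
      using that subset_parent[OF C False] positive_ball_measure_pos[OF B] positive_ball_measure_pos[OF C]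
      by (auto simp: ball_fun_eq[OF False] indicator_def)
  qed (simp add: ball_fun_UNIV)
  then have "AE x in M. x \<notin> C"
    using AE by (auto elim!: eventually_mono)
  then have "emeasure M C = 0"
    by (simp add: AE_iff_measurable[of C M "\<lambda>x. x \<notin> C"])
  then show False
    using positive_ball_measure_pos[OF C] by (simp add: measure_def)
qed

lemma compactly_supported_ball_fun:
  assumes C: "C \<in> positive_balls"
  shows "compactly_supported (ball_fun M C)"
proof -
  define B where "B = (if C = UNIV then C else parent C)"
  have B: "compact B"
    unfolding B_def
    using is_ball_compact[OF positive_ball_is_ball[OF C]] is_ball_compact[OF parent_is_ball[OF C]]
    by (cases "C = UNIV") simp_all
  have "{x. ball_fun M C x \<noteq> 0} \<subseteq> B"
    using ball_fun_outside[OF C] by (auto simp: B_def)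
  then have "closure {x. ball_fun M C x \<noteq> 0} \<subseteq> B"
    using compact_imp_closed[OF B] by (rule closure_minimal)
  then have "compact (B \<inter> closure {x. ball_fun M C x \<noteq> 0})"
    using B by (intro compact_Int_closed closed_closure)
  with \<open>closure _ \<subseteq> B\<close> show ?thesis
    unfolding compactly_supported_def by (simp add: Int_absorb1)
qed

end

context isotropic_space
begin

text \<open>Functions with the same parent ball share the eigenvalue and span one spectral subspace; the
  empty set is the index of the constant functions, which occur for compact \<open>X\<close> only.\<close>

definition parent_index :: "'a set \<Rightarrow> 'a set" where
  "parent_index C = (if C = UNIV then {} else parent C)"

definition parent_number :: "'a set \<Rightarrow> nat" where
  "parent_number C = to_nat_on (parent_index ` positive_balls) (parent_index C)"

text \<open>The constant function 1 has squared norm \<mu>(X), so its weight is the reciprocal; the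
  other weights are those of \<open>ball_fun_reproducing\<close>.\<close>

definition frame_weight :: "'a set \<Rightarrow> real" where
  "frame_weight C = (if C = UNIV then 1 / measure M C else measure M C)"

text \<open>For a number that is not a \<open>parent_number\<close> the value is arbitrary. Its
  fibre is empty, and only the bound by 1 matters there.\<close>

definition spectral_value :: "nat \<Rightarrow> real" where
  "spectral_value n = (let B = from_nat_into (parent_index ` positive_balls) n
     in if B = {} then 1 else \<sigma> (ennreal (diameter B)))"

lemma parent_number_eq_iff:
  "\<lbrakk>C \<in> positive_balls; C' \<in> positive_balls\<rbrakk> \<Longrightarrow>
    parent_number C = parent_number C' \<longleftrightarrow> parent_index C = parent_index C'"
  unfolding parent_number_def using countable_balls by (simp add: to_nat_on_inj)

lemma parent_nonempty: "C \<in> positive_balls \<Longrightarrow> C \<noteq> UNIV \<Longrightarrow> parent C \<noteq> {}"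
  for C :: "'a set"
  by (rule is_ball_nonempty[OF parent_is_ball])

lemma spectral_value_parent_number:
  assumes "C \<in> positive_balls"
  shows "spectral_value (parent_number C) = markov_eigenvalue C"
proof -
  have "from_nat_into (parent_index ` positive_balls) (parent_number C) = parent_index C"
    unfolding parent_number_def using countable_balls assms by (intro from_nat_into_to_nat_on) auto
  then show ?thesis
    using parent_nonempty[OF assms]
    by (simp add: spectral_value_def markov_eigenvalue_def parent_index_def)
qed

lemma parent_number_fibre:
  assumes C: "C \<in> positive_balls"
  shows "{C'\<in>positive_balls. parent_number C' = parent_number C} = (if C = UNIV then {UNIV} else siblings C)"
proof (cases "C = UNIV")
  case True
  have "parent_number C' = parent_number C \<longleftrightarrow> C' = UNIV" if "C' \<in> positive_balls" for C'
    unfolding parent_number_eq_iff[OF that C]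
    using parent_nonempty[OF that] True by (auto simp: parent_index_def)
  then show ?thesis using C True by auto
next
  case False
  have "parent_number C' = parent_number C \<longleftrightarrow> C' \<noteq> UNIV \<and> parent C' = parent C"
    if "C' \<in> positive_balls" for C'
    using parent_nonempty[OF C False] False
    by (auto simp: parent_number_eq_iff[OF that C] parent_index_def)
  then show ?thesis
    unfolding siblings_def using False by (simp cong: conj_cong)
qed

sublocale frame: eigenframe M "positive_balls" "ball_fun M" frame_weight parent_number
proof
  show "finite {C\<in>positive_balls. parent_number C = n}" for n
  proof (cases "\<exists>C\<in>positive_balls. parent_number C = n")
    case True
    then obtain C where C: "C \<in> positive_balls" "n = parent_number C" by auto
    show ?thesis
      unfolding C(2) parent_number_fibre[OF C(1)] using siblings_finite[OF C(1)] by simp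
  next
    case False
    then have "{C\<in>positive_balls. parent_number C = n} = {}" by auto
    then show ?thesis by (simp only: finite.emptyI)
  qed
next
  fix C C' :: "'a set" assume C: "C \<in> positive_balls" "C' \<in> positive_balls" "parent_number C \<noteq> parent_number C'"
  then have neq: "parent_index C \<noteq> parent_index C'" by (simp add: parent_number_eq_iff)
  have *: "l2_inner M (ball_fun M A) (ball_fun M A') = 0"
    if "A \<in> positive_balls" "A' \<in> positive_balls" "A \<noteq> UNIV" "A' = UNIV \<or> \<not> parent A' \<subseteq> parent A" for A A'
    using ball_fun_orthogonal that by blast
  \<comment> \<open>Two different parents cannot each contain the other, so the asymmetric condition
    of \<open>ball_fun_orthogonal\<close> holds in at least one order.\<close>
  consider "C \<noteq> UNIV" "C' = UNIV \<or> \<not> parent C' \<subseteq> parent C"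
    | "C' \<noteq> UNIV" "C = UNIV \<or> \<not> parent C \<subseteq> parent C'"
    using neq by (auto simp: parent_index_def split: if_splits)
  then show "l2_inner M (ball_fun M C) (ball_fun M C') = 0"
    using *[OF C(1,2)] *[OF C(2,1)] by cases (simp_all add: l2_inner_commute)
next
  fix C :: "'a set" and x assume C: "C \<in> positive_balls"
  show "(\<Sum>C'\<in>{C'\<in>positive_balls. parent_number C' = parent_number C}.
      frame_weight C' * l2_inner M (ball_fun M C) (ball_fun M C') * ball_fun M C' x) = ball_fun M C x"
    unfolding parent_number_fibre[OF C]
  proof (cases "C = UNIV")
    case True
    then show "(\<Sum>C'\<in>(if C = UNIV then {UNIV} else siblings C).
      frame_weight C' * l2_inner M (ball_fun M C) (ball_fun M C') * ball_fun M C' x) = ball_fun M C x"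
      using inner_indicator[OF C C] positive_ball_measure_pos[OF C]
      by (simp add: frame_weight_def ball_fun_UNIV)
  next
    case False
    have "frame_weight C' = measure M C'" if "C' \<in> siblings C" for C'
      using that by (simp add: siblings_def frame_weight_def)
    with False show "(\<Sum>C'\<in>(if C = UNIV then {UNIV} else siblings C).
      frame_weight C' * l2_inner M (ball_fun M C) (ball_fun M C') * ball_fun M C' x) = ball_fun M C x"
      using ball_fun_reproducing[OF C False, of x] by simp
  qed
qed (simp_all add: ball_fun_L2 ball_fun_total)

text \<open>The map \<open>h\<close> is strictly increasing on positive numbers, so the
  \<open>dist\<close>-ball of radius \<open>?d\<close> is the intrinsic ball of radius
  \<open>h ?d\<close>. No smaller intrinsic radius works because the diameter of the parent is
  attained.\<close>

lemma intrinsic_radius_parent: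
  fixes C :: "'a set"
  assumes C: "C \<in> positive_balls" "C \<noteq> UNIV"
  shows "intrinsic_radius \<sigma> (parent C) = 1 / ln (1 / \<sigma> (ennreal (diameter (parent C))))"
proof -
  let ?d = "diameter (parent C)"
  define h where "h t = 1 / ln (1 / \<sigma> (ennreal t))" for t
  have d: "0 < ?d" using C by (rule diameter_parent_pos)
  have ln_pos: "0 < ln (1 / \<sigma> (ennreal t))" if "0 < t" for t
    using \<sigma>_pos[OF that] \<sigma>_less_1[of t] by (simp add: ln_gt_zero)
  have h_pos: "0 < h t" if "0 < t" for t
    using ln_pos[OF that] by (simp add: h_def)
  have h_less: "h s < h t" if "0 < s" "s < t" for s t
  proof -
    have t: "0 < t" using that by simp
    have "\<sigma> (ennreal s) < \<sigma> (ennreal t)"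
      using that by (intro \<sigma>_less) (simp add: ennreal_less_iff)
    then have "ln (1 / \<sigma> (ennreal t)) < ln (1 / \<sigma> (ennreal s))"
      using \<sigma>_pos[OF that(1)] \<sigma>_pos[OF t] by (simp add: ln_div)
    then show ?thesis
      unfolding h_def using ln_pos[OF t] by (intro divide_strict_left_mono) (auto intro: mult_pos_pos ln_pos that)
  qed
  have dist_le: "intrinsic_dist \<sigma> x y \<le> h ?d \<longleftrightarrow> dist x y \<le> ?d" for x y :: 'a
  proof (cases "x = y")
    case True
    then show ?thesis using h_pos[OF d] d by (simp add: intrinsic_dist_def)
  next
    case False
    then have "intrinsic_dist \<sigma> x y = h (dist x y)" "0 < dist x y"
      by (simp_all add: intrinsic_dist_def h_def)
    then show ?thesis
      using h_less[of "dist x y" ?d] h_less[of ?d "dist x y"] d by (cases "dist x y" ?d rule: linorder_cases) auto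
  qed
  have "intrinsic_radius \<sigma> (parent C) = h ?d"
    unfolding intrinsic_radius_def
  proof (rule Least_equality, intro conjI ballI)
    show "0 \<le> h ?d" using h_pos[OF d] by simp
    fix x assume "x \<in> parent C"
    then have "parent C = cball x ?d" by (rule parent_eq_cball[OF C])
    also have "\<dots> = {y. intrinsic_dist \<sigma> x y \<le> h ?d}" by (auto simp: dist_le)
    finally show "parent C = {y. intrinsic_dist \<sigma> x y \<le> h ?d}" .
  next
    fix r assume r: "0 \<le> r \<and> (\<forall>x\<in>parent C. parent C = {y. intrinsic_dist \<sigma> x y \<le> r})"
    obtain x where x: "x \<in> parent C" using parent_nonempty[OF C] by auto
    obtain y where y: "y \<in> parent C" "dist x y = ?d" using diameter_parent_attained[OF C x] by auto
    have "parent C = {y. intrinsic_dist \<sigma> x y \<le> r}" using r x by (elim conjE) (rule bspec)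
    then have "intrinsic_dist \<sigma> x y \<le> r" using y(1) by blast
    moreover have "x \<noteq> y" using y(2) d by auto
    ultimately show "h ?d \<le> r" using y(2) by (simp add: intrinsic_dist_def h_def)
  qed
  then show ?thesis by (simp add: h_def)
qed

text \<open>The two reciprocals cancel for a proper ball; for \<open>UNIV\<close> both sides are 0,
  since the Markov eigenvalue is 1.\<close>

lemma ball_eigenvalue_eq:
  assumes "C \<in> positive_balls"
  shows "ball_eigenvalue \<sigma> C = ln (1 / markov_eigenvalue C)"
  using intrinsic_radius_parent[OF assms] by (simp add: ball_eigenvalue_def markov_eigenvalue_def)

lemma eigenfunction_ball_fun:
  assumes C: "C \<in> positive_balls"
  shows "eigenfunction M (isotropic_laplacian M \<sigma>) (ball_fun M C) (ball_eigenvalue \<sigma> C)"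
proof -
  have "functional_calculus M (isotropic_markov M \<sigma>) (\<lambda>s. ln (1 / s)) (ball_fun M C)
      (\<lambda>x. ln (1 / spectral_value (parent_number C)) * ball_fun M C x)"
  proof (rule frame.functional_calculus_frame)
    show "\<bar>spectral_value n\<bar> \<le> 1" for n
      using \<sigma>_nonneg \<sigma>_le_1 by (simp add: spectral_value_def Let_def)
    show "AE x in M. isotropic_markov M \<sigma> (ball_fun M A) x = spectral_value (parent_number A) * ball_fun M A x"
      if "A \<in> positive_balls" for A
      using isotropic_markov_ball_fun[OF that] by (simp add: spectral_value_parent_number[OF that])
  qed (use C in \<open>auto intro: isotropic_markov_linear isotropic_markov_contraction\<close>)
  then show ?thesis
    unfolding eigenfunction_def isotropic_laplacian_def
    using C by (simp add: ball_fun_L2 ball_fun_nonzero spectral_value_parent_number ball_eigenvalue_eq)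
qed

end

theorem theorem3p8:
  fixes M :: "'a::metric_space measure" and \<sigma> :: "ennreal \<Rightarrow> real"
  assumes "ultrametric TYPE('a)"
    and "separable_space (euclidean :: 'a topology)"
    and "\<And>(x::'a) r. compact (cball x r)"
    and "radon_measure M"
    and "full_support M"
    and "\<not> compact (UNIV :: 'a set) \<Longrightarrow> emeasure M UNIV = \<infinity>"
    and "distance_distribution \<sigma>"
  shows "(\<forall>C\<in>positive_balls.
            eigenfunction M (isotropic_laplacian M \<sigma>) (ball_fun M C) (ball_eigenvalue \<sigma> C)) \<and>
         l2_complete M (ball_fun M ` positive_balls) \<and>
         (\<exists>F. (\<forall>f\<in>F. compactly_supported f \<and>
                      (\<exists>c. eigenfunction M (isotropic_laplacian M \<sigma>) f c)) \<and>
              l2_complete M F)"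
proof -
  interpret isotropic_space "TYPE('a)" M \<sigma>
    using assms by unfold_locales
  have "l2_complete M (ball_fun M ` positive_balls)"
    by (rule frame.l2_complete_frame)
  then show ?thesis
    using eigenfunction_ball_fun compactly_supported_ball_fun
    by (intro conjI ballI exI[of _ "ball_fun M ` positive_balls"]) auto
qed

end
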